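(* Let $Y$ be a stratifiable space and let $X\subset Y$ be a closed subset containing more than one point. Then there exists a regular tricontinuous extension operator $T:\mathbb{R}^{X\times X}\to\mathbb{R}^{Y\times Y}$ which preserves the class of bounded functions, the class of continuous functions, the class of pseudometrics and the class of metrics. If, moreover, $Y$ is metrizable, then $T$ can be required in addition to preserve the class of dominating metrics and the class of admissible metrics. Moreover, for each of the following two conditions, the operator $T$ can be constructed so that (in addition to the properties above) that condition is satisfied: (1) if $Y$ is completely metrizable and $X$ is compact, then $T$ preserves the class of complete admissible metrics; (2) if $Y$ is separable and $\dim (Y\setminus X)<\infty$, then $T$ preserves the class of totally bounded pseudometrics.
   Context: A Hausdorff space $Y$ is stratifiable if to every open set $U\subset Y$ one can assign a sequence $\{U_n\}_{n=1}^\infty$ of open subsets of $Y$ such that (a) $\overline{U_n}\subset U$, (b) $\bigcup_{n=1}^\infty U_n=U$, and (c) $U_n\subset V_n$ for all $n$ whenever $U\subset V$ are open. (Every metrizable space is stratifiable.) For a topological space $Z$, $\mathbb{R}^Z$ is the vector lattice of all (not necessarily continuous) real-valued functions on $Z$. Let $T:\mathbb{R}^{X\times X}\to\mathbb{R}^{Y\times Y}$ with $X\subset Y$. $T$ is an extension operator if $T(p)|_{X\times X}=p$ for every $p$. $T$ is regular if it is linear, positive ($p\ge 0$ implies $T(p)\ge 0$), and maps the constant function $1$ to the constant function $1$. $T$ is tricontinuous if it is continuous in each of three cases: when both function spaces carry the topology of uniform convergence, when both carry the topology of pointwise convergence, and when both carry the compact-open topology (the topology of uniform convergence on compact sets). $T$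 preserves a class of functions if, whenever $p:X\times X\to\mathbb{R}$ belongs to the class (relative to $X$), $T(p):Y\times Y\to\mathbb{R}$ belongs to the class (relative to $Y$). (Pseudo)metrics on a topological space are not assumed to be continuous or related to the topology. A metric $d$ on a topological space $Z$ is dominating if for every $z\in Z$ and every open neighborhood $U$ of $z$ there is $\varepsilon>0$ with $\{z'\in Z: d(z,z')<\varepsilon\}\subset U$. A metric is admissible if it is dominating and continuous as a function on $Z\times Z$ (i.e. it generates the topology of $Z$). A pseudometric $p$ on $Z$ is totally bounded if for every $\varepsilon>0$ there is a finite set $A\subset Z$ such that every $z\in Z$ satisfies $\min_{a\in A}p(z,a)<\varepsilon$. $\dim$ denotes covering dimension. *)

theory Defs
  imports "HOL-Analysis.Analysis"
begin

section \<open>Stratifiable spaces and covering dimension\<close>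

text \<open>The sequence of open sets assigned to \<open>U\<close> is indexed from 0 instead of 1.\<close>

definition stratifiable_space :: "'a topology \<Rightarrow> bool" where
  "stratifiable_space Y \<longleftrightarrow>
     Hausdorff_space Y \<and>
     (\<exists>G :: 'a set \<Rightarrow> nat \<Rightarrow> 'a set.
        (\<forall>U. openin Y U \<longrightarrow>
           (\<forall>n. openin Y (G U n) \<and> Y closure_of (G U n) \<subseteq> U) \<and> (\<Union>n. G U n) = U) \<and>
        (\<forall>U V n. openin Y U \<and> openin Y V \<and> U \<subseteq> V \<longrightarrow> G U n \<subseteq> G V n))"

text \<open>
  Covering dimension via finite open covers: order at most \<open>n\<close> of a cover means that every
  point lies in at most \<open>n + 1\<close> of its members.  Dimension \<open>-1\<close> (the empty space) is
  subsumed under \<open>n = 0\<close>, which is harmless as only finiteness of the dimension is used.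
\<close>

definition covering_dim_le :: "'a topology \<Rightarrow> nat \<Rightarrow> bool" where
  "covering_dim_le Z n \<longleftrightarrow>
     (\<forall>\<U>. finite \<U> \<and> (\<forall>U\<in>\<U>. openin Z U) \<and> \<Union>\<U> = topspace Z \<longrightarrow>
        (\<exists>\<V>. finite \<V> \<and> (\<forall>V\<in>\<V>. openin Z V) \<and> \<Union>\<V> = topspace Z \<and>
             (\<forall>V\<in>\<V>. \<exists>U\<in>\<U>. V \<subseteq> U) \<and>
             (\<forall>z\<in>topspace Z. card {V \<in> \<V>. z \<in> V} \<le> n + 1)))"

definition finite_covering_dim :: "'a topology \<Rightarrow> bool" where
  "finite_covering_dim Z \<longleftrightarrow> (\<exists>n. covering_dim_le Z n)"

section \<open>The function spaces and their topologies\<close>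

abbreviation sq :: "'a topology \<Rightarrow> ('a \<times> 'a) set" where
  "sq Z \<equiv> topspace Z \<times> topspace Z"

text \<open>Real functions on \<open>S\<close> are represented extensionally (value \<open>undefined\<close> off \<open>S\<close>).\<close>

abbreviation rfun :: "'b set \<Rightarrow> ('b \<Rightarrow> real) set" where
  "rfun S \<equiv> S \<rightarrow>\<^sub>E UNIV"

definition conv_nbhd :: "'b set \<Rightarrow> 'b set \<Rightarrow> real \<Rightarrow> ('b \<Rightarrow> real) \<Rightarrow> ('b \<Rightarrow> real) set" where
  "conv_nbhd S K e f = {g \<in> rfun S. \<forall>s\<in>K. \<bar>g s - f s\<bar> < e}"

text \<open>
  The topology of uniform convergence on the members of \<open>\<K>\<close>.  These sets do form a topology
  if \<open>\<K>\<close> is closed under finite unions, see below.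
\<close>

definition uniform_conv_on_topology :: "'b set \<Rightarrow> 'b set set \<Rightarrow> ('b \<Rightarrow> real) topology" where
  "uniform_conv_on_topology S \<K> = topology (\<lambda>W. W \<subseteq> rfun S \<and>
     (\<forall>f\<in>W. \<exists>K\<in>\<K>. \<exists>e>0. conv_nbhd S K e f \<subseteq> W))"

definition uniform_conv_topology :: "'b set \<Rightarrow> ('b \<Rightarrow> real) topology" where
  "uniform_conv_topology S = uniform_conv_on_topology S {S}"

definition pointwise_conv_topology :: "'b set \<Rightarrow> ('b \<Rightarrow> real) topology" where
  "pointwise_conv_topology S = product_topology (\<lambda>_. euclideanreal) S"

text \<open>
  The functions need not be continuous, so the compact-open topology is taken to be the topology
  of uniform convergence on compact sets; the sets \<open>{f. f ` K \<subseteq> U}\<close> would not generate it.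
\<close>

definition compact_conv_topology :: "'b topology \<Rightarrow> ('b \<Rightarrow> real) topology" where
  "compact_conv_topology S = uniform_conv_on_topology (topspace S) {K. compactin S K}"

lemma openin_uniform_conv_on_topology:
  assumes directed: "\<And>K L. K \<in> \<K> \<Longrightarrow> L \<in> \<K> \<Longrightarrow> K \<union> L \<in> \<K>"
  shows "openin (uniform_conv_on_topology S \<K>) W \<longleftrightarrow>
    W \<subseteq> rfun S \<and> (\<forall>f\<in>W. \<exists>K\<in>\<K>. \<exists>e>0. conv_nbhd S K e f \<subseteq> W)"
proof -
  define P where "P = (\<lambda>W. W \<subseteq> rfun S \<and> (\<forall>f\<in>W. \<exists>K\<in>\<K>. \<exists>e>0. conv_nbhd S K e f \<subseteq> W))"
  have int: "P (V \<inter> W)" if V: "P V" and W: "P W" for V W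
    unfolding P_def
  proof (intro conjI ballI)
    show "V \<inter> W \<subseteq> rfun S" using V unfolding P_def by blast
    fix f assume f: "f \<in> V \<inter> W"
    obtain K d where d: "K \<in> \<K>" "d > 0" "conv_nbhd S K d f \<subseteq> V"
      using V f unfolding P_def by blast
    obtain L e where e: "L \<in> \<K>" "e > 0" "conv_nbhd S L e f \<subseteq> W"
      using W f unfolding P_def by blast
    have "conv_nbhd S (K \<union> L) (min d e) f \<subseteq> conv_nbhd S K d f \<inter> conv_nbhd S L e f"
      unfolding conv_nbhd_def by auto
    then have "conv_nbhd S (K \<union> L) (min d e) f \<subseteq> V \<inter> W"
      using d(3) e(3) by blast
    moreover have "min d e > 0"
      using d(2) e(2) by simp
    ultimately show "\<exists>K\<in>\<K>. \<exists>e>0. conv_nbhd S K e f \<subseteq> V \<inter> W"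
      using directed[OF d(1) e(1)] by blast
  qed
  have un: "P (\<Union>\<M>)" if all: "\<forall>M\<in>\<M>. P M" for \<M>
    unfolding P_def
  proof (intro conjI ballI)
    show "\<Union>\<M> \<subseteq> rfun S" using all unfolding P_def by blast
    fix f assume "f \<in> \<Union>\<M>"
    then obtain M where M: "M \<in> \<M>" "f \<in> M" by blast
    then obtain K e where "K \<in> \<K>" "e > 0" "conv_nbhd S K e f \<subseteq> M"
      using all unfolding P_def by blast
    moreover have "M \<subseteq> \<Union>\<M>" using M(1) by blast
    ultimately show "\<exists>K\<in>\<K>. \<exists>e>0. conv_nbhd S K e f \<subseteq> \<Union>\<M>"
      by (meson order_trans)
  qed
  have "istopology P"
    unfolding istopology_def using int un by blast
  moreover have "uniform_conv_on_topology S \<K> = topology P"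
    unfolding uniform_conv_on_topology_def P_def ..
  ultimately have "openin (uniform_conv_on_topology S \<K>) W = P W"
    by (metis topology_inverse')
  then show ?thesis
    unfolding P_def .
qed

lemma openin_uniform_conv_topology:
  "openin (uniform_conv_topology S) W \<longleftrightarrow>
    W \<subseteq> rfun S \<and> (\<forall>f\<in>W. \<exists>e>0. conv_nbhd S S e f \<subseteq> W)"
  unfolding uniform_conv_topology_def
  by (subst openin_uniform_conv_on_topology) auto

lemma openin_compact_conv_topology:
  "openin (compact_conv_topology S) W \<longleftrightarrow> W \<subseteq> rfun (topspace S) \<and>
     (\<forall>f\<in>W. \<exists>K\<in>{K. compactin S K}. \<exists>e>0. conv_nbhd (topspace S) K e f \<subseteq> W)"
  unfolding compact_conv_topology_def
  by (rule openin_uniform_conv_on_topology) (auto intro: compactin_Un)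

section \<open>Regular tricontinuous extension operators\<close>

definition extension_operator ::
    "'b set \<Rightarrow> 'b set \<Rightarrow> (('b \<Rightarrow> real) \<Rightarrow> ('b \<Rightarrow> real)) \<Rightarrow> bool" where
  "extension_operator A B T \<longleftrightarrow>
     T \<in> rfun A \<rightarrow> rfun B \<and> (\<forall>p\<in>rfun A. restrict (T p) A = p)"

definition regular_operator ::
    "'b set \<Rightarrow> 'b set \<Rightarrow> (('b \<Rightarrow> real) \<Rightarrow> ('b \<Rightarrow> real)) \<Rightarrow> bool" where
  "regular_operator A B T \<longleftrightarrow>
     (\<forall>p\<in>rfun A. \<forall>q\<in>rfun A. T (\<lambda>s\<in>A. p s + q s) = (\<lambda>s\<in>B. T p s + T q s)) \<and>
     (\<forall>c. \<forall>p\<in>rfun A. T (\<lambda>s\<in>A. c * p s) = (\<lambda>s\<in>B. c * T p s)) \<and>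
     (\<forall>p\<in>rfun A. (\<forall>s\<in>A. 0 \<le> p s) \<longrightarrow> (\<forall>s\<in>B. 0 \<le> T p s)) \<and>
     T (\<lambda>s\<in>A. 1) = (\<lambda>s\<in>B. 1)"

definition tricontinuous ::
    "'b topology \<Rightarrow> 'b topology \<Rightarrow> (('b \<Rightarrow> real) \<Rightarrow> ('b \<Rightarrow> real)) \<Rightarrow> bool" where
  "tricontinuous A B T \<longleftrightarrow>
     continuous_map (uniform_conv_topology (topspace A)) (uniform_conv_topology (topspace B)) T \<and>
     continuous_map (pointwise_conv_topology (topspace A)) (pointwise_conv_topology (topspace B)) T \<and>
     continuous_map (compact_conv_topology A) (compact_conv_topology B) T"

section \<open>Classes of functions on the square of a space\<close>

definition bounded_fun :: "'a topology \<Rightarrow> ('a \<times> 'a \<Rightarrow> real) \<Rightarrow> bool" where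
  "bounded_fun Z p \<longleftrightarrow> bounded (p ` sq Z)"

definition continuous_fun :: "'a topology \<Rightarrow> ('a \<times> 'a \<Rightarrow> real) \<Rightarrow> bool" where
  "continuous_fun Z p \<longleftrightarrow> continuous_map (prod_topology Z Z) euclideanreal p"

definition pseudometric :: "'a topology \<Rightarrow> ('a \<times> 'a \<Rightarrow> real) \<Rightarrow> bool" where
  "pseudometric Z p \<longleftrightarrow>
     (\<forall>x\<in>topspace Z. p (x, x) = 0) \<and>
     (\<forall>x\<in>topspace Z. \<forall>y\<in>topspace Z. 0 \<le> p (x, y) \<and> p (x, y) = p (y, x)) \<and>
     (\<forall>x\<in>topspace Z. \<forall>y\<in>topspace Z. \<forall>z\<in>topspace Z. p (x, z) \<le> p (x, y) + p (y, z))"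

text \<open>
  The locale \<^locale>\<open>Metric_space\<close> requires nonnegativity and symmetry also off the carrier, where
  an extensional function takes the unknown value \<open>undefined\<close>; hence the values there are
  replaced by 0.
\<close>

definition dist_fun :: "'a topology \<Rightarrow> ('a \<times> 'a \<Rightarrow> real) \<Rightarrow> 'a \<Rightarrow> 'a \<Rightarrow> real" where
  "dist_fun Z p x y = (if (x, y) \<in> sq Z then p (x, y) else 0)"

definition metric_fun :: "'a topology \<Rightarrow> ('a \<times> 'a \<Rightarrow> real) \<Rightarrow> bool" where
  "metric_fun Z p \<longleftrightarrow> Metric_space (topspace Z) (dist_fun Z p)"

lemma metric_fun_iff:
  "metric_fun Z p \<longleftrightarrow> pseudometric Z p \<and>
     (\<forall>x\<in>topspace Z. \<forall>y\<in>topspace Z. p (x, y) = 0 \<longrightarrow> x = y)"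
proof
  assume "metric_fun Z p"
  then interpret Metric_space "topspace Z" "dist_fun Z p"
    by (simp add: metric_fun_def)
  have eq: "p (x, y) = dist_fun Z p x y" if "x \<in> topspace Z" "y \<in> topspace Z" for x y
    using that by (simp add: dist_fun_def)
  show "pseudometric Z p \<and> (\<forall>x\<in>topspace Z. \<forall>y\<in>topspace Z. p (x, y) = 0 \<longrightarrow> x = y)"
    unfolding pseudometric_def
  proof (intro conjI ballI impI)
    fix x y z assume x: "x \<in> topspace Z" and y: "y \<in> topspace Z"
    show "p (x, x) = 0" using eq[OF x x] x by simp
    show "0 \<le> p (x, y)" using eq[OF x y] by simp
    show "p (x, y) = p (y, x)" using eq[OF x y] eq[OF y x] commute[of x y] by linarith
    show "x = y" if "p (x, y) = 0" using that eq[OF x y] zero[OF x y] by linarith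
    assume z: "z \<in> topspace Z"
    show "p (x, z) \<le> p (x, y) + p (y, z)"
      using eq[OF x z] eq[OF x y] eq[OF y z] triangle[OF x y z] by linarith
  qed
next
  assume asm: "pseudometric Z p \<and> (\<forall>x\<in>topspace Z. \<forall>y\<in>topspace Z. p (x, y) = 0 \<longrightarrow> x = y)"
  have "Metric_space (topspace Z) (dist_fun Z p)"
  proof
    fix x y z
    show "0 \<le> dist_fun Z p x y"
      using asm by (simp add: dist_fun_def pseudometric_def)
    show "dist_fun Z p x y = dist_fun Z p y x"
      using asm unfolding dist_fun_def pseudometric_def by (metis mem_Sigma_iff)
    assume x: "x \<in> topspace Z" and y: "y \<in> topspace Z"
    show "dist_fun Z p x y = 0 \<longleftrightarrow> x = y"
      using asm x y by (auto simp: dist_fun_def pseudometric_def)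
    assume z: "z \<in> topspace Z"
    show "dist_fun Z p x z \<le> dist_fun Z p x y + dist_fun Z p y z"
      using asm x y z by (simp add: dist_fun_def pseudometric_def)
  qed
  then show "metric_fun Z p"
    by (simp add: metric_fun_def)
qed

definition dominating_metric :: "'a topology \<Rightarrow> ('a \<times> 'a \<Rightarrow> real) \<Rightarrow> bool" where
  "dominating_metric Z p \<longleftrightarrow> metric_fun Z p \<and>
     (\<forall>z U. openin Z U \<and> z \<in> U \<longrightarrow> (\<exists>e>0. {z' \<in> topspace Z. p (z, z') < e} \<subseteq> U))"

definition admissible_metric :: "'a topology \<Rightarrow> ('a \<times> 'a \<Rightarrow> real) \<Rightarrow> bool" where
  "admissible_metric Z p \<longleftrightarrow> dominating_metric Z p \<and> continuous_fun Z p"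

definition complete_admissible_metric :: "'a topology \<Rightarrow> ('a \<times> 'a \<Rightarrow> real) \<Rightarrow> bool" where
  "complete_admissible_metric Z p \<longleftrightarrow>
     admissible_metric Z p \<and> Metric_space.mcomplete (topspace Z) (dist_fun Z p)"

definition totally_bounded_pseudometric :: "'a topology \<Rightarrow> ('a \<times> 'a \<Rightarrow> real) \<Rightarrow> bool" where
  "totally_bounded_pseudometric Z p \<longleftrightarrow> pseudometric Z p \<and>
     (\<forall>e>0. \<exists>A. finite A \<and> A \<subseteq> topspace Z \<and> (\<forall>z\<in>topspace Z. \<exists>a\<in>A. p (z, a) < e))"

section \<open>Preservation of classes\<close>

definition preserves ::
    "('a topology \<Rightarrow> ('a \<times> 'a \<Rightarrow> real) \<Rightarrow> bool) \<Rightarrow> 'a topology \<Rightarrow> 'a topology \<Rightarrow>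
     (('a \<times> 'a \<Rightarrow> real) \<Rightarrow> ('a \<times> 'a \<Rightarrow> real)) \<Rightarrow> bool" where
  "preserves C X Y T \<longleftrightarrow> (\<forall>p\<in>rfun (sq X). C X p \<longrightarrow> C Y (T p))"

definition good_extension_operator ::
    "'a topology \<Rightarrow> 'a topology \<Rightarrow> (('a \<times> 'a \<Rightarrow> real) \<Rightarrow> ('a \<times> 'a \<Rightarrow> real)) \<Rightarrow> bool" where
  "good_extension_operator X Y T \<longleftrightarrow>
     extension_operator (sq X) (sq Y) T \<and>
     regular_operator (sq X) (sq Y) T \<and>
     tricontinuous (prod_topology X X) (prod_topology Y Y) T \<and>
     preserves bounded_fun X Y T \<and>
     preserves continuous_fun X Y T \<and>
     preserves pseudometric X Y T \<and>
     preserves metric_fun X Y T \<and>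
     (metrizable_space Y \<longrightarrow>
        preserves dominating_metric X Y T \<and> preserves admissible_metric X Y T)"

end

theory Submission
  imports Defs
begin

text \<open>
  Let \<open>W\<close> be the complement of \<open>X\<close> and \<open>a \<noteq> b\<close> points of \<open>X\<close>.  As in Dugundji's extension theorem,
  a partition of unity on \<open>W\<close> with points of \<open>X\<close> attached to its members, which converge to \<open>s\<close> as
  the argument tends to \<open>s \<in> X\<close>, assigns to \<open>y \<in> W\<close> a probability measure on \<open>X\<close>.  Following Hartman
  and Mycielski, the measure is realized as the distribution of a step function on \<open>[0,1)\<close>.
  Choose a continuous \<open>r\<close> with zero set \<open>X\<close> and a continuous metric \<open>D \<le> 1\<close> on \<open>Y\<close>.  For \<open>e \<in> {a, b}\<close>
  let \<open>\<xi> e y\<close> be the step function of \<open>y\<close> with the values on \<open>[0, r y)\<close> replaced by \<open>e\<close>, and constantly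
  \<open>y\<close> for \<open>y \<in> X\<close>.  Then \<open>T p (y, y')\<close> is the mean of \<open>\<integral> p (\<xi> e y t, \<xi> e y' t) dt\<close> over \<open>e \<in> {a, b}\<close> plus
  \<open>min (r y) (r y') * D (y, y') * (p (a, b) - (p (a, a) + p (b, b)) / 2)\<close>.

  For a pseudometric \<open>p\<close> this is at least
  \<open>p (a, b) * (min (r y) (r y') * D (y, y') + \<bar>r y - r y'\<bar> / 2)\<close>, whence metrics extend to metrics, and
  domination and completeness are inherited from \<open>D\<close>, \<open>r\<close> and the partition.  If the partitions have
  bounded order, the step functions have boundedly many steps, and total boundedness is preserved.
\<close>

text \<open>Evaluating both step functions at the same \<open>t\<close> couples the two measures, so
  that the diagonal is sent to zero; integration over the product measure would not achieve this. As
  \<open>p\<close> is arbitrary, nothing is known about its measurability; step functions with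
  finitely many values turn the integrals into finite sums. The coupling alone does not separate
  points with equal measures, so an initial interval is given up to base points. A single base point
  would not do, since the other step function may take the same value; with two, every
  \<open>s\<close> satisfies \<open>p (a, s) + p (b, s) \<ge> p (a, b)\<close>, and the difference
  of \<open>r y\<close> and \<open>r y'\<close> becomes visible. Subtracting the mean of
  \<open>p (a, a)\<close> and \<open>p (b, b)\<close> turns the integrand on the common initial
  interval into a convex combination of values of \<open>p\<close>, whence positivity and
  preservation of constants for all \<open>p\<close>, not only for pseudometrics. If
  \<open>Y\<close> is not metrizable, no metric generates the topology: the cover and its attached
  points then come from the monotonicity of a stratification, and \<open>D\<close> is merely
  continuous.\<close>

lemma continuous_map_real_iff:
  fixes f :: "'a \<Rightarrow> real"
  shows "continuous_map Z euclideanreal f \<longleftrightarrow>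
    (\<forall>x\<in>topspace Z. \<forall>e>0. \<exists>N. openin Z N \<and> x \<in> N \<and> (\<forall>y\<in>N. \<bar>f y - f x\<bar> < e))"
proof
  assume f: "continuous_map Z euclideanreal f"
  show "\<forall>x\<in>topspace Z. \<forall>e>0. \<exists>N. openin Z N \<and> x \<in> N \<and> (\<forall>y\<in>N. \<bar>f y - f x\<bar> < e)"
  proof (intro ballI allI impI)
    fix x and e :: real assume "x \<in> topspace Z" "e > 0"
    then show "\<exists>N. openin Z N \<and> x \<in> N \<and> (\<forall>y\<in>N. \<bar>f y - f x\<bar> < e)"
      using openin_continuous_map_preimage[OF f, of "ball (f x) e"]
      by (intro exI[of _ "{y \<in> topspace Z. f y \<in> ball (f x) e}"])
        (auto simp: dist_real_def abs_minus_commute)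
  qed
next
  assume R: "\<forall>x\<in>topspace Z. \<forall>e>0. \<exists>N. openin Z N \<and> x \<in> N \<and> (\<forall>y\<in>N. \<bar>f y - f x\<bar> < e)"
  show "continuous_map Z euclideanreal f"
    unfolding continuous_map_def
  proof (intro conjI allI impI)
    fix V :: "real set" assume "openin euclideanreal V"
    then have V: "open V" by simp
    show "openin Z {x \<in> topspace Z. f x \<in> V}"
    proof (subst openin_subopen, intro ballI)
      fix x assume x: "x \<in> {x \<in> topspace Z. f x \<in> V}"
      then obtain e where e: "e > 0" "ball (f x) e \<subseteq> V"
        using V by (auto simp: open_contains_ball)
      obtain O' where O': "openin Z O'" "x \<in> O'" "\<forall>y\<in>O'. \<bar>f y - f x\<bar> < e"
        using R x e(1) by blast
      have "O' \<subseteq> {x \<in> topspace Z. f x \<in> V}"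
        using O' openin_subset[OF O'(1)] e(2) by (force simp: dist_real_def abs_minus_commute)
      then show "\<exists>T. openin Z T \<and> x \<in> T \<and> T \<subseteq> {x \<in> topspace Z. f x \<in> V}"
        using O' by blast
    qed
  qed auto
qed

text \<open>For functions that agree near each point with a different continuous formula: locally
  finite sums, and functions that depend on a label which is only locally constant.\<close>

lemma continuous_map_real_local:
  fixes f :: "'a \<Rightarrow> real"
  assumes "\<And>x. x \<in> topspace Z \<Longrightarrow>
    \<exists>N g. openin Z N \<and> x \<in> N \<and> continuous_map Z euclideanreal g \<and> (\<forall>y\<in>N. f y = g y)"
  shows "continuous_map Z euclideanreal f"
  unfolding continuous_map_real_iff
proof (intro ballI allI impI)
  fix x and e :: real assume x: "x \<in> topspace Z" and e: "e > 0"
  obtain O1 g where O1: "openin Z O1" "x \<in> O1" "continuous_map Z euclideanreal g"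
    "\<forall>y\<in>O1. f y = g y"
    using assms[OF x] by blast
  obtain O2 where O2: "openin Z O2" "x \<in> O2" "\<forall>y\<in>O2. \<bar>g y - g x\<bar> < e"
    using O1(3) x e unfolding continuous_map_real_iff by blast
  then show "\<exists>N. openin Z N \<and> x \<in> N \<and> (\<forall>y\<in>N. \<bar>f y - f x\<bar> < e)"
    using O1 by (intro exI[of _ "O1 \<inter> O2"]) auto
qed

lemma openin_real_less:
  fixes f :: "'a \<Rightarrow> real"
  assumes "continuous_map Z euclideanreal f"
  shows "openin Z {y \<in> topspace Z. f y < c}" "openin Z {y \<in> topspace Z. c < f y}"
  using openin_continuous_map_preimage[OF assms, of "{..<c}"]
    openin_continuous_map_preimage[OF assms, of "{c<..}"] by auto

section \<open>Stratifications\<close>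

text \<open>Besides monotonicity in the open set, \<open>monoG\<close> demands that
  \<open>G U n\<close> grows with \<open>n\<close>. This allows sets taken at different indices to
  be compared in \<open>sep_disjoint\<close> and \<open>core_meet\<close>.\<close>

locale stratification =
  fixes Z :: "'a topology" and G :: "'a set \<Rightarrow> nat \<Rightarrow> 'a set"
  assumes openG: "\<And>U n. openin Z U \<Longrightarrow> openin Z (G U n)"
    and closG: "\<And>U n. openin Z U \<Longrightarrow> Z closure_of (G U n) \<subseteq> U"
    and unG: "\<And>U. openin Z U \<Longrightarrow> (\<Union>n. G U n) = U"
    and monoG: "\<And>U V m n. openin Z U \<Longrightarrow> openin Z V \<Longrightarrow> U \<subseteq> V \<Longrightarrow> m \<le> n \<Longrightarrow> G U m \<subseteq> G V n"

text \<open>Unions of initial segments make the sequence increasing. Only finitely many sets enter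
  each union, so its closure is the union of their closures and stays inside
  \<open>U\<close>.\<close>

lemma stratifiable_space_imp_stratification:
  assumes "stratifiable_space Z"
  shows "\<exists>G. stratification Z G"
proof -
  obtain G where G: "\<And>U n. openin Z U \<Longrightarrow> openin Z (G U n)"
    "\<And>U n. openin Z U \<Longrightarrow> Z closure_of (G U n) \<subseteq> U"
    "\<And>U. openin Z U \<Longrightarrow> (\<Union>n::nat. G U n) = U"
    "\<And>U V n. openin Z U \<Longrightarrow> openin Z V \<Longrightarrow> U \<subseteq> V \<Longrightarrow> G U n \<subseteq> G V n"
    using assms unfolding stratifiable_space_def by metis
  have "stratification Z (\<lambda>U n. \<Union>i\<le>n. G U i)"
  proof
    fix U :: "'a set" and n assume U: "openin Z U"
    show "openin Z (\<Union>i\<le>n. G U i)" using G(1)[OF U] by blast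
    have "Z closure_of (\<Union>i\<le>n. G U i) = (\<Union>i\<le>n. Z closure_of G U i)"
      by (subst closure_of_Union) auto
    then show "Z closure_of (\<Union>i\<le>n. G U i) \<subseteq> U" using G(2)[OF U] by auto
    have "(\<Union>n. \<Union>i\<le>n. G U i) = (\<Union>n. G U n)" by blast
    then show "(\<Union>n. \<Union>i\<le>n. G U i) = U" using G(3)[OF U] by simp
  next
    fix U V :: "'a set" and m n :: nat
    assume "openin Z U" "openin Z V" "U \<subseteq> V" "m \<le> n"
    then show "(\<Union>i\<le>m. G U i) \<subseteq> (\<Union>i\<le>n. G V i)"
      using G(4)[of U V] by (fastforce intro: order_trans)
  qed
  then show ?thesis by blast
qed

context stratification
begin

lemma subset_closure: "openin Z U \<Longrightarrow> G U n \<subseteq> Z closure_of (G U n)"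
  using openG closure_of_subset openin_subset by metis

lemma closure_mono: "openin Z U \<Longrightarrow> openin Z V \<Longrightarrow> U \<subseteq> V \<Longrightarrow> m \<le> n \<Longrightarrow>
    Z closure_of (G U m) \<subseteq> Z closure_of (G V n)"
  using monoG closure_of_mono by metis

text \<open>An open subset of the open set \<open>W\<close> is open in \<open>Z\<close>, so the same
  operator serves, and closures taken in \<open>W\<close> only shrink. The partitions of unity live
  on such a \<open>W\<close>, the complement of the closed set.\<close>

lemma stratification_subtopology:
  assumes W: "openin Z W"
  shows "stratification (subtopology Z W) G"
proof
  have op: "openin (subtopology Z W) U \<longleftrightarrow> openin Z U \<and> U \<subseteq> W" for U
    using W by (simp add: openin_open_subtopology)
  fix U :: "'a set" and n assume "openin (subtopology Z W) U"
  then have U: "openin Z U" "U \<subseteq> W" using op by auto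
  show "openin (subtopology Z W) (G U n)"
    using op openG[OF U(1)] unG[OF U(1)] U(2) by blast
  show "subtopology Z W closure_of G U n \<subseteq> U"
    using closG[OF U(1)] closure_of_mono[of "W \<inter> G U n" "G U n" Z]
    by (fastforce simp: closure_of_subtopology)
  show "(\<Union>n. G U n) = U" by (rule unG[OF U(1)])
next
  fix U V :: "'a set" and m n :: nat
  assume "openin (subtopology Z W) U" "openin (subtopology Z W) V" "U \<subseteq> V" "m \<le> n"
  then show "G U m \<subseteq> G V n"
    using W monoG by (simp add: openin_open_subtopology)
qed

text \<open>The monotone normality operator of a stratification.\<close>

definition sep :: "'a set \<Rightarrow> 'a set \<Rightarrow> 'a set" where
  "sep A B = (\<Union>k. G (topspace Z - B) k - Z closure_of (G (topspace Z - A) k))"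

lemma openin_sep: "closedin Z A \<Longrightarrow> closedin Z B \<Longrightarrow> openin Z (sep A B)"
  unfolding sep_def
  by (intro openin_Union ballI) (auto intro!: openin_diff openG)

lemma sep_superset:
  assumes "closedin Z A" "closedin Z B" "A \<inter> B = {}"
  shows "A \<subseteq> sep A B"
proof
  fix x assume x: "x \<in> A"
  have oB: "openin Z (topspace Z - B)" and oA: "openin Z (topspace Z - A)" using assms by auto
  have "x \<in> topspace Z - B" using x assms closedin_subset by blast
  then obtain k where "x \<in> G (topspace Z - B) k" using unG[OF oB] by blast
  moreover have "x \<notin> Z closure_of (G (topspace Z - A) k)" using closG[OF oA] x by blast
  ultimately show "x \<in> sep A B" unfolding sep_def by blast
qed

text \<open>A common point carries an index from each union. The set containing it at the smaller
  index is contained in the one whose closure is removed at the larger index.\<close>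

lemma sep_disjoint:
  assumes "closedin Z A" "closedin Z B"
  shows "sep A B \<inter> sep B A = {}"
proof (rule ccontr)
  have oB: "openin Z (topspace Z - B)" and oA: "openin Z (topspace Z - A)" using assms by auto
  assume "sep A B \<inter> sep B A \<noteq> {}"
  then obtain z k l where z: "z \<in> G (topspace Z - B) k" "z \<notin> Z closure_of (G (topspace Z - A) k)"
    "z \<in> G (topspace Z - A) l" "z \<notin> Z closure_of (G (topspace Z - B) l)"
    unfolding sep_def by blast
  show False
  proof (cases "k \<le> l")
    case True
    then show False using z monoG[OF oB oB subset_refl True] subset_closure[OF oB] by blast
  next
    case False
    then have "l \<le> k" by simp
    then show False using z monoG[OF oA oA subset_refl] subset_closure[OF oA] by blast
  qed
qed

lemma sep_antimono:
  assumes "closedin Z B" "closedin Z B'" "B \<subseteq> B'"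
  shows "sep A B' \<subseteq> sep A B"
proof -
  have "G (topspace Z - B') k \<subseteq> G (topspace Z - B) k" for k
    using assms by (intro monoG) auto
  then show ?thesis unfolding sep_def by blast
qed

lemma normal_space: "normal_space Z"
  unfolding normal_space_def
proof (intro allI impI)
  fix S T assume ST: "closedin Z S \<and> closedin Z T \<and> disjnt S T"
  then have "S \<inter> T = {}" "T \<inter> S = {}" by (auto simp: disjnt_def)
  with ST show "\<exists>U V. openin Z U \<and> openin Z V \<and> S \<subseteq> U \<and> T \<subseteq> V \<and> disjnt U V"
    using sep_superset[of S T] sep_superset[of T S] sep_disjoint[of S T] openin_sep[of S T]
      openin_sep[of T S]
    unfolding disjnt_def by blast
qed

lemma urysohn:
  assumes "closedin Z S" "openin Z U" "S \<subseteq> U"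
  obtains f :: "'a \<Rightarrow> real" where "continuous_map Z euclideanreal f"
    "\<And>z. z \<in> topspace Z \<Longrightarrow> 0 \<le> f z \<and> f z \<le> 1" "\<And>z. z \<in> S \<Longrightarrow> f z = 1"
    "\<And>z. z \<in> topspace Z - U \<Longrightarrow> f z = 0"
proof -
  have "closedin Z (topspace Z - U)" "disjnt (topspace Z - U) S"
    using assms by (auto simp: disjnt_def)
  then obtain f :: "'a \<Rightarrow> real" where f: "continuous_map Z (top_of_set {0..1}) f"
    "f ` (topspace Z - U) \<subseteq> {0}" "f ` S \<subseteq> {1}"
    using Urysohn_lemma[OF normal_space, of "topspace Z - U" S 0 1] assms(1) by auto
  have "continuous_map Z euclideanreal f" "f ` topspace Z \<subseteq> {0..1}"
    using f(1) by (simp_all add: continuous_map_in_subtopology image_subset_iff_funcset)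
  moreover from this(2) have "\<And>z. z \<in> topspace Z \<Longrightarrow> 0 \<le> f z \<and> f z \<le> 1"
    by (simp add: image_subset_iff)
  ultimately show thesis using f(2,3) by (intro that) blast+
qed

end

text \<open>As \<open>v n \<le> 1\<close>, the tail from \<open>k\<close> on is at most
  \<open>(1/2)^k\<close>, so the partial sums converge uniformly. The two-sided estimates let later
  arguments replace the sum by finitely many terms or by a single one.\<close>

lemma continuous_map_suminf:
  fixes v :: "nat \<Rightarrow> 'a \<Rightarrow> real"
  assumes cont: "\<And>n. continuous_map Z euclideanreal (v n)"
    and bounds: "\<forall>n. \<forall>z\<in>topspace Z. 0 \<le> v n z \<and> v n z \<le> 1"
  shows "continuous_map Z euclideanreal (\<lambda>z. \<Sum>n. (1/2)^Suc n * v n z)"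
    and "z \<in> topspace Z \<Longrightarrow> summable (\<lambda>n. (1/2)^Suc n * v n z)"
    and "z \<in> topspace Z \<Longrightarrow> (\<Sum>n. (1/2)^Suc n * v n z) \<le> (\<Sum>n<k. (1/2)^Suc n * v n z) + (1/2)^k"
    and "z \<in> topspace Z \<Longrightarrow> (1/2)^Suc k * v k z \<le> (\<Sum>n. (1/2)^Suc n * v n z)"
    and "z \<in> topspace Z \<Longrightarrow> 0 \<le> (\<Sum>n. (1/2)^Suc n * v n z)"
    and "z \<in> topspace Z \<Longrightarrow> (\<Sum>n. (1/2)^Suc n * v n z) \<le> 1"
proof -
  let ?f = "\<lambda>z. \<Sum>n. (1/2)^Suc n * v n z"
  have bd: "\<And>n z. z \<in> topspace Z \<Longrightarrow> 0 \<le> v n z \<and> v n z \<le> 1" using bounds by blast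
  have geo: "(\<lambda>n. (1/2::real)^Suc n) sums 1" by (rule power_half_series)
  have le: "(1/2)^m * v n z \<le> (1/2)^m" if "z \<in> topspace Z" for z m n
    by (rule mult_left_le) (use bd[OF that] in simp_all)
  have sm: "summable (\<lambda>n. (1/2)^Suc n * v n z)" if z: "z \<in> topspace Z" for z
  proof (rule summable_comparison_test'[OF sums_summable[OF geo], of 0])
    fix n
    have "0 \<le> (1/2)^Suc n * v n z" using bd[OF z] by simp
    then show "norm ((1/2)^Suc n * v n z) \<le> (1/2)^Suc n"
      using le[OF z, of "Suc n" n] by (simp only: real_norm_def abs_of_nonneg)
  qed
  show "z \<in> topspace Z \<Longrightarrow> summable (\<lambda>n. (1/2)^Suc n * v n z)" by (rule sm)
  have tail: "?f z \<le> (\<Sum>n<k. (1/2)^Suc n * v n z) + (1/2)^k" if z: "z \<in> topspace Z" for z k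
  proof -
    have "?f z = (\<Sum>n. (1/2)^Suc (n+k) * v (n+k) z) + (\<Sum>n<k. (1/2)^Suc n * v n z)"
      by (rule suminf_split_initial_segment[OF sm[OF z]])
    moreover have "(\<Sum>n. (1/2)^Suc (n+k) * v (n+k) z) \<le> (\<Sum>n. (1/2)^Suc n * (1/2)^k)"
    proof (rule suminf_le)
      show "(1/2)^Suc (n+k) * v (n+k) z \<le> (1/2)^Suc n * (1/2)^k" for n
      proof -
        have "(1/2::real)^Suc (n+k) = (1/2)^Suc n * (1/2)^k"
          using power_add[of "1/2::real" "Suc n" k] by (simp only: add_Suc)
        then show ?thesis using le[OF z, of "Suc (n+k)" "n+k"] by linarith
      qed
      show "summable (\<lambda>n. (1/2)^Suc (n+k) * v (n+k) z)"
        using sm[OF z] by (subst summable_iff_shift)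
      show "summable (\<lambda>n. (1/2::real)^Suc n * (1/2)^k)"
        using geo sums_summable summable_mult2 by blast
    qed
    moreover have "(\<Sum>n. (1/2::real)^Suc n * (1/2)^k) = (1/2)^k"
      using suminf_mult2[OF sums_summable[OF geo], of "(1/2)^k"] sums_unique[OF geo] by simp
    ultimately show ?thesis by linarith
  qed
  show "z \<in> topspace Z \<Longrightarrow> ?f z \<le> (\<Sum>n<k. (1/2)^Suc n * v n z) + (1/2)^k" by (rule tail)
  have nn: "0 \<le> (1/2)^Suc n * v n z" if "z \<in> topspace Z" for z n using bd[OF that] by simp
  have low: "(\<Sum>n<k. (1/2)^Suc n * v n z) \<le> ?f z" if "z \<in> topspace Z" for z k
    by (rule sum_le_suminf[OF sm[OF that]]) (use nn[OF that] in auto)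
  show "0 \<le> ?f z" if "z \<in> topspace Z" using low[OF that, of 0] by simp
  show "?f z \<le> 1" if "z \<in> topspace Z" using tail[OF that, of 0] by simp
  show "(1/2)^Suc k * v k z \<le> ?f z" if "z \<in> topspace Z"
  proof -
    have "(1/2)^Suc k * v k z \<le> (\<Sum>n<Suc k. (1/2)^Suc n * v n z)"
      by (rule member_le_sum) (use nn[OF that] in auto)
    then show ?thesis using low[OF that, of "Suc k"] by linarith
  qed
  show "continuous_map Z euclideanreal ?f"
    unfolding continuous_map_real_iff
  proof (intro ballI allI impI)
    fix x and e :: real assume x: "x \<in> topspace Z" and e: "e > 0"
    obtain k where k: "(1/2::real)^k < e/2"
      using real_arch_pow_inv[of "e/2" "1/2"] e by auto
    have "continuous_map Z euclideanreal (\<lambda>z. \<Sum>n<k. (1/2)^Suc n * v n z)"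
      by (intro continuous_map_sum continuous_map_real_mult cont) auto
    then obtain O' where O': "openin Z O'" "x \<in> O'"
      "\<forall>y\<in>O'. \<bar>(\<Sum>n<k. (1/2)^Suc n * v n y) - (\<Sum>n<k. (1/2)^Suc n * v n x)\<bar> < e/2"
      using x e unfolding continuous_map_real_iff by (meson half_gt_zero)
    have "\<bar>?f y - ?f x\<bar> < e" if y: "y \<in> O'" for y
    proof -
      have "y \<in> topspace Z" using y O'(1) openin_subset by blast
      then show ?thesis
        using tail[of y k] tail[OF x, of k] low[of y k] low[OF x, of k] O'(3)[rule_format, OF y] k by linarith
    qed
    then show "\<exists>N. openin Z N \<and> x \<in> N \<and> (\<forall>y\<in>N. \<bar>?f y - ?f x\<bar> < e)"
      using O' by blast
  qed
qed

context stratification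
begin

text \<open>Perfect normality: \<open>U\<close> is the union of the closed sets
  \<open>Z closure_of (G U n)\<close>, and for each of them a Urysohn function that vanishes off
  \<open>U\<close> enters the series with weight \<open>(1/2)^Suc n\<close>.\<close>

lemma cozero:
  assumes U: "openin Z U"
  obtains f :: "'a \<Rightarrow> real" where "continuous_map Z euclideanreal f"
    "\<And>z. z \<in> topspace Z \<Longrightarrow> 0 \<le> f z \<and> f z \<le> 1"
    "\<And>z. z \<in> topspace Z \<Longrightarrow> 0 < f z \<longleftrightarrow> z \<in> U"
proof -
  define P where "P n f \<longleftrightarrow> continuous_map Z euclideanreal f \<and>
    (\<forall>z\<in>topspace Z. 0 \<le> f z \<and> f z \<le> 1) \<and> (\<forall>z\<in>Z closure_of (G U n). f z = 1) \<and>
    (\<forall>z\<in>topspace Z - U. f z = 0)" for n and f :: "'a \<Rightarrow> real"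
  have "\<exists>f. P n f" for n
  proof -
    obtain f :: "'a \<Rightarrow> real" where "continuous_map Z euclideanreal f"
      "\<And>z. z \<in> topspace Z \<Longrightarrow> 0 \<le> f z \<and> f z \<le> 1" "\<And>z. z \<in> Z closure_of (G U n) \<Longrightarrow> f z = 1"
      "\<And>z. z \<in> topspace Z - U \<Longrightarrow> f z = 0"
      by (rule urysohn[OF closedin_closure_of U closG[OF U], of n]) blast
    then show ?thesis unfolding P_def by blast
  qed
  then obtain v where "\<And>n. P n (v n)" by metis
  then have v: "\<And>n. continuous_map Z euclideanreal (v n)"
    "\<And>n z. z \<in> topspace Z \<Longrightarrow> 0 \<le> v n z \<and> v n z \<le> 1"
    "\<And>n z. z \<in> Z closure_of (G U n) \<Longrightarrow> v n z = 1"
    "\<And>n z. z \<in> topspace Z - U \<Longrightarrow> v n z = 0"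
    unfolding P_def by blast+
  have v2: "\<forall>n. \<forall>z\<in>topspace Z. 0 \<le> v n z \<and> v n z \<le> 1" using v(2) by blast
  note S = continuous_map_suminf[of Z v, OF v(1) v2]
  show thesis
  proof (rule that[of "\<lambda>z. \<Sum>n. (1/2)^Suc n * v n z"])
    show "continuous_map Z euclideanreal (\<lambda>z. \<Sum>n. (1/2)^Suc n * v n z)" by (rule S(1))
  next
    fix z assume z: "z \<in> topspace Z"
    show "0 \<le> (\<Sum>n. (1/2)^Suc n * v n z) \<and> (\<Sum>n. (1/2)^Suc n * v n z) \<le> 1"
      using S(5,6)[OF z] by blast
    show "0 < (\<Sum>n. (1/2)^Suc n * v n z) \<longleftrightarrow> z \<in> U"
    proof
      assume "z \<in> U"
      then obtain k where "z \<in> G U k" using unG[OF U] by blast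
      then have "v k z = 1" using v(3) subset_closure[OF U] by blast
      then have "0 < (1/2)^Suc k * v k z" by simp
      then show "0 < (\<Sum>n. (1/2)^Suc n * v n z)" using S(4)[OF z, of k] by linarith
    next
      assume *: "0 < (\<Sum>n. (1/2)^Suc n * v n z)"
      show "z \<in> U"
      proof (rule ccontr)
        assume "z \<notin> U"
        then have "v n z = 0" for n using v(4) z by blast
        then show False using * by simp
      qed
    qed
  qed
qed

end

text \<open>The functions indexed by \<open>j\<close> of an ordinary partition are those obtained from \<open>\<psi> n\<close> by
  restriction to the open set where \<open>\<psi> n\<close> is positive and labelled \<open>j\<close>.\<close>

locale labelled_partition =
  fixes Z :: "'a topology" and J :: "'j set" and U :: "'j \<Rightarrow> 'a set"
    and \<psi> :: "nat \<Rightarrow> 'a \<Rightarrow> real" and c :: "nat \<Rightarrow> 'a \<Rightarrow> 'j"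
  assumes cont: "\<And>n. continuous_map Z euclideanreal (\<psi> n)"
    and bounds: "\<And>n z. z \<in> topspace Z \<Longrightarrow> 0 \<le> \<psi> n z \<and> \<psi> n z \<le> 1"
    and locfin: "\<And>z. z \<in> topspace Z \<Longrightarrow>
      \<exists>N k. openin Z N \<and> z \<in> N \<and> (\<forall>y\<in>N. \<forall>n\<ge>k. \<psi> n y = 0)"
    and pos: "\<And>z. z \<in> topspace Z \<Longrightarrow> \<exists>n. 0 < \<psi> n z"
    and locconst: "\<And>n z. z \<in> topspace Z \<Longrightarrow>
      \<exists>N j. openin Z N \<and> z \<in> N \<and> (\<forall>y\<in>N. 0 < \<psi> n y \<longrightarrow> c n y = j)"
    and label: "\<And>n z. z \<in> topspace Z \<Longrightarrow> 0 < \<psi> n z \<Longrightarrow> c n z \<in> J \<and> z \<in> U (c n z)"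

lemma well_order_on_least:
  assumes "well_order_on J r" "j \<in> J" "P j"
  shows "\<exists>i\<in>J. P i \<and> (\<forall>k\<in>J. (k, i) \<in> r \<and> k \<noteq> i \<longrightarrow> \<not> P k)"
proof -
  have wf: "wf (r - Id)" using assms(1) by (simp add: well_order_on_def)
  have "j \<in> {i \<in> J. P i}" using assms by simp
  then have "\<exists>i\<in>{i \<in> J. P i}. \<forall>k. (k, i) \<in> r - Id \<longrightarrow> k \<notin> {i \<in> J. P i}"
    using wf[unfolded wf_eq_minimal, rule_format, of j "{i \<in> J. P i}"] by simp
  then show ?thesis by simp blast
qed

text \<open>Collectionwise normality from monotone normality. Each \<open>E j\<close> is separated
  from the union of all others, which is closed because the family is discrete. As
  \<open>sep\<close> is antitone in its second argument, two of the resulting sets lie in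
  \<open>sep (E i) (E j)\<close> and \<open>sep (E j) (E i)\<close>, which are disjoint.\<close>

lemma (in stratification) discrete_expansion:
  assumes disc: "\<And>z. z \<in> topspace Z \<Longrightarrow>
      \<exists>N g. openin Z N \<and> z \<in> N \<and> (\<forall>j\<in>J. j \<noteq> g \<longrightarrow> E j \<inter> N = {})"
    and closed: "\<And>j. j \<in> J \<Longrightarrow> closedin Z (E j)"
    and EU: "\<And>j. j \<in> J \<Longrightarrow> openin Z (U j) \<and> E j \<subseteq> U j"
    and disjoint: "\<And>i j. i \<in> J \<Longrightarrow> j \<in> J \<Longrightarrow> i \<noteq> j \<Longrightarrow> E i \<inter> E j = {}"
  obtains V where "\<And>j. j \<in> J \<Longrightarrow> openin Z (V j) \<and> E j \<subseteq> V j \<and> V j \<subseteq> U j"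
    "\<And>i j. i \<in> J \<Longrightarrow> j \<in> J \<Longrightarrow> i \<noteq> j \<Longrightarrow> V i \<inter> V j = {}"
    "closedin Z (\<Union>j\<in>J. E j)"
proof -
  have cl: "closedin Z (\<Union>j\<in>S. E j)" if S: "S \<subseteq> J" for S
  proof -
    have sub: "(\<Union>j\<in>S. E j) \<subseteq> topspace Z"
    proof (rule UN_least)
      show "E j \<subseteq> topspace Z" if "j \<in> S" for j
        using closedin_subset[OF closed] S that by (meson subsetD)
    qed
    have "openin Z (topspace Z - (\<Union>j\<in>S. E j))"
    proof (rule iffD2[OF openin_subopen], rule ballI)
      fix z assume z: "z \<in> topspace Z - (\<Union>j\<in>S. E j)"
      obtain N g where N: "openin Z N" "z \<in> N" "\<forall>j\<in>J. j \<noteq> g \<longrightarrow> E j \<inter> N = {}"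
        using disc[of z] z by blast
      \<comment> \<open>Of all members only \<open>E g\<close> can meet \<open>N\<close>, so
        removing this one closed set suffices.\<close>
      define T where "T = (if g \<in> S then N - E g else N)"
      have "openin Z T"
      proof (cases "g \<in> S")
        case True
        then have "g \<in> J" using S by (rule subsetD[rotated])
        then show ?thesis using openin_diff[OF N(1) closed] True unfolding T_def by simp
      qed (simp add: T_def N(1))
      moreover have "z \<in> T" using z N(2) unfolding T_def by auto
      moreover have "T \<subseteq> topspace Z - (\<Union>j\<in>S. E j)"
      proof
        fix y assume y: "y \<in> T"
        then have "y \<in> N" unfolding T_def by (auto split: if_splits)
        moreover have "y \<notin> E j" if "j \<in> S" for j
          using y that N(3) S \<open>y \<in> N\<close> unfolding T_def by (cases "j = g") auto
        ultimately show "y \<in> topspace Z - (\<Union>j\<in>S. E j)"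
          using openin_subset[OF N(1)] by blast
      qed
      ultimately show "\<exists>T. openin Z T \<and> z \<in> T \<and> T \<subseteq> topspace Z - (\<Union>j\<in>S. E j)" by blast
    qed
    then show ?thesis using sub by (simp add: closedin_def)
  qed
  define D where "D j = (\<Union>i\<in>J - {j}. E i)" for j
  have D: "closedin Z (D j)" for j unfolding D_def by (rule cl) blast
  have ED: "E j \<inter> D j = {}" if "j \<in> J" for j using disjoint that unfolding D_def by blast
  define V where "V j = sep (E j) (D j) \<inter> U j" for j
  show thesis
  proof (rule that[of V])
    fix j assume j: "j \<in> J"
    show "openin Z (V j) \<and> E j \<subseteq> V j \<and> V j \<subseteq> U j"
      using openin_Int[OF openin_sep[OF closed[OF j] D]] sep_superset[OF closed[OF j] D ED[OF j]]
        EU[OF j]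
      unfolding V_def by simp
    fix i assume i: "i \<in> J" and ij: "i \<noteq> j"
    have "E j \<subseteq> D i" "E i \<subseteq> D j" using i j ij unfolding D_def by auto
    then have "sep (E i) (D i) \<subseteq> sep (E i) (E j)" "sep (E j) (D j) \<subseteq> sep (E j) (E i)"
      using sep_antimono[OF _ D] closed i j by blast+
    then show "V i \<inter> V j = {}"
      using sep_disjoint[OF closed[OF i] closed[OF j]] unfolding V_def by blast
  next
    show "closedin Z (\<Union>j\<in>J. E j)" by (rule cl) simp
  qed
qed

lemma prod_one_minus_nonneg:
  fixes g :: "nat \<Rightarrow> real"
  assumes "\<And>i. 0 \<le> g i \<and> g i \<le> 1"
  shows "0 \<le> (\<Prod>i<n. 1 - g i) \<and> (\<Prod>i<n. 1 - g i) \<le> 1"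
  using assms by (auto intro!: prod_nonneg prod_le_1)

text \<open>For a well-ordered cover \<open>U\<close>, with \<open>P j\<close> and \<open>Q j\<close> the unions of the members before \<open>j\<close> and
  up to \<open>j\<close>, the closed sets \<open>cl G(Q j, n) - P j\<close> form a discrete family for each \<open>n\<close>.\<close>

theorem (in stratification) labelled_partition_exists:
  fixes U :: "'j \<Rightarrow> 'a set"
  assumes U: "\<And>j. j \<in> J \<Longrightarrow> openin Z (U j)" and cover: "topspace Z \<subseteq> (\<Union>j\<in>J. U j)"
  obtains \<psi> c where "labelled_partition Z J U \<psi> c"
proof -
  obtain r where r: "well_order_on J r" using well_order_on by blast
  have tot: "(i, j) \<in> r \<or> (j, i) \<in> r" if "i \<in> J" "j \<in> J" "i \<noteq> j" for i j
    using r that unfolding well_order_on_def linear_order_on_def total_on_def by blast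
  have asym: "i = j" if "(i, j) \<in> r" "(j, i) \<in> r" for i j
    using r that unfolding well_order_on_def linear_order_on_def partial_order_on_def antisym_def
    by blast
  have refl: "(j, j) \<in> r" if "j \<in> J" for j
    using r that unfolding well_order_on_def linear_order_on_def partial_order_on_def
      preorder_on_def refl_on_def by blast
  have trans: "(i, k) \<in> r" if "(i, j) \<in> r" "(j, k) \<in> r" for i j k
    using r that unfolding well_order_on_def linear_order_on_def partial_order_on_def
      preorder_on_def trans_def by blast
  define P where "P j = (\<Union>i\<in>{i\<in>J. (i, j) \<in> r \<and> i \<noteq> j}. U i)" for j
  define Q where "Q j = (\<Union>i\<in>{i\<in>J. (i, j) \<in> r}. U i)" for j
  have oP: "openin Z (P j)" and oQ: "openin Z (Q j)" for j
    unfolding P_def Q_def using U by blast+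
  have QPU: "Q j - P j \<subseteq> U j" for j unfolding P_def Q_def by blast
  have QP: "Q j \<subseteq> P i" if "(j, i) \<in> r" "i \<noteq> j" for i j
  proof
    fix z assume "z \<in> Q j"
    then obtain k where k: "k \<in> J" "(k, j) \<in> r" "z \<in> U k" unfolding Q_def by blast
    have "(k, i) \<in> r" using trans[OF k(2) that(1)] .
    moreover have "k \<noteq> i" using asym[of j i] that k(2) by blast
    ultimately show "z \<in> P i" unfolding P_def using k by blast
  qed
  have UP: "U j \<subseteq> P i" if "(j, i) \<in> r" "i \<noteq> j" "j \<in> J" for i j
    unfolding P_def using that by blast
  have first: "\<exists>j\<in>J. z \<in> U j \<and> z \<notin> P j" if z: "z \<in> topspace Z" for z
  proof -
    obtain j where "j \<in> J" "z \<in> U j" using cover z by blast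
    then obtain i where "i \<in> J" "z \<in> U i" "\<forall>k\<in>J. (k, i) \<in> r \<and> k \<noteq> i \<longrightarrow> z \<notin> U k"
      using well_order_on_least[OF r, of j "\<lambda>j. z \<in> U j"] by blast
    then show ?thesis unfolding P_def by blast
  qed
  define E where "E n j = Z closure_of (G (Q j) n) - P j" for n j
  have Ecl: "closedin Z (E n j)" for n j
    unfolding E_def by (rule closedin_diff[OF closedin_closure_of oP])
  have EU: "E n j \<subseteq> U j" for n j using closG[OF oQ, of j n] QPU[of j] unfolding E_def by blast
  have disc: "\<exists>N g. openin Z N \<and> z \<in> N \<and> (\<forall>j\<in>J. j \<noteq> g \<longrightarrow> E n j \<inter> N = {})"
    if z: "z \<in> topspace Z" for z n
  proof -
    from first[OF z] obtain g where g: "g \<in> J" "z \<in> U g" "z \<notin> P g" by blast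
    \<comment> \<open>\<open>g\<close> is a first index with \<open>z \<in> U g\<close>. For an
      earlier \<open>j\<close>, \<open>Q j \<subseteq> P g\<close>, so the removed closure contains
      \<open>E n j\<close>; for a later \<open>j\<close>, \<open>U g \<subseteq> P j\<close>, which
      \<open>E n j\<close> avoids.\<close>
    define N where "N = U g - Z closure_of (G (P g) n)"
    have "openin Z N" unfolding N_def by (rule openin_diff[OF U[OF g(1)] closedin_closure_of])
    moreover have "z \<in> N" unfolding N_def using g closG[OF oP, of g n] by blast
    moreover have "E n j \<inter> N = {}" if j: "j \<in> J" "j \<noteq> g" for j
    proof (cases "(j, g) \<in> r")
      case True
      then show ?thesis
        using closure_mono[OF oQ oP QP[OF True], of n n] j unfolding E_def N_def by blast
    next
      case False
      then have "(g, j) \<in> r" using tot j g by blast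
      then show ?thesis using UP[of g j] j g unfolding E_def N_def by blast
    qed
    ultimately show ?thesis by blast
  qed
  have Edisj: "E n i \<inter> E n j = {}" if ij: "i \<in> J" "j \<in> J" "i \<noteq> j" for n i j
  proof -
    have "E n i \<inter> E n j = {}" if "(i, j) \<in> r" "i \<in> J" "i \<noteq> j" for i j
    proof -
      have "E n i \<subseteq> P j" using EU[of n i] UP[of i j] that by blast
      then show ?thesis unfolding E_def by blast
    qed
    from this[of i j] this[of j i] show ?thesis using tot[OF ij] ij by blast
  qed
  define isV where "isV n V \<longleftrightarrow> (\<forall>j\<in>J. openin Z (V j) \<and> E n j \<subseteq> V j \<and> V j \<subseteq> U j) \<and>
      (\<forall>i\<in>J. \<forall>j\<in>J. i \<noteq> j \<longrightarrow> V i \<inter> V j = {}) \<and> closedin Z (\<Union>j\<in>J. E n j)"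
    for n and V :: "'j \<Rightarrow> 'a set"
  have "\<exists>V. isV n V" for n
  proof (rule discrete_expansion[of J "E n" U])
      show "openin Z (U j) \<and> E n j \<subseteq> U j" if "j \<in> J" for j using U[OF that] EU by blast
      show "\<exists>N g. openin Z N \<and> z \<in> N \<and> (\<forall>j\<in>J. j \<noteq> g \<longrightarrow> E n j \<inter> N = {})"
        if "z \<in> topspace Z" for z by (rule disc[OF that])
      show "E n i \<inter> E n j = {}" if "i \<in> J" "j \<in> J" "i \<noteq> j" for i j by (rule Edisj[OF that])
    fix V assume "\<And>j. j \<in> J \<Longrightarrow> openin Z (V j) \<and> E n j \<subseteq> V j \<and> V j \<subseteq> U j"
      "\<And>i j. i \<in> J \<Longrightarrow> j \<in> J \<Longrightarrow> i \<noteq> j \<Longrightarrow> V i \<inter> V j = {}" "closedin Z (\<Union>j\<in>J. E n j)"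
    then show "\<exists>V. isV n V" unfolding isV_def by blast
  qed (rule Ecl)
  then have "\<forall>n. \<exists>V. isV n V" by blast
  from choice[OF this] obtain V where isV: "\<And>n. isV n (V n)" by blast
  have Vo: "openin Z (V n j)" "E n j \<subseteq> V n j" "V n j \<subseteq> U j" if "j \<in> J" for n j
    using isV[of n] that unfolding isV_def by blast+
  have Vd: "i = j" if "i \<in> J" "j \<in> J" "z \<in> V n i" "z \<in> V n j" for n i j z
    using isV[of n] that unfolding isV_def by blast
  define isf where "isf n f \<longleftrightarrow> continuous_map Z euclideanreal f \<and>
      (\<forall>z\<in>topspace Z. 0 \<le> f z \<and> f z \<le> 1) \<and> (\<forall>z\<in>(\<Union>j\<in>J. E n j). f z = 1) \<and>
      (\<forall>z\<in>topspace Z - (\<Union>j\<in>J. V n j). f z = 0)" for n and f :: "'a \<Rightarrow> real"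
  have "\<exists>f. isf n f" for n
  proof -
    have 1: "closedin Z (\<Union>j\<in>J. E n j)" using isV[of n] unfolding isV_def by blast
    have 2: "openin Z (\<Union>j\<in>J. V n j)" using Vo(1) by blast
    have 3: "(\<Union>j\<in>J. E n j) \<subseteq> (\<Union>j\<in>J. V n j)" using Vo(2) by blast
    show ?thesis
      by (rule urysohn[OF 1 2 3]) (unfold isf_def, blast)
  qed
  then have "\<forall>n. \<exists>f. isf n f" by blast
  from choice[OF this] obtain f where isf: "\<And>n. isf n (f n)" by blast
  have fc: "continuous_map Z euclideanreal (f n)" for n using isf[of n] unfolding isf_def by blast
  have f1: "f n z = 1" if "z \<in> E n j" "j \<in> J" for n z j
    using isf[of n] that unfolding isf_def by blast
  have f0: "f n z = 0" if "z \<in> topspace Z" "\<And>j. j \<in> J \<Longrightarrow> z \<notin> V n j" for n z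
    using isf[of n] that unfolding isf_def by blast
  \<comment> \<open>The truncation leaves room on both sides: \<open>g n\<close> is 1 on the open
    set \<open>f n > 2/3\<close> around the sets \<open>E n j\<close>, which yields local
    finiteness, and 0 on the open set \<open>f n < 1/3\<close> around the zeros of
    \<open>f n\<close>, where a locally constant label may be missing.\<close>
  define g where "g n z = max 0 (min 1 (3 * f n z - 1))" for n z
  have gc: "continuous_map Z euclideanreal (g n)" for n unfolding g_def
    by (intro continuous_map_real_max continuous_map_real_min continuous_map_diff
        continuous_map_real_mult_left fc) simp_all
  have gb: "0 \<le> g n z \<and> g n z \<le> 1" for n z unfolding g_def by simp
  \<comment> \<open>Later functions vanish wherever an earlier \<open>g m\<close> equals 1, and at
    the first \<open>n\<close> with \<open>g n z > 0\<close> the product is 1.\<close>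
  define \<psi> where "\<psi> n z = g n z * (\<Prod>i<n. 1 - g i z)" for n z
  define c where "c n z = (SOME j. j \<in> J \<and> z \<in> V n j)" for n z
  have c: "c n z = j" if "j \<in> J" "z \<in> V n j" for n z j
    unfolding c_def by (rule some_equality) (use Vd that in blast)+
  have gpos: "0 < g n z" if "0 < \<psi> n z" for n z
    using that gb[of n z] unfolding \<psi>_def by (cases "g n z = 0") auto
  have inE: "\<exists>n. \<exists>j\<in>J. z \<in> E n j" if z: "z \<in> topspace Z" for z
  proof -
    obtain j where j: "j \<in> J" "z \<in> U j" "z \<notin> P j" using first[OF z] by blast
    then have "z \<in> Q j" using refl unfolding Q_def by blast
    then obtain n where "z \<in> G (Q j) n" using unG[OF oQ] by blast
    then have "z \<in> E n j" using j subset_closure[OF oQ] unfolding E_def by blast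
    then show ?thesis using j(1) by blast
  qed
  have inV: "\<exists>j\<in>J. z \<in> V n j" if "z \<in> topspace Z" "0 < f n z" for n z
    using f0[OF that(1)] that(2) by force
  have "labelled_partition Z J U \<psi> c"
  proof
    fix n
    show "continuous_map Z euclideanreal (\<psi> n)" unfolding \<psi>_def
      by (intro continuous_map_real_mult continuous_map_prod continuous_map_diff gc) simp_all
  next
    fix n z assume "z \<in> topspace Z"
    show "0 \<le> \<psi> n z \<and> \<psi> n z \<le> 1"
      using gb[of n z] prod_one_minus_nonneg[of "\<lambda>i. g i z" n] gb unfolding \<psi>_def
      by (auto intro: mult_le_one)
  next
    fix z assume z: "z \<in> topspace Z"
    obtain m j where m: "j \<in> J" "z \<in> E m j" using inE[OF z] by blast
    define N where "N = {y \<in> topspace Z. 2/3 < f m y}"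
    have "openin Z N" unfolding N_def by (rule openin_real_less[OF fc])
    moreover have "z \<in> N" using f1[OF m(2,1)] z unfolding N_def by simp
    moreover have "\<psi> n y = 0" if "y \<in> N" "n \<ge> Suc m" for y n
    proof -
      have "1 - g m y = 0" using that(1) unfolding N_def g_def by simp
      then have "(\<Prod>i<n. 1 - g i y) = 0" using that(2) by (intro prod_zero) (auto intro!: bexI[of _ m])
      then show ?thesis unfolding \<psi>_def by simp
    qed
    ultimately show "\<exists>N k. openin Z N \<and> z \<in> N \<and> (\<forall>y\<in>N. \<forall>n\<ge>k. \<psi> n y = 0)" by blast
  next
    fix z assume z: "z \<in> topspace Z"
    obtain m j where "j \<in> J" "z \<in> E m j" using inE[OF z] by blast
    then have "0 < g m z" using f1 unfolding g_def by simp
    then have ex: "\<exists>n. 0 < g n z" by blast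
    define n where "n = (LEAST n. 0 < g n z)"
    have "0 < g n z" unfolding n_def using ex by (rule LeastI_ex)
    moreover have "g i z = 0" if "i < n" for i
      using not_less_Least[of i "\<lambda>n. 0 < g n z"] that gb[of i z] unfolding n_def by force
    ultimately have "0 < \<psi> n z" unfolding \<psi>_def by simp
    then show "\<exists>n. 0 < \<psi> n z" by blast
  next
    fix n z assume z: "z \<in> topspace Z"
    show "\<exists>N j. openin Z N \<and> z \<in> N \<and> (\<forall>y\<in>N. 0 < \<psi> n y \<longrightarrow> c n y = j)"
    proof (cases "0 < f n z")
      case True
      then obtain j where j: "j \<in> J" "z \<in> V n j" using inV[OF z] by blast
      show ?thesis
        by (rule exI[of _ "V n j"], rule exI[of _ j]) (use Vo(1)[OF j(1)] j c[OF j(1)] in simp)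
    next
      case False
      define N where "N = {y \<in> topspace Z. f n y < 1/3}"
      have "openin Z N" unfolding N_def by (rule openin_real_less[OF fc])
      moreover have "z \<in> N" using z False unfolding N_def by simp
      moreover have "\<not> 0 < \<psi> n y" if "y \<in> N" for y
        using gpos[of n y] that unfolding N_def g_def by (auto simp: max_def)
      ultimately show ?thesis by (intro exI[of _ N]) simp
    qed
  next
    fix n z assume z: "z \<in> topspace Z" and p: "0 < \<psi> n z"
    have "0 < f n z" using gpos[OF p] unfolding g_def by (auto simp: max_def split: if_splits)
    then obtain j where j: "j \<in> J" "z \<in> V n j" using inV[OF z] by blast
    then show "c n z \<in> J \<and> z \<in> U (c n z)" using Vo(3)[OF j(1), of n] c[OF j] by auto
  qed
  then show thesis by (rule that)
qed

section \<open>Step functions on the unit interval\<close>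

text \<open>The interval is half-open because the steps \<open>{u n z..<u (Suc n) z}\<close> are;
  together they cover it exactly once.\<close>

abbreviation unit_lborel :: "real measure" where
  "unit_lborel \<equiv> restrict_space lborel {0..<1}"

lemma space_unit_lborel [simp]: "space unit_lborel = {0..<1}"
  by (simp add: space_restrict_space)

lemma sets_unit_lborel: "A \<in> sets borel \<Longrightarrow> A \<subseteq> {0..<1} \<Longrightarrow> A \<in> sets unit_lborel"
  by (auto simp: sets_restrict_space)

lemma measure_unit_lborel: "A \<subseteq> {0..<1} \<Longrightarrow> measure unit_lborel A = measure lborel A"
  by (rule measure_restrict_space) auto

interpretation unit_lborel: finite_measure unit_lborel
  by (rule finite_measureI) (simp add: emeasure_restrict_space)

lemma measure_space_unit_lborel [simp]: "measure unit_lborel {0..<1} = 1"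
  by (simp add: measure_unit_lborel)

lemma integrable_indicator_unit:
  "A \<in> sets unit_lborel \<Longrightarrow> integrable unit_lborel (indicator A :: real \<Rightarrow> real)"
  by (rule integrable_real_indicator) (simp_all add: less_top[symmetric] unit_lborel.emeasure_finite)

lemma integrable_step:
  fixes h :: "real \<Rightarrow> real"
  assumes "simple_function unit_lborel h"
  shows "integrable unit_lborel h"
proof (rule unit_lborel.integrable_const_bound)
  show "h \<in> borel_measurable unit_lborel" by (rule borel_measurable_simple_function[OF assms])
  have "finite (h ` {0..<1})" using simple_functionD(1)[OF assms] by simp
  then have "\<bar>h t\<bar> \<le> Max ((\<lambda>x. \<bar>x\<bar>) ` h ` {0..<1})" if "t \<in> {0..<1}" for t
    using that by (intro Max_ge) auto
  then show "AE t in unit_lborel. norm (h t) \<le> Max ((\<lambda>x. \<bar>x\<bar>) ` h ` {0..<1})"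
    by (intro AE_I2) simp
qed

text \<open>The gain from step functions: as \<open>f\<close> and \<open>g\<close> have finitely
  many values, the composition is simple for an arbitrary \<open>p\<close>, without any
  measurability.\<close>

lemma simple_function_comp2:
  assumes "simple_function unit_lborel f" "simple_function unit_lborel g"
  shows "simple_function unit_lborel (\<lambda>t. p (f t, g t))"
  using simple_function_compose2[OF assms, of "\<lambda>x y. p (x, y)"] .

lemma integral_const_unit [simp]: "(LINT t|unit_lborel. (k::real)) = k"
  by simp

lemma integral_mono_unit:
  assumes "simple_function unit_lborel h" "simple_function unit_lborel (k :: real \<Rightarrow> real)"
    "\<And>t. 0 \<le> t \<Longrightarrow> t < 1 \<Longrightarrow> h t \<le> k t"
  shows "(LINT t|unit_lborel. h t) \<le> (LINT t|unit_lborel. k t)"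
  by (rule integral_mono[OF integrable_step[OF assms(1)] integrable_step[OF assms(2)]])
    (use assms(3) in auto)

lemma integral_le_const:
  assumes "simple_function unit_lborel h" "\<And>t. 0 \<le> t \<Longrightarrow> t < 1 \<Longrightarrow> h t \<le> (k::real)"
  shows "(LINT t|unit_lborel. h t) \<le> k"
  using integral_mono_unit[OF assms(1), of "\<lambda>t. k"] assms(2) by simp

lemma integral_ge_const:
  assumes "simple_function unit_lborel h" "\<And>t. 0 \<le> t \<Longrightarrow> t < 1 \<Longrightarrow> (k::real) \<le> h t"
  shows "k \<le> (LINT t|unit_lborel. h t)"
  using integral_mono_unit[OF _ assms(1), of "\<lambda>t. k"] assms(2) by simp

lemma simple_function_interval:
  "simple_function unit_lborel (\<lambda>t. if t < s then (x::'b) else y)"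
proof (rule simple_function_If)
  have "{t \<in> space unit_lborel. t < s} = {0..<1} \<inter> {..<s}" by auto
  then show "{t \<in> space unit_lborel. t < s} \<in> sets unit_lborel"
    by (simp add: sets_unit_lborel)
qed auto

lemma integral_interval:
  assumes "0 \<le> s" "s \<le> 1"
  shows "(LINT t|unit_lborel. (if t < s then x else (y::real))) = s * x + (1 - s) * y"
proof -
  have "(if t < s then x else y) = y + (x - y) * indicator {0..<s} t" if "t \<in> {0..<1}" for t
    using that by (auto simp: indicator_def)
  then have "(LINT t|unit_lborel. (if t < s then x else y)) =
      (LINT t|unit_lborel. y + (x - y) * indicator {0..<s} t)"
    by (intro Bochner_Integration.integral_cong) auto
  also have "\<dots> = (LINT t|unit_lborel. y) + (LINT t|unit_lborel. (x - y) * indicator {0..<s} t)"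
    using sets_unit_lborel[of "{0..<s}"] assms
    by (intro Bochner_Integration.integral_add integrable_mult_right integrable_indicator_unit)
      auto
  also have "(LINT t|unit_lborel. (x - y) * indicator {0..<s} t) = (x - y) * s"
    using sets_unit_lborel[of "{0..<s}"] assms by (simp add: measure_unit_lborel Int_absorb1 Int_absorb2)
  finally show ?thesis by (simp add: algebra_simps)
qed

text \<open>The coefficients do not depend on \<open>p\<close>, so for fixed step functions the
  integral is a finite linear combination of values of \<open>p\<close>. Continuity for pointwise
  convergence rests on this.\<close>

lemma integral_step_pair_sum:
  fixes p :: "'b \<times> 'c \<Rightarrow> real"
  assumes f: "simple_function unit_lborel f" and g: "simple_function unit_lborel g"
  shows "(LINT t|unit_lborel. p (f t, g t)) =
    (\<Sum>s\<in>f ` {0..<1} \<times> g ` {0..<1}. measure unit_lborel {t\<in>{0..<1}. (f t, g t) = s} * p s)"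
proof -
  let ?R = "f ` {0..<1} \<times> g ` {0..<1}"
  have fin: "finite ?R" using simple_functionD(1)[OF f] simple_functionD(1)[OF g] by simp
  have S: "{t\<in>{0..<1}. (f t, g t) = s} \<in> sets unit_lborel" for s
  proof -
    have "{t\<in>{0..<1}. (f t, g t) = s} = (\<lambda>t. (f t, g t)) -` {s} \<inter> space unit_lborel" by auto
    then show ?thesis using simple_functionD(2)[OF simple_function_Pair[OF f g], of "{s}"] by simp
  qed
  have "p (f t, g t) = (\<Sum>s\<in>?R. indicator {t\<in>{0..<1}. (f t, g t) = s} t * p s)"
    if "t \<in> {0..<1}" for t
  proof -
    have "(\<Sum>s\<in>?R. indicator {t\<in>{0..<1}. (f t, g t) = s} t * p s) =
        (\<Sum>s\<in>{(f t, g t)}. indicator {t\<in>{0..<1}. (f t, g t) = s} t * p s)"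
      using that fin by (intro sum.mono_neutral_right) (auto simp: indicator_def)
    then show ?thesis using that by simp
  qed
  then have "(LINT t|unit_lborel. p (f t, g t)) =
      (LINT t|unit_lborel. (\<Sum>s\<in>?R. indicator {t\<in>{0..<1}. (f t, g t) = s} t * p s))"
    by (intro Bochner_Integration.integral_cong) auto
  also have "\<dots> = (\<Sum>s\<in>?R. LINT t|unit_lborel. indicator {t\<in>{0..<1}. (f t, g t) = s} t * p s)"
    using S by (intro Bochner_Integration.integral_sum integrable_mult_left
        integrable_indicator_unit)
  also have "\<dots> = (\<Sum>s\<in>?R. measure unit_lborel {t\<in>{0..<1}. (f t, g t) = s} * p s)"
  proof (intro sum.cong refl)
    fix s
    define A where "A = {t\<in>{0..<1}. (f t, g t) = s}"
    have "A \<inter> {0..<1} = A" unfolding A_def by blast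
    then show "(LINT t|unit_lborel. indicator {t\<in>{0..<1}. (f t, g t) = s} t * p s) =
        measure unit_lborel {t\<in>{0..<1}. (f t, g t) = s} * p s"
      unfolding A_def[symmetric] by simp
  qed
  finally show ?thesis .
qed

section \<open>Breakpoints of a partition\<close>

text \<open>\<open>u n z\<close> are the partial sums of a normalized partition of unity: the step
  \<open>{u n z..<u (Suc n) z}\<close> has the weight of the \<open>n\<close>-th function as its
  length and carries the label \<open>c n z\<close>. A label is meaningful only if its step is
  nonempty.\<close>

locale breakpoints =
  fixes Z :: "'a topology" and J :: "'j set" and U :: "'j \<Rightarrow> 'a set"
    and u :: "nat \<Rightarrow> 'a \<Rightarrow> real" and c :: "nat \<Rightarrow> 'a \<Rightarrow> 'j"
  assumes u_cont: "\<And>n. continuous_map Z euclideanreal (u n)"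
    and u_0: "\<And>z. z \<in> topspace Z \<Longrightarrow> u 0 z = 0"
    and u_mono: "\<And>n z. z \<in> topspace Z \<Longrightarrow> u n z \<le> u (Suc n) z"
    and u_1: "\<And>z. z \<in> topspace Z \<Longrightarrow>
      \<exists>N k. openin Z N \<and> z \<in> N \<and> (\<forall>y\<in>N. \<forall>n\<ge>k. u n y = 1)"
    and u_locconst: "\<And>n z. z \<in> topspace Z \<Longrightarrow>
      \<exists>N j. openin Z N \<and> z \<in> N \<and> (\<forall>y\<in>N. u n y < u (Suc n) y \<longrightarrow> c n y = j)"
    and u_label: "\<And>n z. z \<in> topspace Z \<Longrightarrow> u n z < u (Suc n) z \<Longrightarrow> c n z \<in> J \<and> z \<in> U (c n z)"

text \<open>Partial sums divided by the total sum, which is continuous by local finiteness and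
  positive by \<open>pos\<close>. The second conclusion identifies the nonempty steps, so that a
  bound on the order of the partition bounds their number.\<close>

lemma (in labelled_partition) breakpoints_exist:
  obtains u where "breakpoints Z J U u c"
    "\<And>z n. z \<in> topspace Z \<Longrightarrow> u n z < u (Suc n) z \<longleftrightarrow> 0 < \<psi> n z"
proof -
  define s where "s z = (\<Sum>n. \<psi> n z)" for z
  have s: "s z = (\<Sum>n<k. \<psi> n z)" if "\<forall>n\<ge>k. \<psi> n z = 0" for z k
    unfolding s_def using that by (intro suminf_finite) auto
  have spos: "0 < s z" if z: "z \<in> topspace Z" for z
  proof -
    obtain N k where "z \<in> N" "\<forall>y\<in>N. \<forall>n\<ge>k. \<psi> n y = 0" using locfin[OF z] by blast
    then have k: "\<forall>n\<ge>k. \<psi> n z = 0" by blast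
    obtain n where n: "0 < \<psi> n z" using pos[OF z] by blast
    then have "n < k" using k by (cases "k \<le> n") auto
    then have "\<psi> n z \<le> (\<Sum>n<k. \<psi> n z)" using bounds[OF z] by (intro member_le_sum) auto
    then show ?thesis using n s[OF k] by linarith
  qed
  have scont: "continuous_map Z euclideanreal s"
  proof (rule continuous_map_real_local)
    fix x assume "x \<in> topspace Z"
    then obtain N k where N: "openin Z N" "x \<in> N" "\<forall>y\<in>N. \<forall>n\<ge>k. \<psi> n y = 0"
      using locfin[of x] by blast
    have "\<forall>y\<in>N. s y = (\<Sum>n<k. \<psi> n y)" using s N(3) by blast
    moreover have "continuous_map Z euclideanreal (\<lambda>y. \<Sum>n<k. \<psi> n y)"
      by (intro continuous_map_sum cont) auto
    ultimately show "\<exists>N g. openin Z N \<and> x \<in> N \<and> continuous_map Z euclideanreal g \<and>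
        (\<forall>y\<in>N. s y = g y)" using N(1,2) by (intro exI[of _ N] exI[of _ "\<lambda>y. \<Sum>n<k. \<psi> n y"]) simp
  qed
  define u where "u n z = (\<Sum>i<n. \<psi> i z) / s z" for n z
  have uS: "u (Suc n) z = u n z + \<psi> n z / s z" for n z
    unfolding u_def by (simp add: add_divide_distrib)
  have iff: "u n z < u (Suc n) z \<longleftrightarrow> 0 < \<psi> n z" if "z \<in> topspace Z" for n z
    using spos[OF that] by (simp add: uS zero_less_divide_iff)
  have "breakpoints Z J U u c"
  proof
    fix n show "continuous_map Z euclideanreal (u n)" unfolding u_def
      by (intro continuous_map_real_divide continuous_map_sum cont scont) (use spos in force)+
  next
    fix z assume z: "z \<in> topspace Z"
    show "u 0 z = 0" unfolding u_def by simp
    show "u n z \<le> u (Suc n) z" for n using spos[OF z] bounds[OF z, of n] by (simp add: uS)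
    obtain N k where N: "openin Z N" "z \<in> N" "\<forall>y\<in>N. \<forall>n\<ge>k. \<psi> n y = 0"
      using locfin[OF z] by blast
    have "u n y = 1" if "y \<in> N" "n \<ge> k" for y n
    proof -
      have "y \<in> topspace Z" using that(1) openin_subset[OF N(1)] by (rule subsetD[rotated])
      then have "s y > 0" by (rule spos)
      moreover have "\<forall>m\<ge>n. \<psi> m y = 0" using N(3) that by simp
      then have "s y = (\<Sum>i<n. \<psi> i y)" by (rule s)
      ultimately show ?thesis unfolding u_def by simp
    qed
    then show "\<exists>N k. openin Z N \<and> z \<in> N \<and> (\<forall>y\<in>N. \<forall>n\<ge>k. u n y = 1)"
      using N by (intro exI[of _ N] exI[of _ k]) simp
    fix n
    obtain N j where N: "openin Z N" "z \<in> N" "\<forall>y\<in>N. 0 < \<psi> n y \<longrightarrow> c n y = j"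
      using locconst[OF z] by blast
    have "\<forall>y\<in>N. u n y < u (Suc n) y \<longrightarrow> c n y = j"
    proof (intro ballI impI)
      fix y assume y: "y \<in> N" "u n y < u (Suc n) y"
      have "y \<in> topspace Z" using y(1) openin_subset[OF N(1)] by (rule subsetD[rotated])
      then show "c n y = j" using y N(3) iff by simp
    qed
    then show "\<exists>N j. openin Z N \<and> z \<in> N \<and> (\<forall>y\<in>N. u n y < u (Suc n) y \<longrightarrow> c n y = j)"
      using N by (intro exI[of _ N] exI[of _ j]) simp
    assume "u n z < u (Suc n) z"
    then show "c n z \<in> J \<and> z \<in> U (c n z)" using label[OF z] iff[OF z] by simp
  qed
  then show thesis using iff by (rule that)
qed

context breakpoints
begin

definition idx :: "'a \<Rightarrow> real \<Rightarrow> nat" where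
  "idx z t = (LEAST n. t < u (Suc n) z)"

lemma u_mono_le:
  assumes "z \<in> topspace Z" "m \<le> n"
  shows "u m z \<le> u n z"
  using lift_Suc_mono_le[of "\<lambda>n. u n z", OF u_mono[OF assms(1)] assms(2)] .

lemma idx_props:
  assumes z: "z \<in> topspace Z" and t: "0 \<le> t" "t < 1"
  shows "u (idx z t) z \<le> t" "t < u (Suc (idx z t)) z"
proof -
  obtain N k where "z \<in> N" "\<forall>y\<in>N. \<forall>n\<ge>k. u n y = 1" using u_1[OF z] by blast
  then have "t < u (Suc k) z" using t by simp
  then show "t < u (Suc (idx z t)) z" unfolding idx_def by (rule LeastI)
  show "u (idx z t) z \<le> t"
  proof (cases "idx z t")
    case 0
    then show ?thesis using u_0[OF z] t by simp
  next
    case (Suc m)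
    then have "\<not> t < u (Suc m) z"
      using not_less_Least[of m "\<lambda>n. t < u (Suc n) z"] unfolding idx_def by simp
    then show ?thesis using Suc by simp
  qed
qed

lemma idx_less: "z \<in> topspace Z \<Longrightarrow> 0 \<le> t \<Longrightarrow> t < 1 \<Longrightarrow> u (idx z t) z < u (Suc (idx z t)) z"
  using idx_props by fastforce

lemma idx_eqI:
  assumes z: "z \<in> topspace Z" and n: "u n z \<le> t" "t < u (Suc n) z"
  shows "idx z t = n"
  unfolding idx_def
proof (rule Least_equality)
  show "t < u (Suc n) z" by (rule n(2))
  fix m assume m: "t < u (Suc m) z"
  show "n \<le> m"
  proof (rule ccontr)
    assume "\<not> n \<le> m"
    then have "u (Suc m) z \<le> u n z" by (intro u_mono_le[OF z]) simp
    then show False using m n by simp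
  qed
qed

lemma idx_bound:
  assumes z: "z \<in> topspace Z" and k: "u k z = 1" and t: "0 \<le> t" "t < 1"
  shows "idx z t < k"
proof (rule ccontr)
  assume "\<not> idx z t < k"
  then have "u k z \<le> u (idx z t) z" by (intro u_mono_le[OF z]) simp
  then show False using k idx_props[OF z t] t by simp
qed

lemma simple_function_idx:
  assumes z: "z \<in> topspace Z"
  shows "simple_function unit_lborel (idx z)"
  unfolding simple_function_def
proof (intro conjI ballI)
  obtain N k where "z \<in> N" "\<forall>y\<in>N. \<forall>n\<ge>k. u n y = 1" using u_1[OF z] by blast
  then have k: "u k z = 1" by simp
  have "idx z ` space unit_lborel \<subseteq> {..<k}" using idx_bound[OF z k] by auto
  then show "finite (idx z ` space unit_lborel)" by (rule finite_subset) simp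
  fix n assume "n \<in> idx z ` space unit_lborel"
  have "idx z -` {n} \<inter> space unit_lborel = {u n z..<u (Suc n) z} \<inter> {0..<1}"
    using idx_props[OF z] idx_eqI[OF z] by auto
  then show "idx z -` {n} \<inter> space unit_lborel \<in> sets unit_lborel"
    by (auto intro: sets_unit_lborel)
qed

end

section \<open>The extension operator\<close>

locale extension_data = breakpoints "subtopology Y (topspace Y - X)" J U u c
  for Y :: "'a topology" and X :: "'a set" and J :: "'j set" and U u c +
  fixes a b :: 'a and r :: "'a \<Rightarrow> real" and D :: "'a \<times> 'a \<Rightarrow> real" and x :: "'j \<Rightarrow> 'a"
  assumes closed_X: "closedin Y X"
    and ab: "a \<in> X" "b \<in> X" "a \<noteq> b"
    and r_cont: "continuous_map Y euclideanreal r"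
    and r_bounds: "\<And>y. y \<in> topspace Y \<Longrightarrow> 0 \<le> r y \<and> r y \<le> 1"
    and r_0: "\<And>y. y \<in> topspace Y \<Longrightarrow> r y = 0 \<longleftrightarrow> y \<in> X"
    and D_cont: "continuous_fun Y D"
    and D_metric: "metric_fun Y D"
    and D_le: "\<And>y y'. y \<in> topspace Y \<Longrightarrow> y' \<in> topspace Y \<Longrightarrow> D (y, y') \<le> 1"
    and x_in: "\<And>j. j \<in> J \<Longrightarrow> x j \<in> X"
    and x_near: "\<And>s V. s \<in> X \<Longrightarrow> openin Y V \<Longrightarrow> s \<in> V \<Longrightarrow>
      \<exists>N. openin Y N \<and> s \<in> N \<and> (\<forall>j\<in>J. U j \<inter> N \<noteq> {} \<longrightarrow> x j \<in> V)"
begin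

lemma X_sub: "X \<subseteq> topspace Y"
  using closedin_subset[OF closed_X] .

lemma topspace_X [simp]: "topspace (subtopology Y X) = X"
  using X_sub by auto

lemma in_W: "y \<in> topspace Y \<Longrightarrow> y \<notin> X \<Longrightarrow> y \<in> topspace (subtopology Y (topspace Y - X))"
  by simp

lemma openin_W: "openin (subtopology Y (topspace Y - X)) V \<longleftrightarrow> openin Y V \<and> V \<subseteq> topspace Y - X"
  using openin_open_subtopology[of Y "topspace Y - X"] closed_X by blast

definition \<xi> :: "'a \<Rightarrow> 'a \<Rightarrow> real \<Rightarrow> 'a" where
  "\<xi> e y t = (if y \<in> X then y else if t < r y then e else x (c (idx y t) y))"

lemma \<xi>_X [simp]: "y \<in> X \<Longrightarrow> \<xi> e y t = y"
  by (simp add: \<xi>_def)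

lemma \<xi>_less: "y \<in> topspace Y \<Longrightarrow> 0 \<le> t \<Longrightarrow> t < r y \<Longrightarrow> \<xi> e y t = e"
  using r_0[of y] by (auto simp: \<xi>_def)

lemma \<xi>_ge: "r y \<le> t \<Longrightarrow> \<xi> e y t = \<xi> e' y t"
  by (auto simp: \<xi>_def)

lemma c_in:
  assumes "y \<in> topspace Y" "y \<notin> X" "u n y < u (Suc n) y"
  shows "c n y \<in> J" "y \<in> U (c n y)" "x (c n y) \<in> X"
  using u_label[OF in_W[OF assms(1,2)] assms(3)] x_in by auto

lemma \<xi>_in:
  assumes "y \<in> topspace Y" "e \<in> X" "0 \<le> t" "t < 1"
  shows "\<xi> e y t \<in> X"
proof (cases "y \<in> X")
  case False
  then have "x (c (idx y t) y) \<in> X"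
    using c_in(3)[OF assms(1) False] idx_less[OF in_W[OF assms(1) False] assms(3,4)] by blast
  then show ?thesis using assms by (simp add: \<xi>_def)
qed simp

lemma simple_\<xi>:
  assumes "y \<in> topspace Y"
  shows "simple_function unit_lborel (\<xi> e y)"
proof (cases "y \<in> X")
  case False
  have 1: "simple_function unit_lborel (\<lambda>t. x (c (idx y t) y))"
    using simple_function_compose1[OF simple_function_idx[OF in_W[OF assms False]],
        of "\<lambda>n. x (c n y)"] .
  have "simple_function unit_lborel (\<lambda>t. if t < r y then e else x (c (idx y t) y))"
  proof (rule simple_function_If[OF _ 1])
    have "{t \<in> space unit_lborel. t < r y} = {0..<1} \<inter> {..<r y}" by auto
    then show "{t \<in> space unit_lborel. t < r y} \<in> sets unit_lborel" by (simp add: sets_unit_lborel)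
  qed simp
  then show ?thesis using False by (simp add: \<xi>_def[abs_def])
next
  case True
  then have "\<xi> e y = (\<lambda>t. y)" by auto
  then show ?thesis by simp
qed

text \<open>Where both step functions sit at the base point, the first two terms of \<open>Q\<close>
  give the mean of \<open>p (a, a)\<close> and \<open>p (b, b)\<close>. Subtracting this mean here
  makes the integrand a convex combination of the mean and \<open>p (a, b)\<close> with weight
  \<open>D (y, y')\<close>, as \<open>Q_less\<close> records.\<close>

definition K :: "('a \<times> 'a \<Rightarrow> real) \<Rightarrow> real" where
  "K p = p (a, b) - p (a, a) / 2 - p (b, b) / 2"

text \<open>The correction is spread over \<open>t < min (r y) (r y')\<close> instead of being added
  after integration. Bounds and the triangle inequality can then be proved for each \<open>t\<close>
  separately.\<close>

definition Q :: "('a \<times> 'a \<Rightarrow> real) \<Rightarrow> 'a \<Rightarrow> 'a \<Rightarrow> real \<Rightarrow> real" where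
  "Q p y y' t = p (\<xi> a y t, \<xi> a y' t) / 2 + p (\<xi> b y t, \<xi> b y' t) / 2 +
     (if t < min (r y) (r y') then D (y, y') * K p else 0)"

definition T :: "('a \<times> 'a \<Rightarrow> real) \<Rightarrow> 'a \<times> 'a \<Rightarrow> real" where
  "T p = (\<lambda>(y, y')\<in>sq Y. LINT t|unit_lborel. Q p y y' t)"

text \<open>The points that \<open>T p (y, y')\<close> may feed to \<open>p\<close>: besides the
  values of the step functions, the base points, because \<open>K p\<close> uses them.\<close>

definition supp :: "'a \<Rightarrow> 'a set" where
  "supp y = insert a (insert b (\<xi> a y ` {0..<1} \<union> \<xi> b y ` {0..<1}))"

lemma T_eq: "y \<in> topspace Y \<Longrightarrow> y' \<in> topspace Y \<Longrightarrow> T p (y, y') = (LINT t|unit_lborel. Q p y y' t)"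
  by (simp add: T_def)

lemma T_funcset: "T p \<in> rfun (sq Y)"
  by (auto simp: T_def)

lemma simple_Q:
  assumes "y \<in> topspace Y" "y' \<in> topspace Y"
  shows "simple_function unit_lborel (Q p y y')"
proof -
  have "simple_function unit_lborel (\<lambda>t. p (\<xi> e y t, \<xi> e y' t))" for e
    by (rule simple_function_comp2[OF simple_\<xi>[OF assms(1)] simple_\<xi>[OF assms(2)]])
  then show ?thesis unfolding Q_def[abs_def]
    by (intro simple_function_add simple_function_div simple_function_interval simple_function_const)
qed

lemma D_pseudometric: "pseudometric Y D" and D_0: "\<And>y y'. y \<in> topspace Y \<Longrightarrow> y' \<in> topspace Y \<Longrightarrow>
    D (y, y') = 0 \<Longrightarrow> y = y'"
  using D_metric unfolding metric_fun_iff by auto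

lemma D_nonneg: "y \<in> topspace Y \<Longrightarrow> y' \<in> topspace Y \<Longrightarrow> 0 \<le> D (y, y')"
  using D_pseudometric unfolding pseudometric_def by blast

lemma Q_less:
  assumes "y \<in> topspace Y" "y' \<in> topspace Y" "0 \<le> t" "t < r y" "t < r y'"
  shows "Q p y y' t = (1 - D (y, y')) * (p (a, a) / 2 + p (b, b) / 2) + D (y, y') * p (a, b)"
  using assms by (simp add: Q_def \<xi>_less K_def algebra_simps add_divide_distrib diff_divide_distrib)

lemma Q_ge:
  assumes "r y \<le> t \<or> r y' \<le> t"
  shows "Q p y y' t = p (\<xi> a y t, \<xi> a y' t) / 2 + p (\<xi> b y t, \<xi> b y' t) / 2"
  using assms by (auto simp: Q_def)

lemma Q_linear:
  assumes "y \<in> topspace Y" "y' \<in> topspace Y" "0 \<le> t" "t < 1"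
  shows "Q (\<lambda>s\<in>X \<times> X. k * p s + l * q s) y y' t = k * Q p y y' t + l * Q q y y' t"
  using \<xi>_in[OF assms(1) _ assms(3,4)] \<xi>_in[OF assms(2) _ assms(3,4)] ab
  by (simp add: Q_def K_def algebra_simps add_divide_distrib diff_divide_distrib)

section \<open>Linearity, positivity and boundedness of the operator\<close>

lemma T_linear:
  "T (\<lambda>s\<in>X \<times> X. k * p s + l * q s) = (\<lambda>s\<in>sq Y. k * T p s + l * T q s)"
proof
  fix s
  show "T (\<lambda>s\<in>X \<times> X. k * p s + l * q s) s = (\<lambda>s\<in>sq Y. k * T p s + l * T q s) s"
  proof (cases "s \<in> sq Y")
    case True
    then obtain y y' where s: "s = (y, y')" "y \<in> topspace Y" "y' \<in> topspace Y" by auto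
    have "(LINT t|unit_lborel. Q (\<lambda>s\<in>X \<times> X. k * p s + l * q s) y y' t) =
        (LINT t|unit_lborel. k * Q p y y' t + l * Q q y y' t)"
      using Q_linear[OF s(2,3)] by (intro Bochner_Integration.integral_cong) auto
    also have "\<dots> = k * (LINT t|unit_lborel. Q p y y' t) + l * (LINT t|unit_lborel. Q q y y' t)"
      using integrable_step[OF simple_Q[OF s(2,3)]] by simp
    finally show ?thesis using s by (simp add: T_eq)
  qed (auto simp: T_def)
qed

lemma D_convex:
  assumes "y \<in> topspace Y" "y' \<in> topspace Y" "v \<le> B" "w \<le> (B::real)"
  shows "(1 - D (y, y')) * v + D (y, y') * w \<le> B"
proof -
  have "(1 - D (y, y')) * v \<le> (1 - D (y, y')) * B" "D (y, y') * w \<le> D (y, y') * B"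
    using D_nonneg[OF assms(1,2)] D_le[OF assms(1,2)] assms(3,4) by (auto intro: mult_left_mono)
  then show ?thesis by (simp add: algebra_simps)
qed

lemma Q_le:
  assumes y: "y \<in> topspace Y" "y' \<in> topspace Y" and t: "0 \<le> t" "t < 1"
    and p: "\<And>s. s \<in> supp y \<times> supp y' \<Longrightarrow> p s \<le> B"
  shows "Q p y y' t \<le> B"
proof (cases "t < r y \<and> t < r y'")
  case True
  have "p (a, a) \<le> B" "p (b, b) \<le> B" "p (a, b) \<le> B" by (auto intro!: p simp: supp_def)
  then show ?thesis
    using Q_less[OF y t(1)] True D_convex[OF y, of "p (a, a) / 2 + p (b, b) / 2" B] by simp
next
  case False
  have "p (\<xi> a y t, \<xi> a y' t) \<le> B" "p (\<xi> b y t, \<xi> b y' t) \<le> B"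
    using t by (auto intro!: p simp: supp_def)
  then show ?thesis using Q_ge[of y t y' p] False by linarith
qed

text \<open>Combined with linearity, this one-sided bound yields positivity and, through
  \<open>T_diff_le\<close>, boundedness and continuity for the uniform and the compact-open
  topology.\<close>

lemma T_le:
  assumes y: "y \<in> topspace Y" "y' \<in> topspace Y"
    and p: "\<And>s. s \<in> supp y \<times> supp y' \<Longrightarrow> p s \<le> B"
  shows "T p (y, y') \<le> B"
  unfolding T_eq[OF y]
  by (rule integral_le_const[OF simple_Q[OF y]]) (rule Q_le[OF y _ _ p])

lemma supp_X: "y \<in> topspace Y \<Longrightarrow> supp y \<subseteq> X"
  using \<xi>_in ab by (auto simp: supp_def)

lemma T_diff_le:
  assumes y: "y \<in> topspace Y" "y' \<in> topspace Y"
    and p: "\<And>s. s \<in> supp y \<times> supp y' \<Longrightarrow> \<bar>p s - q s\<bar> \<le> B"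
  shows "\<bar>T p (y, y') - T q (y, y')\<bar> \<le> B"
proof -
  have *: "T p (y, y') - T q (y, y') \<le> B"
    if p: "\<And>s. s \<in> supp y \<times> supp y' \<Longrightarrow> p s - q s \<le> B" for p q
  proof -
    have "T (\<lambda>s\<in>X \<times> X. 1 * p s + (-1) * q s) (y, y') \<le> B"
    proof (rule T_le[OF y])
      fix s assume s: "s \<in> supp y \<times> supp y'"
      then have "s \<in> X \<times> X" using supp_X[OF y(1)] supp_X[OF y(2)] by auto
      then show "(\<lambda>s\<in>X \<times> X. 1 * p s + (-1) * q s) s \<le> B" using p[OF s] by simp
    qed
    then show ?thesis using y unfolding T_linear by simp
  qed
  have "p s - q s \<le> B" "q s - p s \<le> B" if "s \<in> supp y \<times> supp y'" for s
    using p[OF that] by auto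
  then show ?thesis using *[of p q] *[of q p] by (simp add: abs_le_iff)
qed

lemma T_const:
  assumes y: "y \<in> topspace Y" "y' \<in> topspace Y" and p: "\<And>s. s \<in> X \<times> X \<Longrightarrow> p s = k"
  shows "T p (y, y') = k"
proof -
  have "Q p y y' t = k" if "0 \<le> t" "t < 1" for t
    using \<xi>_in[OF y(1) _ that] \<xi>_in[OF y(2) _ that] ab p by (simp add: Q_def K_def)
  then have "(LINT t|unit_lborel. Q p y y' t) = (LINT t|unit_lborel. k)"
    by (intro Bochner_Integration.integral_cong) auto
  then show ?thesis using y by (simp add: T_eq)
qed

lemma T_extends: "z \<in> X \<Longrightarrow> z' \<in> X \<Longrightarrow> T p (z, z') = p (z, z')"
proof -
  assume z: "z \<in> X" "z' \<in> X"
  have "r z = 0" "r z' = 0" using z X_sub r_0 by auto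
  then have "Q p z z' t = p (z, z')" if "0 \<le> t" for t
    using z that by (simp add: Q_ge)
  then have "(LINT t|unit_lborel. Q p z z' t) = (LINT t|unit_lborel. p (z, z'))"
    by (intro Bochner_Integration.integral_cong) auto
  then show ?thesis using T_eq[of z z' p] z X_sub by auto
qed

lemma extension_operator_T: "extension_operator (sq (subtopology Y X)) (sq Y) T"
  unfolding extension_operator_def topspace_X
proof (intro conjI ballI Pi_I)
  show "T p \<in> rfun (sq Y)" for p by (rule T_funcset)
  fix p :: "'a \<times> 'a \<Rightarrow> real" assume p: "p \<in> rfun (X \<times> X)"
  show "restrict (T p) (X \<times> X) = p"
  proof
    fix s show "restrict (T p) (X \<times> X) s = p s"
      using PiE_arb[OF p, of s] T_extends by (cases "s \<in> X \<times> X") auto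
  qed
qed

lemma regular_operator_T: "regular_operator (sq (subtopology Y X)) (sq Y) T"
  unfolding regular_operator_def topspace_X
proof (intro conjI ballI allI impI)
  fix p q :: "'a \<times> 'a \<Rightarrow> real" and k
  show "T (\<lambda>s\<in>X \<times> X. p s + q s) = (\<lambda>s\<in>sq Y. T p s + T q s)"
    using T_linear[of 1 p 1 q] by simp
  show "T (\<lambda>s\<in>X \<times> X. k * p s) = (\<lambda>s\<in>sq Y. k * T p s)"
    using T_linear[of k p 0 p] by simp
next
  fix p :: "'a \<times> 'a \<Rightarrow> real" and s assume p: "\<forall>s\<in>X \<times> X. 0 \<le> p s" and s: "s \<in> sq Y"
  obtain y y' where y: "s = (y, y')" "y \<in> topspace Y" "y' \<in> topspace Y" using s by auto
  have "T (\<lambda>s\<in>X \<times> X. 0 * p s + (-1) * p s) (y, y') \<le> 0"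
  proof (rule T_le[OF y(2,3)])
    fix s assume "s \<in> supp y \<times> supp y'"
    then have "s \<in> X \<times> X" using supp_X[OF y(2)] supp_X[OF y(3)] by auto
    then show "(\<lambda>s\<in>X \<times> X. 0 * p s + (-1) * p s) s \<le> 0" using p by auto
  qed
  then show "0 \<le> T p s" using y unfolding T_linear by simp
next
  show "T (\<lambda>s\<in>X \<times> X. 1) = (\<lambda>s\<in>sq Y. 1)"
  proof
    fix s show "T (\<lambda>s\<in>X \<times> X. 1) s = (\<lambda>s\<in>sq Y. 1) s"
      using T_const[of "fst s" "snd s" "\<lambda>s\<in>X \<times> X. 1" 1]
      by (cases "s \<in> sq Y") (auto simp: T_def)
  qed
qed

lemma preserves_bounded: "preserves bounded_fun (subtopology Y X) Y T"
  unfolding preserves_def bounded_fun_def topspace_X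
proof (intro ballI impI)
  fix p :: "'a \<times> 'a \<Rightarrow> real" assume "bounded (p ` (X \<times> X))"
  then obtain B where B: "\<And>s. s \<in> X \<times> X \<Longrightarrow> \<bar>p s\<bar> \<le> B"
    unfolding bounded_iff by auto
  have "\<bar>T p s\<bar> \<le> B" if s: "s \<in> sq Y" for s
  proof -
    obtain y y' where y: "s = (y, y')" "y \<in> topspace Y" "y' \<in> topspace Y" using s by auto
    have "\<bar>T p (y, y') - T (\<lambda>_. 0) (y, y')\<bar> \<le> B"
    proof (rule T_diff_le[OF y(2,3)])
      fix s assume "s \<in> supp y \<times> supp y'"
      then have "s \<in> X \<times> X" using supp_X[OF y(2)] supp_X[OF y(3)] by auto
      then show "\<bar>p s - 0\<bar> \<le> B" using B by simp
    qed
    then show ?thesis using T_const[OF y(2,3), of "\<lambda>_. 0" 0] y by simp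
  qed
  then show "bounded (T p ` sq Y)" unfolding bounded_iff by (intro exI[of _ B]) auto
qed

section \<open>Pseudometrics\<close>

context
  fixes p assumes p: "pseudometric (subtopology Y X) p"
begin

lemma p_0: "s \<in> X \<Longrightarrow> p (s, s) = 0"
  and p_nonneg: "s \<in> X \<Longrightarrow> s' \<in> X \<Longrightarrow> 0 \<le> p (s, s')"
  and p_sym: "s \<in> X \<Longrightarrow> s' \<in> X \<Longrightarrow> p (s, s') = p (s', s)"
  and p_tri: "s \<in> X \<Longrightarrow> s' \<in> X \<Longrightarrow> s'' \<in> X \<Longrightarrow> p (s, s'') \<le> p (s, s') + p (s', s'')"
  using p unfolding pseudometric_def topspace_X by blast+

lemma K_p: "K p = p (a, b)"
  using p_0 ab by (simp add: K_def)

lemma Q_refl: "y \<in> topspace Y \<Longrightarrow> 0 \<le> t \<Longrightarrow> t < 1 \<Longrightarrow> Q p y y t = 0"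
  using p_0 \<xi>_in ab D_pseudometric by (simp add: Q_def pseudometric_def)

lemma Q_sym:
  assumes "y \<in> topspace Y" "y' \<in> topspace Y" "0 \<le> t" "t < 1"
  shows "Q p y y' t = Q p y' y t"
  using p_sym[OF \<xi>_in[OF assms(1) ab(1) assms(3,4)] \<xi>_in[OF assms(2) ab(1) assms(3,4)]]
    p_sym[OF \<xi>_in[OF assms(1) ab(2) assms(3,4)] \<xi>_in[OF assms(2) ab(2) assms(3,4)]]
    D_pseudometric assms(1,2)
  by (simp add: Q_def pseudometric_def min.commute)

lemma Q_nonneg:
  assumes "y \<in> topspace Y" "y' \<in> topspace Y" "0 \<le> t" "t < 1"
  shows "0 \<le> Q p y y' t"
  using p_nonneg[OF \<xi>_in[OF assms(1) ab(1) assms(3,4)] \<xi>_in[OF assms(2) ab(1) assms(3,4)]]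
    p_nonneg[OF \<xi>_in[OF assms(1) ab(2) assms(3,4)] \<xi>_in[OF assms(2) ab(2) assms(3,4)]]
    D_nonneg[OF assms(1,2)] p_nonneg[OF ab(1,2)]
  by (simp add: Q_def K_p)

text \<open>The value \<open>\<xi> a y t\<close> is \<open>a\<close> or \<open>b\<close> with equal weights where \<open>t < r y\<close>; a point outside that
  range has total distance at least \<open>p (a, b)\<close> to the two, which pays for the term with \<open>D\<close>.\<close>

lemma Q_tri:
  assumes y: "y \<in> topspace Y" "y' \<in> topspace Y" "y'' \<in> topspace Y" and t: "0 \<le> t" "t < 1"
  shows "Q p y y'' t \<le> Q p y y' t + Q p y' y'' t"
proof -
  have in_X: "\<xi> e y t \<in> X" "\<xi> e y' t \<in> X" "\<xi> e y'' t \<in> X" if "e \<in> X" for e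
    using \<xi>_in y t that by auto
  have tri: "p (\<xi> e y t, \<xi> e y'' t) \<le> p (\<xi> e y t, \<xi> e y' t) + p (\<xi> e y' t, \<xi> e y'' t)"
    if "e \<in> X" for e using p_tri in_X that by blast
  have nn: "0 \<le> D (y, y') * p (a, b)" "0 \<le> D (y', y'') * p (a, b)"
    using D_nonneg y p_nonneg ab by auto
  show ?thesis
  proof (cases "t < r y \<and> t < r y''")
    case False
    then have "Q p y y'' t = p (\<xi> a y t, \<xi> a y'' t) / 2 + p (\<xi> b y t, \<xi> b y'' t) / 2"
      by (intro Q_ge) auto
    also have "\<dots> \<le> p (\<xi> a y t, \<xi> a y' t) / 2 + p (\<xi> b y t, \<xi> b y' t) / 2 +
        p (\<xi> a y' t, \<xi> a y'' t) / 2 + p (\<xi> b y' t, \<xi> b y'' t) / 2"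
      using tri[OF ab(1)] tri[OF ab(2)] by linarith
    also have "\<dots> \<le> Q p y y' t + Q p y' y'' t"
      using nn unfolding Q_def K_p by simp
    finally show ?thesis .
  next
    case True
    then have Q: "Q p y y'' t = D (y, y'') * p (a, b)"
      using Q_less[OF y(1,3) t(1)] p_0 ab by simp
    show ?thesis
    proof (cases "t < r y'")
      case r': True
      have "D (y, y'') * p (a, b) \<le> (D (y, y') + D (y', y'')) * p (a, b)"
        using D_pseudometric y p_nonneg[OF ab(1,2)] unfolding pseudometric_def
        by (intro mult_right_mono) blast+
      then show ?thesis
        using Q Q_less[OF y(1,2) t(1)] Q_less[OF y(2,3) t(1)] r' True p_0 ab
        by (simp add: algebra_simps)
    next
      case False
      define s where "s = \<xi> a y' t"
      have s: "\<xi> a y' t = s" "\<xi> b y' t = s" "s \<in> X"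
        using \<xi>_ge[of y' t b a] False in_X ab by (auto simp: s_def)
      have "Q p y y' t = p (a, s) / 2 + p (b, s) / 2" "Q p y' y'' t = p (s, a) / 2 + p (s, b) / 2"
        using Q_ge[of y t y' p] Q_ge[of y' t y'' p] False True s y t by (auto simp: \<xi>_less)
      moreover have "p (a, b) \<le> p (a, s) + p (s, b)" using p_tri s ab by blast
      moreover have "p (s, a) = p (a, s)" "p (s, b) = p (b, s)" using p_sym s ab by blast+
      moreover have "D (y, y'') * p (a, b) \<le> p (a, b)"
        using D_le[OF y(1,3)] p_nonneg[OF ab(1,2)] D_nonneg[OF y(1,3)]
        by (intro mult_left_le_one_le)
      ultimately show ?thesis using Q by linarith
    qed
  qed
qed

lemma pseudometric_T: "pseudometric Y (T p)"
  unfolding pseudometric_def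
proof (intro conjI ballI)
  fix y assume y: "y \<in> topspace Y"
  have "(LINT t|unit_lborel. Q p y y t) = (LINT t|unit_lborel. 0)"
    using Q_refl[OF y] by (intro Bochner_Integration.integral_cong) auto
  then show "T p (y, y) = 0" using y by (simp add: T_eq)
  fix y' assume y': "y' \<in> topspace Y"
  show "0 \<le> T p (y, y')"
    unfolding T_eq[OF y y'] by (rule integral_ge_const[OF simple_Q[OF y y']]) (rule Q_nonneg[OF y y'])
  have "(LINT t|unit_lborel. Q p y y' t) = (LINT t|unit_lborel. Q p y' y t)"
    using Q_sym[OF y y'] by (intro Bochner_Integration.integral_cong) auto
  then show "T p (y, y') = T p (y', y)" using y y' by (simp add: T_eq)
  fix y'' assume y'': "y'' \<in> topspace Y"
  have "(LINT t|unit_lborel. Q p y y'' t) \<le> (LINT t|unit_lborel. Q p y y' t + Q p y' y'' t)"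
    using Q_tri[OF y y' y'']
    by (intro integral_mono_unit simple_function_add simple_Q y y' y'')
  also have "\<dots> = (LINT t|unit_lborel. Q p y y' t) + (LINT t|unit_lborel. Q p y' y'' t)"
    by (intro Bochner_Integration.integral_add integrable_step simple_Q y y' y'')
  finally show "T p (y, y'') \<le> T p (y, y') + T p (y', y'')" using y y' y'' by (simp add: T_eq)
qed

text \<open>Below both \<open>r y\<close> and \<open>r y'\<close> the integrand is
  \<open>D (y, y') * p (a, b)\<close>. Between the two, one step function takes \<open>a\<close> and
  \<open>b\<close> in turn while the other has the same value \<open>s\<close> in both cases, and
  \<open>p (a, s) + p (b, s) \<ge> p (a, b)\<close> leaves at least \<open>p (a, b) / 2\<close>. The
  lengths of these intervals are \<open>min (r y) (r y')\<close> and
  \<open>\<bar>r y - r y'\<bar>\<close>.\<close>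

lemma T_lower:
  assumes y: "y \<in> topspace Y" "y' \<in> topspace Y"
  shows "p (a, b) * (min (r y) (r y') * D (y, y') + \<bar>r y - r y'\<bar> / 2) \<le> T p (y, y')"
proof -
  \<comment> \<open>The lower bound is split into two functions that are constant on one initial
    interval each, the shape that \<open>integral_interval\<close> handles; on the common part
    \<open>h1\<close> subtracts what \<open>h2\<close> adds.\<close>
  define h1 where "h1 t = (if t < min (r y) (r y') then D (y, y') * p (a, b) - p (a, b) / 2 else 0)" for t
  define h2 where "h2 t = (if t < max (r y) (r y') then p (a, b) / 2 else 0)" for t
  have r: "0 \<le> min (r y) (r y')" "min (r y) (r y') \<le> 1" "0 \<le> max (r y) (r y')" "max (r y) (r y') \<le> 1"
    using r_bounds[OF y(1)] r_bounds[OF y(2)] by auto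
  have s: "simple_function unit_lborel h1" "simple_function unit_lborel h2"
    unfolding h1_def[abs_def] h2_def[abs_def] by (rule simple_function_interval)+
  have *: "p (a, b) / 2 \<le> p (a, s) / 2 + p (b, s) / 2" "p (a, b) / 2 \<le> p (s, a) / 2 + p (s, b) / 2"
    if "s \<in> X" for s
    using p_tri[of a s b] p_sym[of s b] p_sym[of s a] that ab by auto
  have le: "h1 t + h2 t \<le> Q p y y' t" if t: "0 \<le> t" "t < 1" for t
  proof -
    consider "t < r y" "t < r y'" | "t < r y" "r y' \<le> t" | "r y \<le> t" "t < r y'" | "r y \<le> t" "r y' \<le> t"
      by linarith
    then show ?thesis
    proof cases
      case 1
      then show ?thesis using Q_less[OF y t(1), of p] p_0 ab by (simp add: h1_def h2_def)
    next
      case 2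
      have "\<xi> b y' t = \<xi> a y' t" "\<xi> a y' t \<in> X" using 2 \<xi>_ge[of y' t b a] \<xi>_in[OF y(2) ab(1) t] by auto
      then show ?thesis
        using 2 *(1)[of "\<xi> a y' t"] Q_ge[of y t y' p] \<xi>_less[OF y(1) t(1)]
        by (simp add: h1_def h2_def)
    next
      case 3
      have "\<xi> b y t = \<xi> a y t" "\<xi> a y t \<in> X" using 3 \<xi>_ge[of y t b a] \<xi>_in[OF y(1) ab(1) t] by auto
      then show ?thesis
        using 3 *(2)[of "\<xi> a y t"] Q_ge[of y t y' p] \<xi>_less[OF y(2) t(1)]
        by (simp add: h1_def h2_def)
    next
      case 4
      then have "h1 t = 0" "h2 t = 0" by (auto simp: h1_def h2_def)
      then show ?thesis using Q_nonneg[OF y t] by simp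
    qed
  qed
  have "p (a, b) * (min (r y) (r y') * D (y, y') + \<bar>r y - r y'\<bar> / 2) =
      (LINT t|unit_lborel. h1 t) + (LINT t|unit_lborel. h2 t)"
    unfolding h1_def h2_def integral_interval[OF r(1,2)] integral_interval[OF r(3,4)]
    by (simp add: algebra_simps abs_if min_def max_def diff_divide_distrib)
  also have "\<dots> = (LINT t|unit_lborel. h1 t + h2 t)"
    by (intro Bochner_Integration.integral_add[symmetric] integrable_step s)
  also have "\<dots> \<le> T p (y, y')"
    unfolding T_eq[OF y] by (intro integral_mono_unit simple_function_add s simple_Q y le)
  finally show ?thesis .
qed

end

lemma preserves_pseudometric: "preserves pseudometric (subtopology Y X) Y T"
  unfolding preserves_def using pseudometric_T by blast

section \<open>Metrics and dominating metrics\<close>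

lemma metric_pos:
  assumes "metric_fun (subtopology Y X) p"
  shows "0 < p (a, b)"
  using assms ab unfolding metric_fun_iff topspace_X pseudometric_def
  by (metis less_eq_real_def)

text \<open>Distance zero forces both terms of \<open>T_lower\<close> to vanish, hence
  \<open>r y = r y'\<close>. If this value is 0, both points lie in \<open>X\<close>, where
  \<open>T p\<close> is \<open>p\<close>; otherwise \<open>D (y, y')\<close> itself must
  vanish.\<close>

lemma preserves_metric: "preserves metric_fun (subtopology Y X) Y T"
  unfolding preserves_def
proof (intro ballI impI)
  fix p assume m: "metric_fun (subtopology Y X) p"
  then have p: "pseudometric (subtopology Y X) p" unfolding metric_fun_iff by blast
  have "y = y'" if y: "y \<in> topspace Y" "y' \<in> topspace Y" and 0: "T p (y, y') = 0" for y y'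
  proof -
    have n: "0 \<le> min (r y) (r y') * D (y, y')"
      using r_bounds[OF y(1)] r_bounds[OF y(2)] D_nonneg[OF y] by simp
    have "min (r y) (r y') * D (y, y') + \<bar>r y - r y'\<bar> / 2 \<le> 0"
      using T_lower[OF p y] metric_pos[OF m] 0 by (simp add: mult_le_0_iff)
    moreover have nonpos: "v \<le> 0 \<and> w \<le> 0" if "v + w / 2 \<le> 0" "0 \<le> v" "0 \<le> w" for v w :: real
      using that by linarith
    ultimately have le: "min (r y) (r y') * D (y, y') \<le> 0" "\<bar>r y - r y'\<bar> \<le> 0"
      using nonpos[OF _ n abs_ge_zero] by blast+
    have e: "r y = r y'" using le(2) by simp
    have e2: "min (r y) (r y') * D (y, y') = 0" by (rule antisym[OF le(1) n])
    show ?thesis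
    proof (cases "r y = 0")
      case True
      then have "y \<in> X" "y' \<in> X" using r_0[OF y(1)] r_0[OF y(2)] e by simp_all
      then show ?thesis using 0 T_extends m unfolding metric_fun_iff topspace_X by simp
    next
      case False
      then show ?thesis using e e2 D_0[OF y] by simp
    qed
  qed
  then show "metric_fun Y (T p)" unfolding metric_fun_iff using pseudometric_T[OF p] by blast
qed

text \<open>Outside \<open>X\<close> domination is inherited from \<open>D\<close>. At
  \<open>z \<in> X\<close> the given metric \<open>p\<close> only sees \<open>X\<close>: a small
  distance to some \<open>z'\<close> outside \<open>X\<close> makes \<open>r z'\<close> small and
  some attached point used by \<open>z'\<close> close to \<open>z\<close>. The hypothesis
  \<open>x_dom\<close>, a converse of \<open>x_near\<close>, carries this closeness over to
  \<open>z'\<close>.\<close>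

lemma preserves_dominating:
  assumes D: "dominating_metric Y D"
    and x_dom: "\<And>s V. s \<in> X \<Longrightarrow> openin Y V \<Longrightarrow> s \<in> V \<Longrightarrow>
      \<exists>\<delta>>0. \<exists>V'. openin Y V' \<and> s \<in> V' \<and>
        (\<forall>y\<in>topspace Y - X. \<forall>j\<in>J. r y < \<delta> \<and> y \<in> U j \<and> x j \<in> V' \<longrightarrow> y \<in> V)"
  shows "preserves dominating_metric (subtopology Y X) Y T"
  unfolding preserves_def
proof (intro ballI impI)
  fix p assume p': "p \<in> rfun (sq (subtopology Y X))" and dm: "dominating_metric (subtopology Y X) p"
  then have m: "metric_fun (subtopology Y X) p" by (simp add: dominating_metric_def)
  then have p: "pseudometric (subtopology Y X) p" unfolding metric_fun_iff by blast
  have pab: "0 < p (a, b)" by (rule metric_pos[OF m])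
  have dom: "\<exists>e>0. \<forall>z'\<in>X. p (z, z') < e \<longrightarrow> z' \<in> V" if "z \<in> X" "openin Y V" "z \<in> V" for z V
  proof -
    have "openin (subtopology Y X) (V \<inter> X)" using that(2) by (auto simp: openin_subtopology)
    moreover have "z \<in> V \<inter> X" using that by simp
    ultimately obtain e where "e > 0" "{z' \<in> X. p (z, z') < e} \<subseteq> V \<inter> X"
      using dm[unfolded dominating_metric_def topspace_X, THEN conjunct2, rule_format,
          of "V \<inter> X" z] by auto
    then show ?thesis by (intro exI[of _ e]) auto
  qed
  show "dominating_metric Y (T p)"
    unfolding dominating_metric_def
  proof (intro conjI allI impI)
    show "metric_fun Y (T p)" using preserves_metric[unfolded preserves_def, rule_format, OF p' m] .
    fix z V assume zV: "openin Y V \<and> z \<in> V"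
    then have z: "z \<in> topspace Y" using openin_subset[of Y V] by auto
    show "\<exists>e>0. {z' \<in> topspace Y. T p (z, z') < e} \<subseteq> V"
    proof (cases "z \<in> X")
      case False
      then have rz: "0 < r z" using r_bounds[OF z] r_0[OF z] by linarith
      obtain e where e: "e > 0" "{z' \<in> topspace Y. D (z, z') < e} \<subseteq> V"
        using D[unfolded dominating_metric_def, THEN conjunct2, rule_format, OF zV] by auto
      \<comment> \<open>The first bound gives \<open>\<bar>r z - r z'\<bar> < r z / 2\<close>, so
        \<open>min (r z) (r z')\<close> is at least \<open>r z / 2\<close>; the second bound then
        gives \<open>D (z, z') < e\<close>.\<close>
      define k where "k = p (a, b) * min (r z / 4) (r z / 2 * e)"
      have "k > 0" using pab rz e by (simp add: k_def)
      moreover have "z' \<in> V" if z': "z' \<in> topspace Y" and lt: "T p (z, z') < k" for z'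
      proof -
        have mn: "0 \<le> min (r z) (r z') * D (z, z')"
          using r_bounds[OF z] r_bounds[OF z'] D_nonneg[OF z z'] by simp
        have "p (a, b) * (min (r z) (r z') * D (z, z') + \<bar>r z - r z'\<bar> / 2) <
            p (a, b) * min (r z / 4) (r z / 2 * e)"
          using T_lower[OF p z z'] lt unfolding k_def by linarith
        then have lt': "min (r z) (r z') * D (z, z') + \<bar>r z - r z'\<bar> / 2 < min (r z / 4) (r z / 2 * e)"
          using pab by simp
        have split: "v < k \<and> v < l \<and> w / 2 < k" if "v + w / 2 < min k l" "0 \<le> v" "0 \<le> w"
          for v w k l :: real
          using that by auto
        have sp: "min (r z) (r z') * D (z, z') < r z / 2 * e" "\<bar>r z - r z'\<bar> / 2 < r z / 4"
          using split[OF lt' mn] by simp_all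
        have "r z / 2 \<le> r z'" using sp(2) rz by (simp add: abs_if split: if_splits)
        then have "r z / 2 \<le> min (r z) (r z')" using rz by simp
        then have "r z / 2 * D (z, z') \<le> min (r z) (r z') * D (z, z')"
          using D_nonneg[OF z z'] by (rule mult_right_mono)
        also note sp(1)
        finally have "D (z, z') < e" using rz by simp
        then show ?thesis using e z' by blast
      qed
      ultimately show ?thesis by blast
    next
      case True
      then have rz: "r z = 0" using r_0[OF z] by blast
      obtain \<delta> V' where V': "\<delta> > 0" "openin Y V'" "z \<in> V'"
        "\<And>y j. y \<in> topspace Y - X \<Longrightarrow> j \<in> J \<Longrightarrow> r y < \<delta> \<Longrightarrow> y \<in> U j \<Longrightarrow> x j \<in> V' \<Longrightarrow> y \<in> V"
        using x_dom[OF True, of V] zV by blast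
      obtain \<eta>' where \<eta>': "\<eta>' > 0" "\<forall>z'\<in>X. p (z, z') < \<eta>' \<longrightarrow> z' \<in> V' \<inter> V"
        using dom[OF True, of "V' \<inter> V"] V' zV by blast
      \<comment> \<open>Since \<open>T p (z, z')\<close> is at least
        \<open>p (a, b) * r z' / 2\<close>, the second bound gives
        \<open>r z' < min \<delta> (1/2)\<close>. Then \<open>{r z'..<1}\<close> is longer than 1/2,
        and the first bound prevents \<open>p (z, \<xi> a z' t) \<ge> \<eta>'\<close> from holding
        throughout it.\<close>
      define k where "k = min (\<eta>' / 2) (p (a, b) / 2 * min \<delta> (1/2))"
      have "k > 0" using \<eta>' V' pab by (simp add: k_def)
      moreover have "z' \<in> V" if z': "z' \<in> topspace Y" and lt: "T p (z, z') < k" for z'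
      proof (cases "z' \<in> X")
        case z'X: True
        then have "p (z, z') < \<eta>'" using lt T_extends[OF True z'X] \<eta>'(1) by (simp add: k_def)
        then show ?thesis using \<eta>' z'X by blast
      next
        case False
        have "p (a, b) * (r z' / 2) \<le> T p (z, z')"
          using T_lower[OF p z z'] rz r_bounds[OF z'] by simp
        also have "\<dots> < p (a, b) / 2 * min \<delta> (1/2)" using lt by (simp add: k_def)
        finally have "p (a, b) / 2 * r z' < p (a, b) / 2 * min \<delta> (1/2)" by simp
        then have r': "r z' < min \<delta> (1/2)" using pab by simp
        have "\<exists>t. r z' \<le> t \<and> t < 1 \<and> p (z, \<xi> a z' t) < \<eta>'"
        proof (rule ccontr)
          assume "\<not> ?thesis"
          then have big: "\<eta>' \<le> p (z, \<xi> a z' t)" if "r z' \<le> t" "t < 1" for t using that by force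
          have "(if t < r z' then 0 else \<eta>') \<le> Q p z z' t" if t: "0 \<le> t" "t < 1" for t
          proof (cases "t < r z'")
            case True
            then show ?thesis using Q_nonneg[OF p z z' t] by simp
          next
            case False
            then show ?thesis
              using Q_ge[of z t z' p] rz t \<open>z \<in> X\<close> \<xi>_ge[of z' t b a] big[of t] by simp
          qed
          then have "(LINT t|unit_lborel. (if t < r z' then 0 else \<eta>')) \<le> T p (z, z')"
            unfolding T_eq[OF z z']
            by (intro integral_mono_unit simple_function_interval simple_Q z z')
          then have "(1 - r z') * \<eta>' \<le> T p (z, z')"
            using integral_interval[of "r z'" 0 \<eta>'] r_bounds[OF z'] by simp
          moreover have "(1/2) * \<eta>' \<le> (1 - r z') * \<eta>'" using r' \<eta>' by (intro mult_right_mono) auto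
          ultimately show False using lt by (simp add: k_def)
        qed
        then obtain t where t: "r z' \<le> t" "t < 1" "p (z, \<xi> a z' t) < \<eta>'" by blast
        then have t0: "0 \<le> t" using r_bounds[OF z'] by linarith
        have "\<xi> a z' t \<in> V'" using \<eta>' t \<xi>_in[OF z' ab(1) t0 t(2)] by blast
        moreover have "\<xi> a z' t = x (c (idx z' t) z')" using t False by (simp add: \<xi>_def)
        moreover note c_in(1,2)[OF z' False idx_less[OF in_W[OF z' False] t0 t(2)]]
        ultimately show ?thesis using V'(4)[of z' "c (idx z' t) z'"] z' False r' by simp
      qed
      ultimately show ?thesis by blast
    qed
  qed
qed

end

section \<open>Continuity of the extended functions\<close>

lemma continuous_map_real_at:
  fixes f :: "'a \<Rightarrow> real"
  assumes "continuous_map Z euclideanreal f" "x \<in> topspace Z" "e > 0"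
  shows "\<exists>N. openin Z N \<and> x \<in> N \<and> (\<forall>y\<in>N. \<bar>f y - f x\<bar> < e)"
  using assms by (simp only: continuous_map_real_iff)

context extension_data
begin

text \<open>A form of continuity in measure that also controls the values on the exceptional set.\<close>

definition step_nbhd :: "'a \<Rightarrow> 'a \<Rightarrow> 'a set \<Rightarrow> ('a \<Rightarrow> 'a set) \<Rightarrow> real \<Rightarrow> 'a set \<Rightarrow> bool" where
  "step_nbhd e y0 F V \<delta> N \<longleftrightarrow> openin Y N \<and> y0 \<in> N \<and>
    (\<forall>y\<in>N. (\<forall>t\<in>{0..<1}. \<exists>s\<in>F. \<xi> e y t \<in> V s) \<and>
      (\<exists>B\<in>sets unit_lborel. measure unit_lborel B < \<delta> \<and>
        (\<forall>t\<in>{0..<1} - B. \<xi> e y t \<in> V (\<xi> e y0 t))))"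

text \<open>The neighbourhoods \<open>V s\<close> are prescribed in advance for the points of a
  finite set \<open>F\<close>. It may exceed the set of values at \<open>y0\<close>: it can include
  the base point and the values of steps that are empty at \<open>y0\<close> but not at points
  nearby.\<close>

definition step_continuous_at :: "'a \<Rightarrow> 'a \<Rightarrow> bool" where
  "step_continuous_at e y0 \<longleftrightarrow> (\<exists>F. finite F \<and> F \<subseteq> X \<and> \<xi> e y0 ` {0..<1} \<subseteq> F \<and>
    (\<forall>V. (\<forall>s\<in>F. openin Y (V s) \<and> s \<in> V s) \<longrightarrow> (\<forall>\<delta>>0. \<exists>N. step_nbhd e y0 F V \<delta> N)))"

text \<open>Near \<open>y0\<close> the base point is taken only on \<open>{0..<r y}\<close>, which
  is short since \<open>r\<close> is continuous with \<open>r y0 = 0\<close>. The other values are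
  \<open>y\<close> itself or attached points of members meeting a small neighbourhood of
  \<open>y0\<close>, and these lie in \<open>V y0\<close> by \<open>x_near\<close>.\<close>

lemma step_continuous_at_X:
  assumes e: "e \<in> X" and y0: "y0 \<in> X"
  shows "step_continuous_at e y0"
  unfolding step_continuous_at_def step_nbhd_def
proof (rule exI[of _ "{y0, e}"], intro conjI allI impI)
  show "\<xi> e y0 ` {0..<1} \<subseteq> {y0, e}" using y0 by auto
  fix V and \<delta> :: real assume V: "\<forall>s\<in>{y0, e}. openin Y (V s) \<and> s \<in> V s" and \<delta>: "\<delta> > 0"
  have y0Y: "y0 \<in> topspace Y" using X_sub y0 by blast
  obtain N1 where N1: "openin Y N1" "y0 \<in> N1" "\<forall>j\<in>J. U j \<inter> N1 \<noteq> {} \<longrightarrow> x j \<in> V y0"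
    using x_near[OF y0, of "V y0"] V by blast
  obtain N2 where N2: "openin Y N2" "y0 \<in> N2" "\<And>y. y \<in> N2 \<Longrightarrow> \<bar>r y - r y0\<bar> < \<delta>"
    using continuous_map_real_at[OF r_cont y0Y \<delta>] by blast
  show "\<exists>N. openin Y N \<and> y0 \<in> N \<and> (\<forall>y\<in>N. (\<forall>t\<in>{0..<1}. \<exists>s\<in>{y0, e}. \<xi> e y t \<in> V s) \<and>
      (\<exists>B\<in>sets unit_lborel. measure unit_lborel B < \<delta> \<and>
        (\<forall>t\<in>{0..<1} - B. \<xi> e y t \<in> V (\<xi> e y0 t))))"
  proof (intro exI[of _ "N1 \<inter> N2 \<inter> V y0"] conjI ballI)
    show "openin Y (N1 \<inter> N2 \<inter> V y0)" using N1 N2 V by auto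
    show "y0 \<in> N1 \<inter> N2 \<inter> V y0" using N1 N2 V by auto
    fix y assume y: "y \<in> N1 \<inter> N2 \<inter> V y0"
    then have yY: "y \<in> topspace Y" using openin_subset[OF N1(1)] by auto
    have *: "\<xi> e y t \<in> V y0" if t: "t \<in> {0..<1}" "r y \<le> t" for t
    proof (cases "y \<in> X")
      case True
      then show ?thesis using y by simp
    next
      case False
      have "u (idx y t) y < u (Suc (idx y t)) y" using idx_less[OF in_W[OF yY False]] t by simp
      note c_in(1,2)[OF yY False this]
      then show ?thesis using N1(3) y t False by (auto simp: \<xi>_def)
    qed
    show "\<exists>s\<in>{y0, e}. \<xi> e y t \<in> V s" if t: "t \<in> {0..<1}" for t
    proof (cases "r y \<le> t")
      case True
      then show ?thesis using *[OF t] by blast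
    next
      case False
      then have "\<xi> e y t = e" using \<xi>_less[OF yY] t by simp
      then show ?thesis using V by auto
    qed
    show "\<exists>B\<in>sets unit_lborel. measure unit_lborel B < \<delta> \<and>
        (\<forall>t\<in>{0..<1} - B. \<xi> e y t \<in> V (\<xi> e y0 t))"
    proof (intro bexI[of _ "{0..<r y}"] conjI ballI)
      have r: "0 \<le> r y" "r y \<le> 1" using r_bounds[OF yY] by auto
      then show "{0..<r y} \<in> sets unit_lborel" by (intro sets_unit_lborel) auto
      have "\<bar>r y - r y0\<bar> < \<delta>" "r y0 = 0" using N2(3) y r_0[OF y0Y] y0 by auto
      then show "measure unit_lborel {0..<r y} < \<delta>" using r by (simp add: measure_unit_lborel)
      fix t assume "t \<in> {0..<1} - {0..<r y}"
      then have "t \<in> {0..<1}" "r y \<le> t" by auto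
      then show "\<xi> e y t \<in> V (\<xi> e y0 t)" using * y0 by simp
    qed
  qed
qed (use y0 e in auto)

lemma uniform_breakpoints:
  assumes y0: "y0 \<in> topspace Y" "y0 \<notin> X" and \<eta>: "\<eta> > 0"
  obtains N where "openin Y N" "y0 \<in> N" "N \<subseteq> topspace Y - X"
    "\<And>y n. y \<in> N \<Longrightarrow> n \<le> k \<Longrightarrow> \<bar>u n y - u n y0\<bar> < \<eta>"
proof -
  let ?W = "subtopology Y (topspace Y - X)"
  have "\<exists>N. openin ?W N \<and> y0 \<in> N \<and> (\<forall>y\<in>N. \<bar>u n y - u n y0\<bar> < \<eta>)" for n
    by (rule continuous_map_real_at[OF u_cont in_W[OF y0] \<eta>])
  then have "\<forall>n. \<exists>N. openin ?W N \<and> y0 \<in> N \<and> (\<forall>y\<in>N. \<bar>u n y - u n y0\<bar> < \<eta>)" by blast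
  from choice[OF this] obtain N where N: "\<And>n. openin ?W (N n)" "\<And>n. y0 \<in> N n"
    "\<And>n y. y \<in> N n \<Longrightarrow> \<bar>u n y - u n y0\<bar> < \<eta>" by blast
  have "openin ?W (\<Inter>n\<in>{..k}. N n)" using N(1) by (intro openin_INT2) auto
  then show thesis
    using N unfolding openin_W by (intro that[of "\<Inter>n\<in>{..k}. N n"]) auto
qed

lemma locally_finite_values:
  assumes y0: "y0 \<in> topspace Y" "y0 \<notin> X"
  obtains N k s where "openin Y N" "y0 \<in> N" "N \<subseteq> topspace Y - X" "\<And>n. s n \<in> X"
    "\<And>y n. y \<in> N \<Longrightarrow> n \<ge> k \<Longrightarrow> u n y = 1"
    "\<And>y n. y \<in> N \<Longrightarrow> u n y < u (Suc n) y \<Longrightarrow> n < k \<and> x (c n y) = s n"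
proof -
  let ?W = "subtopology Y (topspace Y - X)"
  obtain N0 k where N0: "openin ?W N0" "y0 \<in> N0" "\<forall>y\<in>N0. \<forall>n\<ge>k. u n y = 1"
    using u_1[OF in_W[OF y0]] by blast
  have "\<exists>N s. openin ?W N \<and> y0 \<in> N \<and> s \<in> X \<and> (\<forall>y\<in>N. u n y < u (Suc n) y \<longrightarrow> x (c n y) = s)" for n
  proof -
    obtain N j where N: "openin ?W N" "y0 \<in> N" "\<forall>y\<in>N. u n y < u (Suc n) y \<longrightarrow> c n y = j"
      using u_locconst[OF in_W[OF y0]] by blast
    \<comment> \<open>If \<open>j\<close> is not in \<open>J\<close>, then the \<open>n\<close>-th
      step is empty throughout \<open>N\<close>; the default \<open>a\<close> merely keeps
      \<open>s n\<close> in \<open>X\<close>.\<close>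
    have "x (c n y) = (if j \<in> J then x j else a)" if "y \<in> N" "u n y < u (Suc n) y" for y
    proof -
      have "y \<in> topspace Y" "y \<notin> X" using that(1) N(1) unfolding openin_W by auto
      then have "c n y \<in> J" using c_in(1) that(2) by blast
      then show ?thesis using N(3) that by auto
    qed
    then show ?thesis using N(1,2) x_in ab
      by (intro exI[of _ N] exI[of _ "if j \<in> J then x j else a"]) auto
  qed
  then have "\<forall>n. \<exists>N s. openin ?W N \<and> y0 \<in> N \<and> s \<in> X \<and> (\<forall>y\<in>N. u n y < u (Suc n) y \<longrightarrow> x (c n y) = s)"
    by blast
  from choice[OF this] obtain N where "\<forall>n. \<exists>s. openin ?W (N n) \<and> y0 \<in> N n \<and> s \<in> X \<and>
      (\<forall>y\<in>N n. u n y < u (Suc n) y \<longrightarrow> x (c n y) = s)" by blast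
  from choice[OF this] obtain s where N: "\<And>n. openin ?W (N n)" "\<And>n. y0 \<in> N n" "\<And>n. s n \<in> X"
    "\<And>n y. y \<in> N n \<Longrightarrow> u n y < u (Suc n) y \<Longrightarrow> x (c n y) = s n" by blast
  have op: "openin ?W (N0 \<inter> (\<Inter>n\<in>{..k}. N n))"
    using N(1) N0(1) by (intro openin_Int openin_INT2) auto
  show thesis
  proof (rule that)
    show "openin Y (N0 \<inter> (\<Inter>n\<in>{..k}. N n))" "N0 \<inter> (\<Inter>n\<in>{..k}. N n) \<subseteq> topspace Y - X"
      using op unfolding openin_W by blast+
    show "y0 \<in> N0 \<inter> (\<Inter>n\<in>{..k}. N n)" using N0(2) N(2) by blast
    show "s n \<in> X" for n by (rule N(3))
    fix y n assume y: "y \<in> N0 \<inter> (\<Inter>n\<in>{..k}. N n)"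
    show "u n y = 1" if "n \<ge> k" using y N0(3) that by simp
    assume lt: "u n y < u (Suc n) y"
    have "n < k"
    proof (rule ccontr)
      assume "\<not> n < k"
      then have "u n y = 1" "u (Suc n) y = 1" using y N0(3) by auto
      then show False using lt by simp
    qed
    then show "n < k \<and> x (c n y) = s n" using N(4)[OF _ lt] y by auto
  qed
qed

text \<open>Near \<open>y0\<close> there are finitely many steps with fixed values, and only their
  endpoints and \<open>r\<close> move. So the step functions of \<open>y\<close> and
  \<open>y0\<close> agree exactly at every \<open>t\<close> that is farther from the breakpoints of
  \<open>y0\<close> than these can move.\<close>

lemma step_continuous_at_W:
  assumes e: "e \<in> X" and y0: "y0 \<in> topspace Y" "y0 \<notin> X"
  shows "step_continuous_at e y0"
proof -
  obtain N0 k s where N0: "openin Y N0" "y0 \<in> N0" "N0 \<subseteq> topspace Y - X" "\<And>n. s n \<in> X"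
    "\<And>y n. y \<in> N0 \<Longrightarrow> n \<ge> k \<Longrightarrow> u n y = 1"
    "\<And>y n. y \<in> N0 \<Longrightarrow> u n y < u (Suc n) y \<Longrightarrow> n < k \<and> x (c n y) = s n"
    by (rule locally_finite_values[OF y0]) (rule that)
  define F where "F = insert e (s ` {..<k})"
  have val: "\<xi> e y t = (if t < r y then e else s (idx y t))" "idx y t < k"
    if y: "y \<in> N0" and t: "t \<in> {0..<1}" for y t
  proof -
    have yY: "y \<in> topspace Y" "y \<notin> X" using y N0(3) by auto
    have "u (idx y t) y < u (Suc (idx y t)) y" using idx_less[OF in_W[OF yY]] t by simp
    then show "idx y t < k" "\<xi> e y t = (if t < r y then e else s (idx y t))"
      using N0(6)[OF y] yY by (auto simp: \<xi>_def)
  qed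
  have inF: "\<xi> e y t \<in> F" if "y \<in> N0" "t \<in> {0..<1}" for y t
    using val[OF that] by (auto simp: F_def)
  show ?thesis
    unfolding step_continuous_at_def step_nbhd_def
  proof (rule exI[of _ F], intro conjI allI impI)
    show "finite F" by (simp add: F_def)
    show "F \<subseteq> X" using e N0(4) by (auto simp: F_def)
    show "\<xi> e y0 ` {0..<1} \<subseteq> F" using inF[OF N0(2)] by blast
    fix V and \<delta> :: real assume V: "\<forall>s\<in>F. openin Y (V s) \<and> s \<in> V s" and \<delta>: "\<delta> > 0"
    \<comment> \<open>The set \<open>C\<close> below has at most \<open>k + 2\<close> points, namely
      \<open>r y0\<close> and \<open>u 0 y0\<close> to \<open>u k y0\<close>. Their intervals of
      length \<open>2 * \<eta>\<close> have total length less than \<open>\<delta>\<close>.\<close>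
    define \<eta> where "\<eta> = \<delta> / (2 * (real k + 3))"
    have \<eta>: "\<eta> > 0" using \<delta> by (simp add: \<eta>_def)
    obtain N1 where N1: "openin Y N1" "y0 \<in> N1" "N1 \<subseteq> topspace Y - X"
      "\<And>y n. y \<in> N1 \<Longrightarrow> n \<le> k \<Longrightarrow> \<bar>u n y - u n y0\<bar> < \<eta>"
      by (rule uniform_breakpoints[OF y0 \<eta>, where k = k]) (rule that)
    obtain N2 where N2: "openin Y N2" "y0 \<in> N2" "\<And>y. y \<in> N2 \<Longrightarrow> \<bar>r y - r y0\<bar> < \<eta>"
      using continuous_map_real_at[OF r_cont y0(1) \<eta>] by blast
    define C where "C = insert (r y0) ((\<lambda>n. u n y0) ` {..k})"
    define B where "B = {0..<1} \<inter> (\<Union>v\<in>C. {v - \<eta>..v + \<eta>})"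
    have Bs: "B \<in> sets unit_lborel"
      unfolding B_def C_def by (intro sets_unit_lborel sets.Int sets.finite_UN) auto
    have Bm: "measure unit_lborel B < \<delta>"
    proof -
      have fin: "(\<Union>v\<in>C. {v - \<eta>..v + \<eta>}) \<in> fmeasurable lborel"
        by (intro fmeasurable.finite_UN fmeasurableI)
          (auto simp: C_def emeasure_lborel_Icc_eq)
      have "measure unit_lborel B = measure lborel B" by (rule measure_unit_lborel) (auto simp: B_def)
      also have "\<dots> \<le> measure lborel (\<Union>v\<in>C. {v - \<eta>..v + \<eta>})"
        by (rule measure_mono_fmeasurable[OF _ _ fin]) (use sets_restrict_space Bs in \<open>auto simp: B_def C_def\<close>)
      also have "\<dots> \<le> (\<Sum>v\<in>C. measure lborel {v - \<eta>..v + \<eta>})"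
        by (rule measure_UNION_le) (auto simp: C_def)
      also have "\<dots> = real (card C) * (2 * \<eta>)" using \<eta> by simp
      also have "\<dots> \<le> (real k + 2) * (2 * \<eta>)"
      proof (rule mult_right_mono)
        have "card C \<le> Suc (card ((\<lambda>n. u n y0) ` {..k}))" unfolding C_def by (rule card_insert_le_m1) simp_all
        also have "\<dots> \<le> Suc (card {..k})" using card_image_le[of "{..k}" "\<lambda>n. u n y0"] by simp
        finally show "real (card C) \<le> real k + 2" by simp
      qed (use \<eta> in simp)
      also have "\<dots> < \<delta>" using \<delta> by (simp add: \<eta>_def field_simps)
      finally show ?thesis .
    qed
    show "\<exists>N. openin Y N \<and> y0 \<in> N \<and> (\<forall>y\<in>N. (\<forall>t\<in>{0..<1}. \<exists>s\<in>F. \<xi> e y t \<in> V s) \<and>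
        (\<exists>B\<in>sets unit_lborel. measure unit_lborel B < \<delta> \<and>
          (\<forall>t\<in>{0..<1} - B. \<xi> e y t \<in> V (\<xi> e y0 t))))"
    proof (intro exI[of _ "N0 \<inter> N1 \<inter> N2"] conjI ballI bexI[of _ B] Bs Bm)
      show "openin Y (N0 \<inter> N1 \<inter> N2)" using N0 N1 N2 by auto
      show "y0 \<in> N0 \<inter> N1 \<inter> N2" using N0 N1 N2 by auto
      fix y assume y: "y \<in> N0 \<inter> N1 \<inter> N2"
      show "\<exists>s\<in>F. \<xi> e y t \<in> V s" if "t \<in> {0..<1}" for t
        using V inF[of y t] y that by blast
      fix t assume t: "t \<in> {0..<1} - B"
      have far: "\<eta> < \<bar>t - v\<bar>" if "v \<in> C" for v
      proof -
        have "t \<notin> {v - \<eta>..v + \<eta>}" using t that unfolding B_def by blast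
        then show ?thesis by (auto simp: abs_if)
      qed
      have near: "\<bar>u n y - u n y0\<bar> < \<eta>" if "n \<le> k" for n using N1(4) y that by blast
      have t01: "0 \<le> t" "t < 1" using t by auto
      define n where "n = idx y0 t"
      have n: "u n y0 \<le> t" "t < u (Suc n) y0" "n < k"
        using idx_props[OF in_W[OF y0] t01] val(2)[OF N0(2)] t01 by (auto simp: n_def)
      have "u n y \<le> t" "t < u (Suc n) y"
        using near[of n] near[of "Suc n"] far[of "u n y0"] far[of "u (Suc n) y0"] n
        unfolding C_def by auto
      moreover have "y \<in> topspace Y" "y \<notin> X" using y N0(3) by auto
      ultimately have "idx y t = n" by (intro idx_eqI in_W)
      moreover have "t < r y \<longleftrightarrow> t < r y0"
        using far[of "r y0"] N2(3)[of y] y unfolding C_def by auto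
      ultimately have "\<xi> e y t = \<xi> e y0 t"
        using val(1)[of y t] val(1)[OF N0(2), of t] y t by (simp add: n_def)
      then show "\<xi> e y t \<in> V (\<xi> e y0 t)" using V inF[OF N0(2)] t by auto
    qed
  qed
qed

lemma step_continuous: "e \<in> X \<Longrightarrow> y \<in> topspace Y \<Longrightarrow> step_continuous_at e y"
  using step_continuous_at_X step_continuous_at_W by (cases "y \<in> X") auto

text \<open>As \<open>p\<close> may be unbounded, convergence in measure of the step functions would
  not suffice. Off a set of small measure the two values are close to those at the limit point; on
  that set they are still near points of the finite sets \<open>F\<close> and \<open>F'\<close>, so
  \<open>p\<close> remains bounded.\<close>

lemma continuous_integral:
  assumes p: "continuous_fun (subtopology Y X) p" and e: "e \<in> X"
  shows "continuous_map (prod_topology Y Y) euclideanreal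
    (\<lambda>(y, y'). LINT t|unit_lborel. p (\<xi> e y t, \<xi> e y' t))"
  unfolding continuous_map_real_iff
proof (intro ballI allI impI)
  fix w and \<epsilon> :: real assume w: "w \<in> topspace (prod_topology Y Y)" and \<epsilon>: "\<epsilon> > 0"
  obtain y0 y0' where w': "w = (y0, y0')" "y0 \<in> topspace Y" "y0' \<in> topspace Y" using w by auto
  obtain F where F: "finite F" "F \<subseteq> X" "\<xi> e y0 ` {0..<1} \<subseteq> F"
    "\<forall>V. (\<forall>s\<in>F. openin Y (V s) \<and> s \<in> V s) \<longrightarrow> (\<forall>\<delta>>0. \<exists>N. step_nbhd e y0 F V \<delta> N)"
    using step_continuous[OF e w'(2), unfolded step_continuous_at_def] by (elim exE conjE) (rule that)
  obtain F' where F': "finite F'" "F' \<subseteq> X" "\<xi> e y0' ` {0..<1} \<subseteq> F'"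
    "\<forall>V. (\<forall>s\<in>F'. openin Y (V s) \<and> s \<in> V s) \<longrightarrow> (\<forall>\<delta>>0. \<exists>N. step_nbhd e y0' F' V \<delta> N)"
    using step_continuous[OF e w'(3), unfolded step_continuous_at_def] by (elim exE conjE) (rule that)
  \<comment> \<open>The bound by 1 serves the exceptional set, where it makes
    \<open>\<bar>p\<bar> \<le> M\<close> with \<open>M\<close> one more than the maximum over
    \<open>F \<times> F'\<close>.\<close>
  define \<epsilon>' where "\<epsilon>' = min 1 (\<epsilon> / 3)"
  have \<epsilon>': "\<epsilon>' > 0" "\<epsilon>' \<le> 1" "\<epsilon>' \<le> \<epsilon> / 3" using \<epsilon> by (auto simp: \<epsilon>'_def)
  have "\<exists>A A'. openin Y A \<and> openin Y A' \<and> fst q \<in> A \<and> snd q \<in> A' \<and>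
      (\<forall>v\<in>A \<inter> X. \<forall>v'\<in>A' \<inter> X. \<bar>p (v, v') - p q\<bar> < \<epsilon>')" if q: "q \<in> F \<times> F'" for q
  proof -
    obtain s s' where s: "q = (s, s')" "s \<in> X" "s' \<in> X" using q F(2) F'(2) by blast
    have "(s, s') \<in> topspace (prod_topology (subtopology Y X) (subtopology Y X))"
      using s by (simp add: topspace_prod_topology del: topspace_subtopology)
    from continuous_map_real_at[OF p[unfolded continuous_fun_def] this \<epsilon>'(1)]
    obtain N where N: "openin (prod_topology (subtopology Y X) (subtopology Y X)) N" "(s, s') \<in> N"
      "\<And>v. v \<in> N \<Longrightarrow> \<bar>p v - p (s, s')\<bar> < \<epsilon>'" by blast
    obtain A A' where A: "openin (subtopology Y X) A" "openin (subtopology Y X) A'"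
      "s \<in> A" "s' \<in> A'" "A \<times> A' \<subseteq> N"
      using N(1)[unfolded openin_prod_topology_alt, rule_format, OF N(2)] by blast
    obtain A1 A1' where A1: "openin Y A1" "A = A1 \<inter> X" "openin Y A1'" "A' = A1' \<inter> X"
      using A(1,2) unfolding openin_subtopology by blast
    have "\<bar>p (v, v') - p q\<bar> < \<epsilon>'" if "v \<in> A1 \<inter> X" "v' \<in> A1' \<inter> X" for v v'
      using N(3)[of "(v, v')"] A(5) A1 that s(1) by auto
    then show ?thesis using A A1 s by (intro exI[of _ A1] exI[of _ A1']) auto
  qed
  then have "\<forall>q\<in>F \<times> F'. \<exists>A A'. openin Y A \<and> openin Y A' \<and> fst q \<in> A \<and> snd q \<in> A' \<and>
      (\<forall>v\<in>A \<inter> X. \<forall>v'\<in>A' \<inter> X. \<bar>p (v, v') - p q\<bar> < \<epsilon>')" by blast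
  from bchoice[OF this] obtain A where "\<forall>q\<in>F \<times> F'. \<exists>A'. openin Y (A q) \<and> openin Y A' \<and> fst q \<in> A q \<and>
      snd q \<in> A' \<and> (\<forall>v\<in>A q \<inter> X. \<forall>v'\<in>A' \<inter> X. \<bar>p (v, v') - p q\<bar> < \<epsilon>')" by (elim exE) (rule that)
  from bchoice[OF this] obtain A' where AA': "\<forall>q\<in>F \<times> F'. openin Y (A q) \<and> openin Y (A' q) \<and>
      fst q \<in> A q \<and> snd q \<in> A' q \<and> (\<forall>v\<in>A q \<inter> X. \<forall>v'\<in>A' q \<inter> X. \<bar>p (v, v') - p q\<bar> < \<epsilon>')"
    by (elim exE) (rule that)
  have A: "openin Y (A (s, s'))" "openin Y (A' (s, s'))" "s \<in> A (s, s')" "s' \<in> A' (s, s')"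
    "\<And>v v'. v \<in> A (s, s') \<Longrightarrow> v' \<in> A' (s, s') \<Longrightarrow> v \<in> X \<Longrightarrow> v' \<in> X \<Longrightarrow>
      \<bar>p (v, v') - p (s, s')\<bar> < \<epsilon>'" if "s \<in> F" "s' \<in> F'" for s s'
    using AA'[THEN bspec, of "(s, s')"] that by auto
  have "\<xi> e y0 0 \<in> F" "\<xi> e y0' 0 \<in> F'" using F(3) F'(3) by auto
  then have ne: "F \<noteq> {}" "F' \<noteq> {}" by blast+
  \<comment> \<open>The neighbourhoods found so far depend on pairs, whereas
    \<open>step_nbhd\<close> treats the two arguments separately; finite intersections remove the
    dependence on the partner.\<close>
  define V where "V s = (\<Inter>s'\<in>F'. A (s, s'))" for s
  define V' where "V' s' = (\<Inter>s\<in>F. A' (s, s'))" for s'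
  have V: "\<forall>s\<in>F. openin Y (V s) \<and> s \<in> V s"
  proof (intro ballI conjI)
    fix s assume s: "s \<in> F"
    show "openin Y (V s)" unfolding V_def
      by (rule openin_INT2[OF F'(1) ne(2)]) (rule A(1)[OF s])
    show "s \<in> V s" unfolding V_def using A(3)[OF s] by blast
  qed
  have V': "\<forall>s\<in>F'. openin Y (V' s) \<and> s \<in> V' s"
  proof (intro ballI conjI)
    fix s assume s: "s \<in> F'"
    show "openin Y (V' s)" unfolding V'_def
      by (rule openin_INT2[OF F(1) ne(1)]) (rule A(2)[OF _ s])
    show "s \<in> V' s" unfolding V'_def using A(4)[OF _ s] by blast
  qed
  have close: "\<bar>p (v, v') - p (s, s')\<bar> < \<epsilon>'"
    if "s \<in> F" "s' \<in> F'" "v \<in> V s" "v' \<in> V' s'" "v \<in> X" "v' \<in> X" for s s' v v'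
    using that by (intro A(5)) (auto simp: V_def V'_def)
  define M where "M = Max ((\<lambda>q. \<bar>p q\<bar>) ` (F \<times> F')) + 1"
  have M: "\<bar>p q\<bar> \<le> M - 1" if "q \<in> F \<times> F'" for q
    unfolding M_def using that F(1) F'(1) by simp
  obtain q0 where "q0 \<in> F \<times> F'" using ne by auto
  then have M1: "M > 0" using M[of q0] by linarith
  \<comment> \<open>On two exceptional sets of measure below \<open>\<delta>\<close> the integrand
    changes by at most \<open>2 * M\<close>, a total of at most \<open>\<epsilon> / 2\<close>;
    together with \<open>\<epsilon>' \<le> \<epsilon> / 3\<close> this stays below
    \<open>\<epsilon>\<close>.\<close>
  define \<delta> where "\<delta> = \<epsilon> / (8 * M)"
  have \<delta>: "\<delta> > 0" using M1 \<epsilon> by (simp add: \<delta>_def)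
  obtain N where sN: "step_nbhd e y0 F V \<delta> N" 
    using F(4)[THEN spec, THEN mp, OF V] \<delta> by blast
  then have N: "openin Y N" "y0 \<in> N" by (simp_all add: step_nbhd_def)
  obtain N' where sN': "step_nbhd e y0' F' V' \<delta> N'" 
    using F'(4)[THEN spec, THEN mp, OF V'] \<delta> by blast
  then have N': "openin Y N'" "y0' \<in> N'" by (simp_all add: step_nbhd_def)
  define I where "I y y' = (LINT t|unit_lborel. p (\<xi> e y t, \<xi> e y' t))" for y y'
  have "\<bar>I y y' - I y0 y0'\<bar> < \<epsilon>" if y: "y \<in> N" "y' \<in> N'" for y y'
  proof -
    have yY: "y \<in> topspace Y" "y' \<in> topspace Y"
      using y openin_subset[OF N(1)] openin_subset[OF N'(1)] by auto
    obtain B where B: "B \<in> sets unit_lborel" "measure unit_lborel B < \<delta>"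
      "\<forall>t\<in>{0..<1} - B. \<xi> e y t \<in> V (\<xi> e y0 t)" using sN y unfolding step_nbhd_def by blast
    obtain B' where B': "B' \<in> sets unit_lborel" "measure unit_lborel B' < \<delta>"
      "\<forall>t\<in>{0..<1} - B'. \<xi> e y' t \<in> V' (\<xi> e y0' t)" using sN' y unfolding step_nbhd_def by blast
    define h where "h t = p (\<xi> e y t, \<xi> e y' t) - p (\<xi> e y0 t, \<xi> e y0' t)" for t
    define g where "g t = \<epsilon>' + 2 * M * indicator (B \<union> B') t" for t :: real
    have s1: "simple_function unit_lborel (\<lambda>t. p (\<xi> e y t, \<xi> e y' t))"
      "simple_function unit_lborel (\<lambda>t. p (\<xi> e y0 t, \<xi> e y0' t))"
      using simple_\<xi> yY w' by (auto intro!: simple_function_comp2)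
    then have hs: "simple_function unit_lborel h" unfolding h_def[abs_def] by (rule simple_function_diff)
    have hg: "\<bar>h t\<bar> \<le> g t" if t: "t \<in> {0..<1}" for t
    proof -
      have X: "\<xi> e y t \<in> X" "\<xi> e y' t \<in> X" using \<xi>_in yY e t by auto
      have F0: "\<xi> e y0 t \<in> F" "\<xi> e y0' t \<in> F'" using F(3) F'(3) t by auto
      show ?thesis
      proof (cases "t \<in> B \<union> B'")
        case False
        then have "\<xi> e y t \<in> V (\<xi> e y0 t)" "\<xi> e y' t \<in> V' (\<xi> e y0' t)" using B(3) B'(3) t by auto
        from close[OF F0 this X] show ?thesis using False by (simp add: h_def g_def)
      next
        case True
        obtain s s' where s: "s \<in> F" "\<xi> e y t \<in> V s" "s' \<in> F'" "\<xi> e y' t \<in> V' s'"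
          using sN sN' y t unfolding step_nbhd_def by blast
        have "\<bar>p (\<xi> e y t, \<xi> e y' t)\<bar> \<le> M"
          using close[OF s(1,3,2,4) X] M[of "(s, s')"] s \<epsilon>' by auto
        moreover have "\<bar>p (\<xi> e y0 t, \<xi> e y0' t)\<bar> \<le> M" using M[of "(\<xi> e y0 t, \<xi> e y0' t)"] F0 by auto
        ultimately show ?thesis using True \<epsilon>' by (simp add: h_def g_def)
      qed
    qed
    have ig: "integrable unit_lborel g" unfolding g_def[abs_def]
      by (intro Bochner_Integration.integrable_add integrable_mult_right integrable_indicator_unit)
        (use B B' in auto)
    have "I y y' - I y0 y0' = (LINT t|unit_lborel. h t)"
      unfolding I_def h_def
      by (rule Bochner_Integration.integral_diff[symmetric]) (intro integrable_step s1)+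
    then have "\<bar>I y y' - I y0 y0'\<bar> \<le> (LINT t|unit_lborel. \<bar>h t\<bar>)"
      using integral_abs_bound[of unit_lborel h] by simp
    also have "\<dots> \<le> (LINT t|unit_lborel. g t)"
      by (rule integral_mono[OF integrable_abs[OF integrable_step[OF hs]] ig]) (use hg in simp)
    also have "\<dots> = \<epsilon>' + 2 * M * measure unit_lborel (B \<union> B')"
    proof -
      have "B \<union> B' \<in> sets unit_lborel" using B(1) B'(1) by (rule sets.Un)
      then have i: "integrable unit_lborel (indicator (B \<union> B') :: real \<Rightarrow> real)"
        by (rule integrable_indicator_unit)
      have "(LINT t|unit_lborel. g t) = (LINT t|unit_lborel. \<epsilon>') +
          (LINT t|unit_lborel. 2 * M * indicator (B \<union> B') t)"
        unfolding g_def by (intro Bochner_Integration.integral_add integrable_mult_right i) simp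
      then show ?thesis using \<open>B \<union> B' \<in> sets unit_lborel\<close> sets.sets_into_space[of "B \<union> B'" unit_lborel]
        by (simp add: Int_absorb2)
    qed
    also have "\<dots> \<le> \<epsilon>' + 2 * M * (\<delta> + \<delta>)"
    proof -
      have "measure unit_lborel (B \<union> B') \<le> measure unit_lborel B + measure unit_lborel B'"
        by (rule measure_Un_le[OF B(1) B'(1)])
      then show ?thesis using B(2) B'(2) M1 by simp
    qed
    also have "\<dots> = \<epsilon>' + \<epsilon> / 2" using M1 by (simp add: \<delta>_def field_simps)
    also have "\<dots> < \<epsilon>" using \<epsilon>'(3) \<epsilon> by simp
    finally show ?thesis .
  qed
  then show "\<exists>N. openin (prod_topology Y Y) N \<and> w \<in> N \<and> (\<forall>y\<in>N.
      \<bar>(case y of (y, y') \<Rightarrow> LINT t|unit_lborel. p (\<xi> e y t, \<xi> e y' t)) -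
       (case w of (y, y') \<Rightarrow> LINT t|unit_lborel. p (\<xi> e y t, \<xi> e y' t))\<bar> < \<epsilon>)"
    using N N' w'
    by (intro exI[of _ "N \<times> N'"]) (auto simp: openin_prod_Times_iff I_def)
qed

lemma T_decompose:
  assumes y: "y \<in> topspace Y" "y' \<in> topspace Y"
  shows "T p (y, y') = (LINT t|unit_lborel. p (\<xi> a y t, \<xi> a y' t)) / 2 +
    (LINT t|unit_lborel. p (\<xi> b y t, \<xi> b y' t)) / 2 + min (r y) (r y') * (D (y, y') * K p)"
proof -
  have s: "simple_function unit_lborel (\<lambda>t. p (\<xi> e y t, \<xi> e y' t))" for e
    by (rule simple_function_comp2[OF simple_\<xi>[OF y(1)] simple_\<xi>[OF y(2)]])
  have i: "integrable unit_lborel (\<lambda>t. p (\<xi> e y t, \<xi> e y' t) / 2)" for e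
    using integrable_step[OF s] by simp
  have "0 \<le> min (r y) (r y')" "min (r y) (r y') \<le> 1" using r_bounds[OF y(1)] r_bounds[OF y(2)] by auto
  then have m: "(LINT t|unit_lborel. (if t < min (r y) (r y') then D (y, y') * K p else 0)) =
      min (r y) (r y') * (D (y, y') * K p)"
    by (simp only: integral_interval)
  have "(LINT t|unit_lborel. Q p y y' t) =
      (LINT t|unit_lborel. p (\<xi> a y t, \<xi> a y' t) / 2 + p (\<xi> b y t, \<xi> b y' t) / 2) +
      (LINT t|unit_lborel. (if t < min (r y) (r y') then D (y, y') * K p else 0))"
    unfolding Q_def
    by (intro Bochner_Integration.integral_add Bochner_Integration.integrable_add i
        integrable_step simple_function_interval)
  also have "(LINT t|unit_lborel. p (\<xi> a y t, \<xi> a y' t) / 2 + p (\<xi> b y t, \<xi> b y' t) / 2) =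
      (LINT t|unit_lborel. p (\<xi> a y t, \<xi> a y' t) / 2) + (LINT t|unit_lborel. p (\<xi> b y t, \<xi> b y' t) / 2)"
    by (intro Bochner_Integration.integral_add i)
  finally show ?thesis unfolding m T_eq[OF y] by simp
qed

lemma preserves_continuous: "preserves continuous_fun (subtopology Y X) Y T"
  unfolding preserves_def
proof (intro ballI impI)
  fix p assume p: "continuous_fun (subtopology Y X) p"
  let ?I = "\<lambda>e (y, y'). LINT t|unit_lborel. p (\<xi> e y t, \<xi> e y' t)"
  have "continuous_map (prod_topology Y Y) euclideanreal
     (\<lambda>w. ?I a w / 2 + ?I b w / 2 + min (r (fst w)) (r (snd w)) * (D w * K p))"
    using continuous_map_compose[OF continuous_map_fst r_cont, of Y]
      continuous_map_compose[OF continuous_map_snd r_cont, of Y] D_cont[unfolded continuous_fun_def]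
    by (intro continuous_map_add continuous_map_real_divide continuous_map_real_mult
        continuous_integral p ab continuous_map_real_min) (simp_all add: o_def)
  then show "continuous_fun Y (T p)"
    unfolding continuous_fun_def
    by (rule continuous_map_eq) (auto simp: T_decompose)
qed

end

section \<open>Continuity of the operator\<close>

lemma openin_uniform_conv_on_topology':
  assumes "\<forall>K\<in>\<K>. \<forall>L\<in>\<K>. K \<union> L \<in> \<K>"
  shows "openin (uniform_conv_on_topology S \<K>) W \<longleftrightarrow>
    W \<subseteq> rfun S \<and> (\<forall>f\<in>W. \<exists>K\<in>\<K>. \<exists>e>0. conv_nbhd S K e f \<subseteq> W)"
  by (rule openin_uniform_conv_on_topology) (use assms in blast)

lemma topspace_uniform_conv_on_topology:
  fixes S :: "'b set"
  assumes "\<forall>K\<in>\<K>. \<forall>L\<in>\<K>. K \<union> L \<in> \<K>" "\<K> \<noteq> {}"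
  shows "topspace (uniform_conv_on_topology S \<K>) = rfun S"
proof -
  obtain K where K: "K \<in> \<K>" using assms(2) by blast
  have sub: "conv_nbhd S K 1 f \<subseteq> rfun S" for f :: "'b \<Rightarrow> real" by (auto simp: conv_nbhd_def)
  have "openin (uniform_conv_on_topology S \<K>) (rfun S)"
    unfolding openin_uniform_conv_on_topology'[OF assms(1)]
  proof (intro conjI ballI)
    show "\<exists>K\<in>\<K>. \<exists>e>0. conv_nbhd S K e f \<subseteq> rfun S" for f :: "'b \<Rightarrow> real"
      by (rule bexI[OF _ K], rule exI[of _ 1]) (use sub in simp)
  qed simp
  moreover have "topspace (uniform_conv_on_topology S \<K>) \<subseteq> rfun S"
    using openin_topspace[of "uniform_conv_on_topology S \<K>"]
    unfolding openin_uniform_conv_on_topology'[OF assms(1)] by (rule conjunct1)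
  ultimately show ?thesis using openin_subset by (intro subset_antisym)
qed

text \<open>Serves the uniform and the compact-open topology at once. The estimate
  \<open>bound\<close> is non-strict while \<open>conv_nbhd\<close> is strict, so the proof passes
  to half the radius.\<close>

lemma continuous_map_uniform_conv_on:
  assumes dK: "\<forall>K\<in>\<K>. \<forall>L\<in>\<K>. K \<union> L \<in> \<K>" "\<K> \<noteq> {}"
    and dL: "\<forall>K\<in>\<L>. \<forall>L\<in>\<L>. K \<union> L \<in> \<L>" "\<L> \<noteq> {}"
    and T: "\<And>p. p \<in> rfun A \<Longrightarrow> T p \<in> rfun B"
    and bound: "\<And>L. L \<in> \<L> \<Longrightarrow> \<exists>K\<in>\<K>. \<forall>p\<in>rfun A. \<forall>q\<in>rfun A. \<forall>e.
      (\<forall>s\<in>K. \<bar>p s - q s\<bar> \<le> e) \<longrightarrow> (\<forall>s\<in>L. \<bar>T p s - T q s\<bar> \<le> e)"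
  shows "continuous_map (uniform_conv_on_topology A \<K>) (uniform_conv_on_topology B \<L>) T"
  unfolding continuous_map_def topspace_uniform_conv_on_topology[OF dK]
    topspace_uniform_conv_on_topology[OF dL]
proof (intro conjI allI impI)
  show "T \<in> rfun A \<rightarrow> rfun B" using T by (rule Pi_I)
  fix W assume "openin (uniform_conv_on_topology B \<L>) W"
  then have W: "W \<subseteq> rfun B" "\<forall>f\<in>W. \<exists>L\<in>\<L>. \<exists>e>0. conv_nbhd B L e f \<subseteq> W"
    unfolding openin_uniform_conv_on_topology'[OF dL(1)] by blast+
  show "openin (uniform_conv_on_topology A \<K>) {p \<in> rfun A. T p \<in> W}"
    unfolding openin_uniform_conv_on_topology'[OF dK(1)]
  proof (intro conjI ballI)
    fix p assume p: "p \<in> {p \<in> rfun A. T p \<in> W}"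
    then obtain L e where L: "L \<in> \<L>" "e > 0" "conv_nbhd B L e (T p) \<subseteq> W" using W(2) by blast
    obtain K where K: "K \<in> \<K>" "\<forall>p\<in>rfun A. \<forall>q\<in>rfun A. \<forall>e.
      (\<forall>s\<in>K. \<bar>p s - q s\<bar> \<le> e) \<longrightarrow> (\<forall>s\<in>L. \<bar>T p s - T q s\<bar> \<le> e)"
      using bound[OF L(1)] by (elim bexE) (rule that)
    have "conv_nbhd A K (e / 2) p \<subseteq> {p \<in> rfun A. T p \<in> W}"
    proof
      fix q assume q: "q \<in> conv_nbhd A K (e / 2) p"
      then have qA: "q \<in> rfun A" and le: "\<forall>s\<in>K. \<bar>q s - p s\<bar> \<le> e / 2"
        by (auto simp: conv_nbhd_def less_imp_le)
      have pA: "p \<in> rfun A" using p by simp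
      have "\<forall>s\<in>L. \<bar>T q s - T p s\<bar> \<le> e / 2"
        by (rule K(2)[THEN bspec, OF qA, THEN bspec, OF pA, THEN spec, THEN mp, OF le])
      then have "T q \<in> conv_nbhd B L e (T p)"
        using T[OF qA] L(2) by (fastforce simp: conv_nbhd_def)
      then show "q \<in> {p \<in> rfun A. T p \<in> W}" using L(3) qA by blast
    qed
    moreover have "e / 2 > 0" using L(2) by simp
    ultimately show "\<exists>K\<in>\<K>. \<exists>e>0. conv_nbhd A K e p \<subseteq> {p \<in> rfun A. T p \<in> W}"
      using K(1) by blast
  qed auto
qed

context extension_data
begin

lemma continuous_uniform:
  "continuous_map (uniform_conv_topology (X \<times> X)) (uniform_conv_topology (sq Y)) T"
  unfolding uniform_conv_topology_def
proof (rule continuous_map_uniform_conv_on)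
  fix L assume L: "L \<in> {sq Y}"
  show "\<exists>K\<in>{X \<times> X}. \<forall>p\<in>rfun (X \<times> X). \<forall>q\<in>rfun (X \<times> X). \<forall>e.
      (\<forall>s\<in>K. \<bar>p s - q s\<bar> \<le> e) \<longrightarrow> (\<forall>s\<in>L. \<bar>T p s - T q s\<bar> \<le> e)"
  proof (intro bexI[of _ "X \<times> X"] ballI allI impI)
    fix p q :: "'a \<times> 'a \<Rightarrow> real" and e s
    assume pq: "\<forall>s\<in>X \<times> X. \<bar>p s - q s\<bar> \<le> e" and "s \<in> L"
    then obtain y y' where y: "s = (y, y')" "y \<in> topspace Y" "y' \<in> topspace Y" using L by auto
    show "\<bar>T p s - T q s\<bar> \<le> e"
      unfolding y(1)
    proof (rule T_diff_le[OF y(2,3)])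
      fix s assume "s \<in> supp y \<times> supp y'"
      then show "\<bar>p s - q s\<bar> \<le> e" using pq supp_X[OF y(2)] supp_X[OF y(3)] by blast
    qed
  qed simp
qed (use T_funcset in auto)

text \<open>To \<open>X \<inter> C\<close> and the base points all attached points of nonempty steps
  over \<open>C\<close> are adjoined. Finitely many members of an open cover contain the first part;
  by \<open>x_near\<close> they also contain the attached points used near
  \<open>X \<inter> C\<close>. Every other point of \<open>C\<close> has a neighbourhood over which
  only finitely many attached points occur, and compactness of \<open>C\<close> leaves finitely many
  exceptions in all.\<close>

lemma supp_hull_compact:
  assumes C: "compactin Y C"
  shows "\<exists>L. compactin (subtopology Y X) L \<and> (\<forall>y\<in>C. supp y \<subseteq> L)"
proof -
  have KY: "C \<subseteq> topspace Y" using C by (simp add: compactin_def)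
  define L0 where "L0 = {a, b} \<union> (X \<inter> C)"
  define L where "L = L0 \<union> {x (c n y) |y n. y \<in> C - X \<and> u n y < u (Suc n) y}"
  have "compactin Y (X \<inter> C)" using closed_Int_compactin[OF closed_X C] .
  moreover have "compactin Y {a, b}" using ab X_sub by (intro finite_imp_compactin) auto
  ultimately have "compactin Y L0" unfolding L0_def by (rule compactin_Un[rotated])
  moreover have L0X: "L0 \<subseteq> X" unfolding L0_def using ab by blast
  ultimately have L0: "compactin (subtopology Y X) L0" by (simp add: compactin_subtopology)
  have LX: "L \<subseteq> X" unfolding L_def using L0X c_in(3) KY by blast
  have "compactin (subtopology Y X) L"
    unfolding compactin_def
  proof (intro conjI allI impI)
    show "L \<subseteq> topspace (subtopology Y X)" unfolding topspace_X by (rule LX)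
    fix \<U> assume \<U>: "Ball \<U> (openin (subtopology Y X)) \<and> L \<subseteq> \<Union>\<U>"
    then have "L0 \<subseteq> \<Union>\<U>" unfolding L_def by blast
    then obtain \<F>0 where F0: "finite \<F>0" "\<F>0 \<subseteq> \<U>" "L0 \<subseteq> \<Union>\<F>0"
      using L0 \<U> unfolding compactin_def by blast
    have U0: "openin (subtopology Y X) (\<Union>\<F>0)"
      by (rule openin_Union) (use \<U> F0(2) in blast)
    obtain V where V: "openin Y V" "\<Union>\<F>0 = V \<inter> X"
      using U0[unfolded openin_subtopology] by (elim exE conjE) (rule that)
    define good where "good N F \<longleftrightarrow> openin Y N \<and> finite F \<and>
        (\<forall>y\<in>N - X. \<forall>n. u n y < u (Suc n) y \<longrightarrow> x (c n y) \<in> V \<union> F)" for N F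
    have "\<exists>N F. good N F \<and> y \<in> N" if y: "y \<in> C" for y
    proof (cases "y \<in> X")
      case True
      then have "y \<in> V" using V(2) F0(3) y unfolding L0_def by blast
      then obtain N where N: "openin Y N" "y \<in> N" "\<forall>j\<in>J. U j \<inter> N \<noteq> {} \<longrightarrow> x j \<in> V"
        using x_near[OF True V(1)] by blast
      have "x (c n z) \<in> V" if z: "z \<in> N - X" "u n z < u (Suc n) z" for n z
      proof -
        have "z \<in> topspace Y" using z openin_subset[OF N(1)] by blast
        then have "c n z \<in> J" "z \<in> U (c n z)" using c_in(1,2)[of z n] z by blast+
        then show ?thesis using N(3) z by blast
      qed
      then show ?thesis using N unfolding good_def by (intro exI[of _ N] exI[of _ "{}"]) simp
    next
      case False
      have yY: "y \<in> topspace Y" using y KY by blast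
      obtain N k s where N: "openin Y N" "y \<in> N" "N \<subseteq> topspace Y - X" "\<And>n. s n \<in> X"
        "\<And>y n. y \<in> N \<Longrightarrow> n \<ge> k \<Longrightarrow> u n y = 1"
        "\<And>y n. y \<in> N \<Longrightarrow> u n y < u (Suc n) y \<Longrightarrow> n < k \<and> x (c n y) = s n"
        by (rule locally_finite_values[OF yY False]) (rule that)
      have "good N (s ` {..<k})" unfolding good_def using N(1,6) by auto
      then show ?thesis using N(2) by blast
    qed
    then have "C \<subseteq> \<Union>{N. \<exists>F. good N F}" by blast
    moreover have "\<forall>N\<in>{N. \<exists>F. good N F}. openin Y N" unfolding good_def by blast
    ultimately obtain \<N> where \<N>: "finite \<N>" "\<N> \<subseteq> {N. \<exists>F. good N F}" "C \<subseteq> \<Union>\<N>"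
      using C unfolding compactin_def by meson
    have "\<forall>N\<in>\<N>. \<exists>F. good N F" using \<N>(2) by blast
    from bchoice[OF this] obtain F where F: "\<forall>N\<in>\<N>. good N (F N)" by blast
    define E where "E = (\<Union>N\<in>\<N>. F N) \<inter> L"
    have "finite E" unfolding E_def using \<N>(1) F unfolding good_def by auto
    have "\<forall>v\<in>E. \<exists>W. W \<in> \<U> \<and> v \<in> W" using \<U> unfolding E_def by blast
    from bchoice[OF this] obtain W where W: "\<forall>v\<in>E. W v \<in> \<U> \<and> v \<in> W v" by blast
    show "\<exists>\<F>. finite \<F> \<and> \<F> \<subseteq> \<U> \<and> L \<subseteq> \<Union>\<F>"
    proof (intro exI[of _ "\<F>0 \<union> W ` E"] conjI)
      show "finite (\<F>0 \<union> W ` E)" using F0(1) \<open>finite E\<close> by simp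
      show "\<F>0 \<union> W ` E \<subseteq> \<U>" using F0(2) W by blast
      show "L \<subseteq> \<Union>(\<F>0 \<union> W ` E)"
      proof
        fix v assume v: "v \<in> L"
        show "v \<in> \<Union>(\<F>0 \<union> W ` E)"
        proof (cases "v \<in> L0")
          case True
          then show ?thesis using F0(3) by blast
        next
          case False
          then obtain y n where y: "v = x (c n y)" "y \<in> C - X" "u n y < u (Suc n) y"
            using v unfolding L_def by blast
          then obtain N where N: "N \<in> \<N>" "y \<in> N" using \<N>(3) by blast
          then have "good N (F N)" using F by blast
          then have "v \<in> V \<union> F N" using y N(2) unfolding good_def by blast
          then show ?thesis
          proof
            assume "v \<in> V"
            then have "v \<in> \<Union>\<F>0" using V(2) v LX by blast
            then show ?thesis by blast
          next
            assume "v \<in> F N"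
            then have "v \<in> E" unfolding E_def using v N(1) by blast
            then show ?thesis using W by blast
          qed
        qed
      qed
    qed
  qed
  moreover have "supp y \<subseteq> L" if y: "y \<in> C" for y
  proof -
    have "\<xi> e y t \<in> L" if "e \<in> {a, b}" "t \<in> {0..<1}" for e t
    proof (cases "y \<in> X \<or> t < r y")
      case True
      then show ?thesis using that y by (auto simp: \<xi>_def L_def L0_def)
    next
      case False
      then have "u (idx y t) y < u (Suc (idx y t)) y"
        using idx_less[OF in_W, of y t] y KY that by auto
      then show ?thesis using False y by (auto simp: \<xi>_def L_def)
    qed
    moreover have "a \<in> L" "b \<in> L" by (simp_all add: L_def L0_def)
    ultimately show ?thesis unfolding supp_def by blast
  qed
  ultimately show ?thesis by blast
qed

lemma continuous_compact:
  "continuous_map (compact_conv_topology (prod_topology (subtopology Y X) (subtopology Y X)))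
    (compact_conv_topology (prod_topology Y Y)) T"
proof -
  show ?thesis
    unfolding compact_conv_topology_def topspace_prod_topology topspace_X
  proof (rule continuous_map_uniform_conv_on)
    fix L assume "L \<in> {K. compactin (prod_topology Y Y) K}"
    then have L: "compactin (prod_topology Y Y) L" by simp
    obtain K1 where K1: "compactin (subtopology Y X) K1" "\<forall>y\<in>fst ` L. supp y \<subseteq> K1"
      using supp_hull_compact[OF image_compactin[OF L continuous_map_fst]] by blast
    obtain K2 where K2: "compactin (subtopology Y X) K2" "\<forall>y\<in>snd ` L. supp y \<subseteq> K2"
      using supp_hull_compact[OF image_compactin[OF L continuous_map_snd]] by blast
    show "\<exists>K\<in>{K. compactin (prod_topology (subtopology Y X) (subtopology Y X)) K}.
        \<forall>p\<in>rfun (X \<times> X). \<forall>q\<in>rfun (X \<times> X). \<forall>e.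
        (\<forall>s\<in>K. \<bar>p s - q s\<bar> \<le> e) \<longrightarrow> (\<forall>s\<in>L. \<bar>T p s - T q s\<bar> \<le> e)"
    proof (intro bexI[of _ "K1 \<times> K2"] ballI allI impI)
      show "K1 \<times> K2 \<in> {K. compactin (prod_topology (subtopology Y X) (subtopology Y X)) K}"
        using K1(1) K2(1) by (simp add: compactin_Times)
      fix p q :: "'a \<times> 'a \<Rightarrow> real" and e s
      assume pq: "\<forall>s\<in>K1 \<times> K2. \<bar>p s - q s\<bar> \<le> e" and s: "s \<in> L"
      obtain y y' where y: "s = (y, y')" by fastforce
      have "L \<subseteq> topspace Y \<times> topspace Y" using compactin_subset_topspace[OF L] by simp
      then have yY: "y \<in> topspace Y" "y' \<in> topspace Y" using s y by auto
      have sub: "supp y \<subseteq> K1" "supp y' \<subseteq> K2" using K1(2) K2(2) s y by force+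
      show "\<bar>T p s - T q s\<bar> \<le> e"
        unfolding y
      proof (rule T_diff_le[OF yY])
        fix s assume "s \<in> supp y \<times> supp y'"
        then have "s \<in> K1 \<times> K2" using sub by blast
        then show "\<bar>p s - q s\<bar> \<le> e" by (rule bspec[OF pq])
      qed
    qed
  next
    show "{K. compactin (prod_topology (subtopology Y X) (subtopology Y X)) K} \<noteq> {}"
      "{K. compactin (prod_topology Y Y) K} \<noteq> {}" using compactin_empty by blast+
  qed (use T_funcset in \<open>auto intro: compactin_Un\<close>)
qed

lemma continuous_pointwise:
  "continuous_map (pointwise_conv_topology (X \<times> X)) (pointwise_conv_topology (sq Y)) T"
  unfolding pointwise_conv_topology_def continuous_map_componentwise
proof (intro conjI ballI)
  let ?P = "product_topology (\<lambda>_::'a \<times> 'a. euclideanreal) (X \<times> X)"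
  show "T ` topspace ?P \<subseteq> extensional (sq Y)" using T_funcset by (auto simp: PiE_def)
  fix s assume "s \<in> sq Y"
  then obtain y y' where y: "s = (y, y')" "y \<in> topspace Y" "y' \<in> topspace Y" by auto
  have ev: "continuous_map ?P euclideanreal (\<lambda>p. p q)" if "q \<in> X \<times> X" for q
    using continuous_map_product_projection[OF that, of "\<lambda>_. euclideanreal"] by simp
  have "continuous_map ?P euclideanreal (\<lambda>p. LINT t|unit_lborel. p (\<xi> e y t, \<xi> e y' t))"
    if e: "e \<in> X" for e
    unfolding integral_step_pair_sum[OF simple_\<xi>[OF y(2)] simple_\<xi>[OF y(3)]]
  proof (rule continuous_map_sum)
    show "finite (\<xi> e y ` {0..<1} \<times> \<xi> e y' ` {0..<1})"
      using simple_functionD(1)[OF simple_\<xi>[OF y(2)], of e]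
        simple_functionD(1)[OF simple_\<xi>[OF y(3)], of e] by simp
    fix q assume "q \<in> \<xi> e y ` {0..<1} \<times> \<xi> e y' ` {0..<1}"
    then have "q \<in> X \<times> X" using \<xi>_in[OF y(2) e] \<xi>_in[OF y(3) e] by auto
    then show "continuous_map ?P euclideanreal
        (\<lambda>p. measure unit_lborel {t \<in> {0..<1}. (\<xi> e y t, \<xi> e y' t) = q} * p q)"
      by (intro continuous_map_real_mult ev) simp_all
  qed
  then show "continuous_map ?P euclideanreal (\<lambda>p. T p s)"
    unfolding y(1) T_decompose[OF y(2,3)] K_def using ab
    by (intro continuous_map_add continuous_map_real_divide continuous_map_real_mult
        continuous_map_diff ev) auto
qed

lemma tricontinuous_T:
  "tricontinuous (prod_topology (subtopology Y X) (subtopology Y X)) (prod_topology Y Y) T"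
proof -
  show ?thesis
    unfolding tricontinuous_def topspace_prod_topology topspace_X
    using continuous_uniform continuous_pointwise continuous_compact by blast
qed

theorem good_extension_operator_T:
  assumes "metrizable_space Y \<Longrightarrow> dominating_metric Y D"
    and "\<And>s V. metrizable_space Y \<Longrightarrow> s \<in> X \<Longrightarrow> openin Y V \<Longrightarrow> s \<in> V \<Longrightarrow>
      \<exists>\<delta>>0. \<exists>V'. openin Y V' \<and> s \<in> V' \<and>
        (\<forall>y\<in>topspace Y - X. \<forall>j\<in>J. r y < \<delta> \<and> y \<in> U j \<and> x j \<in> V' \<longrightarrow> y \<in> V)"
  shows "good_extension_operator (subtopology Y X) Y T"
proof -
  have "preserves dominating_metric (subtopology Y X) Y T" if "metrizable_space Y"
    by (rule preserves_dominating[OF assms(1)[OF that] assms(2)[OF that]])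
  moreover have "preserves admissible_metric (subtopology Y X) Y T"
    if "preserves dominating_metric (subtopology Y X) Y T"
    using that preserves_continuous unfolding preserves_def admissible_metric_def by blast
  ultimately show ?thesis
    unfolding good_extension_operator_def
    using extension_operator_T regular_operator_T tricontinuous_T preserves_bounded
      preserves_continuous preserves_pseudometric preserves_metric by blast
qed

end

section \<open>Covers of the complement of a closed set\<close>

text \<open>The cover is indexed by the points of the complement of \<open>X\<close>. The last
  clause is a converse of the one before: a point with small \<open>r\<close> that lies in a member
  with attached point near \<open>s\<close> is itself near \<open>s\<close>. It serves dominating
  metrics and is asked for in metrizable spaces only.\<close>

definition approach_system ::
    "'a topology \<Rightarrow> 'a set \<Rightarrow> ('a \<Rightarrow> real) \<Rightarrow> ('a \<Rightarrow> 'a set) \<Rightarrow> ('a \<Rightarrow> 'a) \<Rightarrow> bool" where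
  "approach_system Y X r U x \<longleftrightarrow>
    continuous_map Y euclideanreal r \<and>
    (\<forall>y\<in>topspace Y. 0 \<le> r y \<and> r y \<le> 1 \<and> (r y = 0 \<longleftrightarrow> y \<in> X)) \<and>
    (\<forall>w\<in>topspace Y - X. openin Y (U w) \<and> w \<in> U w \<and> U w \<subseteq> topspace Y - X \<and> x w \<in> X) \<and>
    (\<forall>s\<in>X. \<forall>V. openin Y V \<and> s \<in> V \<longrightarrow>
      (\<exists>N. openin Y N \<and> s \<in> N \<and> (\<forall>w\<in>topspace Y - X. U w \<inter> N \<noteq> {} \<longrightarrow> x w \<in> V))) \<and>
    (metrizable_space Y \<longrightarrow> (\<forall>s\<in>X. \<forall>V. openin Y V \<and> s \<in> V \<longrightarrow>
      (\<exists>\<delta>>0. \<exists>V'. openin Y V' \<and> s \<in> V' \<and>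
        (\<forall>y\<in>topspace Y - X. \<forall>w\<in>topspace Y - X. r y < \<delta> \<and> y \<in> U w \<and> x w \<in> V' \<longrightarrow> y \<in> V))))"

section \<open>Covers in stratifiable spaces\<close>

context stratification
begin

definition rank :: "'a \<Rightarrow> 'a set \<Rightarrow> nat" where
  "rank y U = (LEAST n. y \<in> G U n)"

text \<open>The neighbourhood of \<open>y\<close> in \<open>U\<close> that underlies Borges'
  extension theorem for stratifiable spaces. Removing the closure keeps it disjoint from
  \<open>G S n\<close> for every open \<open>S\<close> with \<open>y \<notin> S\<close> and every
  \<open>n \<le> rank y U\<close>.\<close>

definition core :: "'a \<Rightarrow> 'a set \<Rightarrow> 'a set" where
  "core y U = G U (rank y U) - Z closure_of (G (topspace Z - {y}) (rank y U))"

lemma mem_rank: "openin Z U \<Longrightarrow> y \<in> U \<Longrightarrow> y \<in> G U (rank y U)"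
proof -
  assume U: "openin Z U" "y \<in> U"
  then obtain n where "y \<in> G U n" using unG[OF U(1)] by blast
  then show ?thesis unfolding rank_def by (rule LeastI)
qed

context
  assumes t1: "t1_space Z"
begin

lemma openin_delete: "openin Z (topspace Z - {y})"
proof (cases "y \<in> topspace Z")
  case True
  then show ?thesis using closedin_t1_singleton[OF t1 True] by (intro openin_diff) simp_all
qed simp

lemma core_props:
  assumes "openin Z U" "y \<in> U"
  shows "openin Z (core y U)" "y \<in> core y U" "core y U \<subseteq> U"
proof -
  show "openin Z (core y U)" unfolding core_def
    by (rule openin_diff[OF openG[OF assms(1)] closedin_closure_of])
  show "y \<in> core y U"
    using mem_rank[OF assms] closG[OF openin_delete[of y], of "rank y U"] unfolding core_def by blast
  show "core y U \<subseteq> U" using unG[OF assms(1)] unfolding core_def by blast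
qed

text \<open>If \<open>y'\<close> were outside \<open>U\<close>, then \<open>G U (rank y U)\<close>
  would be contained in \<open>G (topspace Z - {y'}) (rank y' V)\<close>, whose closure is removed
  from \<open>core y' V\<close>; the cores could not meet.\<close>

lemma core_meet:
  assumes U: "openin Z U" "y \<in> U" and V: "openin Z V" "y' \<in> V"
    and meet: "core y U \<inter> core y' V \<noteq> {}" and le: "rank y U \<le> rank y' V"
  shows "y' \<in> U"
proof (rule ccontr)
  assume "y' \<notin> U"
  then have "U \<subseteq> topspace Z - {y'}" using openin_subset[OF U(1)] by blast
  then have "G U (rank y U) \<subseteq> G (topspace Z - {y'}) (rank y' V)"
    using monoG[OF U(1) openin_delete _ le] by blast
  then show False using meet subset_closure[OF openin_delete] unfolding core_def by blast
qed

text \<open>Every \<open>w\<close> outside \<open>X\<close> receives a point \<open>s\<close> of \<open>X\<close> that maximizes \<open>rank s S\<close> among the pairs with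
  \<open>w \<in> core s S\<close>; as \<open>s \<notin> W\<close>, \<open>core_meet\<close> bounds these ranks by \<open>rank w W\<close>.\<close>

lemma approach_cover:
  assumes X: "closedin Z X" and ne: "X \<noteq> {}"
  shows "\<exists>U x. (\<forall>w\<in>topspace Z - X. openin Z (U w) \<and> w \<in> U w \<and> U w \<subseteq> topspace Z - X \<and> x w \<in> X) \<and>
    (\<forall>s\<in>X. \<forall>V. openin Z V \<and> s \<in> V \<longrightarrow>
      (\<exists>N. openin Z N \<and> s \<in> N \<and> (\<forall>w\<in>topspace Z - X. U w \<inter> N \<noteq> {} \<longrightarrow> x w \<in> V)))"
proof -
  define W where "W = topspace Z - X"
  have W: "openin Z W" unfolding W_def using X by blast
  define U where "U w = core w W" for w
  define P where "P w n \<longleftrightarrow> (\<exists>s S. s \<in> X \<and> openin Z S \<and> s \<in> S \<and> w \<in> core s S \<and> rank s S = n)" for w n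
  have below: "rank s S < rank w W"
    if w: "w \<in> W" and s: "s \<in> X" "openin Z S" "s \<in> S" "core s S \<inter> core w W \<noteq> {}" for w s S
  proof (rule ccontr)
    assume "\<not> rank s S < rank w W"
    then have "s \<in> W" using core_meet[OF W w s(2,3)] s(4) by (simp add: Int_commute)
    then show False using s(1) by (simp add: W_def)
  qed
  have "\<exists>s. s \<in> X \<and> (\<forall>n. P w n \<longrightarrow>
      (\<exists>S. openin Z S \<and> s \<in> S \<and> w \<in> core s S \<and> n \<le> rank s S))" if w: "w \<in> W" for w
  proof (cases "\<exists>n. P w n")
    case False
    then show ?thesis using ne by blast
  next
    case True
    have bd: "\<forall>n. P w n \<longrightarrow> n \<le> rank w W"
    proof (intro allI impI)
      fix n assume "P w n"
      then obtain s S where s: "s \<in> X" "openin Z S" "s \<in> S" "w \<in> core s S" "rank s S = n"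
        unfolding P_def by blast
      have "core s S \<inter> core w W \<noteq> {}" using s(4) core_props(2)[OF W w] by blast
      then show "n \<le> rank w W" using below[OF w s(1-3)] s(5) by simp
    qed
    define m where "m = (GREATEST n. P w n)"
    obtain n where "P w n" using True by blast
    then have "P w m" unfolding m_def using bd by (intro GreatestI_nat[of "P w" n "rank w W"]) auto
    then obtain s S where s: "s \<in> X" "openin Z S" "s \<in> S" "w \<in> core s S" "rank s S = m"
      unfolding P_def by blast
    have "n \<le> m" if "P w n" for n
      unfolding m_def using bd that by (intro Greatest_le_nat[of "P w" n "rank w W"]) auto
    then show ?thesis using s by blast
  qed
  then have "\<forall>w\<in>W. \<exists>s. s \<in> X \<and> (\<forall>n. P w n \<longrightarrow>
      (\<exists>S. openin Z S \<and> s \<in> S \<and> w \<in> core s S \<and> n \<le> rank s S))" by blast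
  from bchoice[OF this] obtain x where x: "\<forall>w\<in>W. x w \<in> X \<and> (\<forall>n. P w n \<longrightarrow>
      (\<exists>S. openin Z S \<and> x w \<in> S \<and> w \<in> core (x w) S \<and> n \<le> rank (x w) S))"
    by (elim exE) (rule that)
  show ?thesis
  proof (rule exI[of _ U], rule exI[of _ x], intro conjI ballI allI impI)
    fix w assume "w \<in> topspace Z - X"
    then have w: "w \<in> W" by (simp add: W_def)
    show "openin Z (U w)" "w \<in> U w" "U w \<subseteq> topspace Z - X"
      using core_props[OF W w] unfolding U_def W_def by auto
    show "x w \<in> X" using x w by blast
  next
    fix s V assume s: "s \<in> X" and "openin Z V \<and> s \<in> V"
    then have V: "openin Z V" "s \<in> V" by auto
    \<comment> \<open>The core is taken twice. Meeting the inner one forces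
      \<open>w \<in> core s V\<close>, so \<open>s\<close> and \<open>V\<close> compete for the
      choice of \<open>x w\<close>; the winner has at least their rank, and \<open>core_meet\<close>
      then places \<open>x w\<close> in \<open>V\<close>.\<close>
    note V1 = core_props[OF V]
    note V2 = core_props[OF V1(1,2)]
    have "x w \<in> V" if w: "w \<in> W" and meet: "U w \<inter> core s (core s V) \<noteq> {}" for w
    proof -
      have meet': "core s (core s V) \<inter> core w W \<noteq> {}" using meet unfolding U_def by blast
      have "w \<in> core s V"
        by (rule core_meet[OF V1(1,2) W w meet' less_imp_le[OF below[OF w s V1(1,2) meet']]])
      then have "P w (rank s V)" using s V unfolding P_def by blast
      then obtain S where S: "openin Z S" "x w \<in> S" "w \<in> core (x w) S" "rank s V \<le> rank (x w) S"
        using x w by blast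
      show "x w \<in> V"
        by (rule core_meet[OF V S(1,2) _ S(4)]) (use S(3) \<open>w \<in> core s V\<close> in blast)
    qed
    then show "\<exists>N. openin Z N \<and> s \<in> N \<and> (\<forall>w\<in>topspace Z - X. U w \<inter> N \<noteq> {} \<longrightarrow> x w \<in> V)"
      using V2(1,2) unfolding W_def[symmetric] by blast
  qed
qed

lemma approach_system_nonmetrizable:
  assumes X: "closedin Z X" and ne: "X \<noteq> {}" and nm: "\<not> metrizable_space Z"
  shows "\<exists>r U x. approach_system Z X r U x"
proof -
  obtain U x where Ux: "(\<forall>w\<in>topspace Z - X. openin Z (U w) \<and> w \<in> U w \<and> U w \<subseteq> topspace Z - X \<and> x w \<in> X) \<and>
    (\<forall>s\<in>X. \<forall>V. openin Z V \<and> s \<in> V \<longrightarrow>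
      (\<exists>N. openin Z N \<and> s \<in> N \<and> (\<forall>w\<in>topspace Z - X. U w \<inter> N \<noteq> {} \<longrightarrow> x w \<in> V)))"
    using approach_cover[OF X ne] by (elim exE) (rule that)
  have W: "openin Z (topspace Z - X)" using X by blast
  show ?thesis
  proof (rule cozero[OF W])
    fix r :: "'a \<Rightarrow> real"
    assume r: "continuous_map Z euclideanreal r" "\<And>z. z \<in> topspace Z \<Longrightarrow> 0 \<le> r z \<and> r z \<le> 1"
      "\<And>z. z \<in> topspace Z \<Longrightarrow> 0 < r z \<longleftrightarrow> z \<in> topspace Z - X"
    have "\<forall>y\<in>topspace Z. 0 \<le> r y \<and> r y \<le> 1 \<and> (r y = 0 \<longleftrightarrow> y \<in> X)"
    proof
      fix y assume y: "y \<in> topspace Z"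
      then show "0 \<le> r y \<and> r y \<le> 1 \<and> (r y = 0 \<longleftrightarrow> y \<in> X)"
        using r(2)[OF y] r(3)[OF y] by auto
    qed
    then have "approach_system Z X r U x"
      unfolding approach_system_def using r(1) Ux nm by simp
    then show "\<exists>r U x. approach_system Z X r U x" by blast
  qed
qed

end

end

section \<open>Covers in metric spaces\<close>

context Metric_space
begin

definition dist_to :: "'a set \<Rightarrow> 'a \<Rightarrow> real" where
  "dist_to X y = (INF s\<in>X. d y s)"

context
  fixes X assumes X: "closedin mtopology X" "X \<noteq> {}"
begin

lemma X_subset: "X \<subseteq> M"
  using closedin_subset[OF X(1)] by simp

lemma bdd: "bdd_below ((\<lambda>s. d y s) ` X)"
  by (rule bdd_belowI[of _ 0]) auto

lemma dist_to_le: "s \<in> X \<Longrightarrow> dist_to X y \<le> d y s"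
  unfolding dist_to_def by (rule cINF_lower[OF bdd])

lemma dist_to_nonneg: "0 \<le> dist_to X y"
  unfolding dist_to_def by (rule cINF_greatest[OF X(2)]) simp

lemma dist_to_less: "dist_to X y < e \<Longrightarrow> \<exists>s\<in>X. d y s < e"
  unfolding dist_to_def using cINF_less_iff[OF X(2) bdd] by blast

lemma dist_to_lipschitz:
  assumes "y \<in> M" "z \<in> M"
  shows "dist_to X y \<le> d y z + dist_to X z"
proof -
  have "dist_to X y - d y z \<le> dist_to X z"
    unfolding dist_to_def[of X z]
  proof (rule cINF_greatest[OF X(2)])
    fix s assume s: "s \<in> X"
    then have "d y s \<le> d y z + d z s" using X_subset assms by (intro triangle) auto
    then show "dist_to X y - d y z \<le> d z s" using dist_to_le[OF s, of y] by linarith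
  qed
  then show ?thesis by linarith
qed

lemma dist_to_0:
  assumes y: "y \<in> M"
  shows "dist_to X y = 0 \<longleftrightarrow> y \<in> X"
proof
  assume "y \<in> X"
  then show "dist_to X y = 0" using dist_to_le[of y y] dist_to_nonneg[of y] y by simp
next
  assume 0: "dist_to X y = 0"
  show "y \<in> X"
  proof (rule ccontr)
    assume "y \<notin> X"
    then have "y \<in> M - X" using y by simp
    then obtain e where e: "e > 0" "mball y e \<subseteq> M - X"
      using X(1) unfolding closedin_def openin_mtopology by auto
    obtain s where s: "s \<in> X" "d y s < e" using dist_to_less[of y e] 0 e(1) by auto
    then have "s \<in> mball y e" using y X_subset by auto
    then show False using e(2) s(1) by blast
  qed
qed

lemma dist_to_continuous: "continuous_map mtopology euclideanreal (dist_to X)"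
  unfolding continuous_map_real_iff topspace_mtopology
proof (intro ballI allI impI)
  fix y and e :: real assume y: "y \<in> M" and e: "e > 0"
  show "\<exists>N. openin mtopology N \<and> y \<in> N \<and> (\<forall>z\<in>N. \<bar>dist_to X z - dist_to X y\<bar> < e)"
  proof (intro exI[of _ "mball y e"] conjI ballI)
    fix z assume "z \<in> mball y e"
    then have z: "z \<in> M" "d y z < e" by auto
    then show "\<bar>dist_to X z - dist_to X y\<bar> < e"
      using dist_to_lipschitz[OF y z(1)] dist_to_lipschitz[OF z(1) y] commute[of y z] by auto
  qed (use y e in auto)
qed

text \<open>Dugundji's cover: balls whose radius is a quarter of the distance to \<open>X\<close>,
  with a point of \<open>X\<close> at less than twice that distance. Both limit clauses follow from
  \<open>near\<close>, which compares \<open>d y (x w)\<close> with the distance of \<open>y\<close>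
  itself to \<open>X\<close>.\<close>

theorem approach_system_metric:
  "\<exists>U x. approach_system mtopology X (\<lambda>y. min 1 (dist_to X y)) U x"
proof -
  have pos: "0 < dist_to X w" if "w \<in> M - X" for w
    using dist_to_0[of w] dist_to_nonneg[of w] that by force
  have "\<forall>w\<in>M - X. \<exists>s. s \<in> X \<and> d w s < 2 * dist_to X w"
  proof
    fix w assume "w \<in> M - X"
    then have "dist_to X w < 2 * dist_to X w" using pos by simp
    from dist_to_less[OF this] show "\<exists>s. s \<in> X \<and> d w s < 2 * dist_to X w" by blast
  qed
  from bchoice[OF this] obtain x where x: "\<forall>w\<in>M - X. x w \<in> X \<and> d w (x w) < 2 * dist_to X w" by blast
  define U where "U w = mball w (dist_to X w / 4)" for w
  \<comment> \<open>With \<open>q = dist_to X w\<close>, the distance of \<open>y\<close> to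
    \<open>X\<close> is at least \<open>3/4 * q\<close>, and \<open>d y (x w)\<close> is less than
    \<open>1/4 * q + 2 * q\<close>, which is three times \<open>3/4 * q\<close>.\<close>
  have near: "y \<in> M \<and> x w \<in> M \<and> d y (x w) \<le> 3 * dist_to X y" if w: "w \<in> M - X" and y: "y \<in> U w" for w y
  proof -
    have yw: "y \<in> M" "w \<in> M" "d w y < dist_to X w / 4" using y w by (auto simp: U_def)
    have xw: "x w \<in> M" "d w (x w) < 2 * dist_to X w" using x w X_subset by auto
    have "dist_to X w \<le> d w y + dist_to X y" by (rule dist_to_lipschitz[OF yw(2,1)])
    moreover have "d y (x w) \<le> d w y + d w (x w)"
      using triangle[OF yw(1,2) xw(1)] commute[of y w] by simp
    ultimately show ?thesis using yw xw by auto
  qed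
  have "approach_system mtopology X (\<lambda>y. min 1 (dist_to X y)) U x"
    unfolding approach_system_def topspace_mtopology
  proof (intro conjI ballI allI impI)
    show "continuous_map mtopology euclideanreal (\<lambda>y. min 1 (dist_to X y))"
      by (intro continuous_map_real_min dist_to_continuous) simp
    fix y assume y: "y \<in> M"
    show "0 \<le> min 1 (dist_to X y)" "min 1 (dist_to X y) \<le> 1" using dist_to_nonneg[of y] by auto
    show "min 1 (dist_to X y) = 0 \<longleftrightarrow> y \<in> X" using dist_to_0[OF y] by (auto simp: min_def)
  next
    fix w assume w: "w \<in> M - X"
    show "openin mtopology (U w)" "w \<in> U w" using pos[OF w] w by (auto simp: U_def)
    show "x w \<in> X" using x w by blast
    show "U w \<subseteq> M - X"
    proof
      fix y assume y: "y \<in> U w"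
      have "y \<notin> X"
      proof
        assume "y \<in> X"
        then have "dist_to X w \<le> d w y" by (rule dist_to_le)
        then show False using y pos[OF w] by (simp add: U_def)
      qed
      then show "y \<in> M - X" using y by (auto simp: U_def)
    qed
  next
    fix s V assume s: "s \<in> X" and V: "openin mtopology V \<and> s \<in> V"
    then have sM: "s \<in> M" using X_subset by blast
    obtain e where e: "e > 0" "mball s e \<subseteq> V" using V unfolding openin_mtopology by blast
    show "\<exists>N. openin mtopology N \<and> s \<in> N \<and> (\<forall>w\<in>M - X. U w \<inter> N \<noteq> {} \<longrightarrow> x w \<in> V)"
    \<comment> \<open>For \<open>y\<close> in this ball,
      \<open>dist_to X y \<le> d s y < e / 4\<close>, so \<open>d s (x w)\<close> is less than
      \<open>e / 4 + 3 * (e / 4) = e\<close>.\<close>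
    proof (rule exI[of _ "mball s (e / 4)"], intro conjI ballI impI)
      fix w assume w: "w \<in> M - X" and "U w \<inter> mball s (e / 4) \<noteq> {}"
      then obtain y where y: "y \<in> U w" "y \<in> M" "d s y < e / 4" by auto
      have n: "x w \<in> M" "d y (x w) \<le> 3 * dist_to X y" using near[OF w y(1)] by auto
      have "dist_to X y \<le> d s y" using dist_to_le[OF s, of y] commute[of s y] by simp
      then have "d s (x w) < e" using triangle[OF sM y(2) n(1)] n(2) y(3) by linarith
      then show "x w \<in> V" using e(2) sM n(1) by auto
    qed (use sM e in auto)
    show "\<exists>\<delta>>0. \<exists>V'. openin mtopology V' \<and> s \<in> V' \<and> (\<forall>y\<in>M - X. \<forall>w\<in>M - X.
        min 1 (dist_to X y) < \<delta> \<and> y \<in> U w \<and> x w \<in> V' \<longrightarrow> y \<in> V)"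
    \<comment> \<open>The minimum with 1 undoes the truncation in
      \<open>min 1 (dist_to X y)\<close>; then
      \<open>d s y < e / 2 + 3 * (e / 8) < e\<close>.\<close>
    proof (rule exI[of _ "min 1 (e / 8)"], rule conjI, simp add: e,
        rule exI[of _ "mball s (e / 2)"], intro conjI ballI impI)
      fix y w assume y: "y \<in> M - X" and w: "w \<in> M - X"
        and *: "min 1 (dist_to X y) < min 1 (e / 8) \<and> y \<in> U w \<and> x w \<in> mball s (e / 2)"
      then have n: "x w \<in> M" "d y (x w) \<le> 3 * dist_to X y" using near[OF w] by auto
      have "dist_to X y < e / 8" using * by (auto simp: min_def split: if_splits)
      moreover have "d s (x w) < e / 2" using * by simp
      moreover have "d s y \<le> d s (x w) + d y (x w)"
        using triangle[OF sM n(1), of y] y commute[of y "x w"] by simp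
      ultimately have "d s y < e" using n(2) e(1) by linarith
      then show "y \<in> V" using e(2) sM y by auto
    qed (use sM e in auto)
  qed
  then show ?thesis by blast
qed

end

end

text \<open>The last clause of \<open>approach_system\<close> is verified with a metric; the cores
  of the stratification are used only where that clause is vacuous.\<close>

lemma (in stratification) approach_system_exists:
  assumes "t1_space Z" "closedin Z X" "X \<noteq> {}"
  shows "\<exists>r U x. approach_system Z X r U x"
proof (cases "metrizable_space Z")
  case False
  then show ?thesis by (rule approach_system_nonmetrizable[OF assms])
next
  case True
  then obtain M d where "Metric_space M d" and Z: "Z = Metric_space.mtopology M d"
    unfolding metrizable_space_def by blast
  interpret M: Metric_space M d by fact
  have "\<exists>U x. approach_system M.mtopology X (\<lambda>y. min 1 (M.dist_to X y)) U x"
    by (rule M.approach_system_metric) (use assms Z in auto)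
  then show ?thesis unfolding Z by blast
qed

section \<open>Continuous metrics\<close>

text \<open>By the triangle inequality, \<open>\<bar>p (z, z') - p (y, y')\<bar> \<le> p (y, z) + p
  (y', z')\<close>, so smallness near the diagonal suffices.\<close>

lemma continuous_funI_pseudometric:
  assumes p: "pseudometric Y p"
    and small: "\<And>y e. y \<in> topspace Y \<Longrightarrow> e > 0 \<Longrightarrow> \<exists>N. openin Y N \<and> y \<in> N \<and> (\<forall>z\<in>N. p (y, z) < e)"
  shows "continuous_fun Y p"
  unfolding continuous_fun_def continuous_map_real_iff
proof (intro ballI allI impI)
  fix w and e :: real assume w: "w \<in> topspace (prod_topology Y Y)" and e: "e > 0"
  obtain y y' where y: "w = (y, y')" "y \<in> topspace Y" "y' \<in> topspace Y" using w by auto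
  have e2: "e / 2 > 0" using e by simp
  obtain N where N: "openin Y N" "y \<in> N" "\<forall>z\<in>N. p (y, z) < e / 2" using small[OF y(2) e2] by blast
  obtain N' where N': "openin Y N'" "y' \<in> N'" "\<forall>z\<in>N'. p (y', z) < e / 2"
    using small[OF y(3) e2] by blast
  have "\<bar>p (z, z') - p (y, y')\<bar> < e" if z: "z \<in> N" "z' \<in> N'" for z z'
  proof -
    have zY: "z \<in> topspace Y" "z' \<in> topspace Y"
      using z openin_subset[OF N(1)] openin_subset[OF N'(1)] by auto
    have tri: "\<And>u v w. u \<in> topspace Y \<Longrightarrow> v \<in> topspace Y \<Longrightarrow> w \<in> topspace Y \<Longrightarrow>
        p (u, w) \<le> p (u, v) + p (v, w)"
      and sym: "\<And>u v. u \<in> topspace Y \<Longrightarrow> v \<in> topspace Y \<Longrightarrow> p (u, v) = p (v, u)"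
      using p unfolding pseudometric_def by blast+
    have "p (z, z') \<le> p (z, y) + (p (y, y') + p (y', z'))"
      using tri[OF zY(1) y(2) zY(2)] tri[OF y(2,3) zY(2)] by linarith
    moreover have "p (y, y') \<le> p (y, z) + (p (z, z') + p (z', y'))"
      using tri[OF y(2) zY(1) y(3)] tri[OF zY y(3)] by linarith
    ultimately show ?thesis
      using N(3)[rule_format, OF z(1)] N'(3)[rule_format, OF z(2)] sym[OF y(2) zY(1)] sym[OF y(3) zY(2)]
      by (simp add: abs_less_iff)
  qed
  then show "\<exists>N. openin (prod_topology Y Y) N \<and> w \<in> N \<and> (\<forall>v\<in>N. \<bar>p v - p w\<bar> < e)"
    using N(1,2) N'(1,2) y(1)
    by (intro exI[of _ "N \<times> N'"]) (auto simp: openin_prod_Times_iff)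
qed

text \<open>Domination is asked for in metrizable spaces only: a continuous dominating metric
  generates the topology, so none exists elsewhere. The bound by 1 enters the triangle inequality
  for \<open>T p\<close>.\<close>

definition admissible_weight :: "'a topology \<Rightarrow> ('a \<times> 'a \<Rightarrow> real) \<Rightarrow> bool" where
  "admissible_weight Y D \<longleftrightarrow> metric_fun Y D \<and> continuous_fun Y D \<and>
    (\<forall>y\<in>topspace Y. \<forall>z\<in>topspace Y. D (y, z) \<le> 1) \<and>
    (metrizable_space Y \<longrightarrow> dominating_metric Y D)"

lemma series_metric:
  fixes d :: "nat \<Rightarrow> 'a \<times> 'a \<Rightarrow> real"
  assumes d: "\<And>k. pseudometric Y (d k)" "\<And>k. continuous_fun Y (d k)"
    and le: "\<forall>k. \<forall>y\<in>topspace Y. \<forall>z\<in>topspace Y. d k (y, z) \<le> 1"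
    and sep: "\<forall>y\<in>topspace Y. \<forall>z\<in>topspace Y. y \<noteq> z \<longrightarrow> (\<exists>k. 0 < d k (y, z))"
  defines "D \<equiv> \<lambda>w. \<Sum>k. (1/2)^Suc k * d k w"
  shows "metric_fun Y D" "continuous_fun Y D"
    "y \<in> topspace Y \<Longrightarrow> z \<in> topspace Y \<Longrightarrow> D (y, z) \<le> 1"
    "y \<in> topspace Y \<Longrightarrow> z \<in> topspace Y \<Longrightarrow> (1/2)^Suc k * d k (y, z) \<le> D (y, z)"
    "y \<in> topspace Y \<Longrightarrow> z \<in> topspace Y \<Longrightarrow>
      D (y, z) \<le> (\<Sum>i<n. (1/2)^Suc i * d i (y, z)) + (1/2)^n"
proof -
  let ?Z = "prod_topology Y Y"
  have nn: "0 \<le> d k (y, z)" if "y \<in> topspace Y" "z \<in> topspace Y" for k y z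
    using d(1)[of k] that unfolding pseudometric_def by blast
  have c: "\<And>k. continuous_map ?Z euclideanreal (d k)" using d(2) unfolding continuous_fun_def .
  have b: "\<forall>k. \<forall>w\<in>topspace ?Z. 0 \<le> d k w \<and> d k w \<le> 1"
    using nn le by auto
  note S = continuous_map_suminf[OF c b]
  show "continuous_fun Y D" unfolding continuous_fun_def D_def by (rule S(1))
  have in_Z: "(y, z) \<in> topspace ?Z" if "y \<in> topspace Y" "z \<in> topspace Y" for y z using that by simp
  show "D (y, z) \<le> 1" if "y \<in> topspace Y" "z \<in> topspace Y"
    unfolding D_def by (rule S(6)[OF in_Z[OF that]])
  show low: "(1/2)^Suc k * d k (y, z) \<le> D (y, z)" if "y \<in> topspace Y" "z \<in> topspace Y" for k y z
    unfolding D_def by (rule S(4)[OF in_Z[OF that]])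
  show "D (y, z) \<le> (\<Sum>i<n. (1/2)^Suc i * d i (y, z)) + (1/2)^n"
    if "y \<in> topspace Y" "z \<in> topspace Y"
    unfolding D_def by (rule S(3)[OF in_Z[OF that]])
  show "metric_fun Y D"
    unfolding metric_fun_iff pseudometric_def
  proof (intro conjI ballI impI)
    fix y z assume y: "y \<in> topspace Y" and z: "z \<in> topspace Y"
    have "d k (y, y) = 0" for k using d(1)[of k] y unfolding pseudometric_def by blast
    then show "D (y, y) = 0" by (simp add: D_def)
    show "0 \<le> D (y, z)" unfolding D_def by (rule S(5)[OF in_Z[OF y z]])
    have "d k (y, z) = d k (z, y)" for k using d(1)[of k] y z unfolding pseudometric_def by blast
    then show "D (y, z) = D (z, y)" by (simp add: D_def)
    show "y = z" if "D (y, z) = 0"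
    proof (rule ccontr)
      assume "y \<noteq> z"
      then obtain k where "0 < d k (y, z)" using sep y z by blast
      then have "0 < (1/2)^Suc k * d k (y, z)" by simp
      then show False using low[OF y z, of k] that by linarith
    qed
    fix w assume w: "w \<in> topspace Y"
    have "D (y, w) \<le> (\<Sum>k. (1/2)^Suc k * d k (y, z) + (1/2)^Suc k * d k (z, w))"
      unfolding D_def
    proof (rule suminf_le[OF _ S(2)[OF in_Z[OF y w]] summable_add[OF S(2)[OF in_Z[OF y z]] S(2)[OF in_Z[OF z w]]]])
      fix k
      have "d k (y, w) \<le> d k (y, z) + d k (z, w)"
        using d(1)[of k] y z w unfolding pseudometric_def by blast
      then have "(1/2)^Suc k * d k (y, w) \<le> (1/2)^Suc k * (d k (y, z) + d k (z, w))"
        by (rule mult_left_mono) simp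
      then show "(1/2)^Suc k * d k (y, w) \<le> (1/2)^Suc k * d k (y, z) + (1/2)^Suc k * d k (z, w)"
        by (simp only: distrib_left)
    qed
    also have "\<dots> = D (y, z) + D (z, w)"
      unfolding D_def by (rule suminf_add[symmetric, OF S(2)[OF in_Z[OF y z]] S(2)[OF in_Z[OF z w]]])
    finally show "D (y, w) \<le> D (y, z) + D (z, w)" .
  qed
qed

section \<open>Continuous metrics from partitions of unity\<close>

context labelled_partition
begin

text \<open>The metric of a hedgehog whose spines are the labels.\<close>

definition hedgehog :: "nat \<Rightarrow> 'a \<times> 'a \<Rightarrow> real" where
  "hedgehog n = (\<lambda>(y, z). (if c n y = c n z \<or> \<psi> n y = 0 \<or> \<psi> n z = 0
     then \<bar>\<psi> n y - \<psi> n z\<bar> else \<psi> n y + \<psi> n z) / 2)"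

lemma pseudometric_hedgehog: "pseudometric Z (hedgehog n)"
  unfolding pseudometric_def
proof (intro conjI ballI)
  fix y z w assume y: "y \<in> topspace Z" and z: "z \<in> topspace Z"
  show "hedgehog n (y, y) = 0" by (simp add: hedgehog_def)
  have nn: "0 \<le> \<psi> n y" "0 \<le> \<psi> n z" using bounds y z by blast+
  then show "0 \<le> hedgehog n (y, z)" by (simp add: hedgehog_def)
  show "hedgehog n (y, z) = hedgehog n (z, y)" by (auto simp: hedgehog_def abs_minus_commute)
  assume w: "w \<in> topspace Z"
  have "0 \<le> \<psi> n w" using bounds w by blast
  then have "2 * hedgehog n (y, w) \<le> 2 * hedgehog n (y, z) + 2 * hedgehog n (z, w)"
    using nn unfolding hedgehog_def by (simp add: abs_if)
  then show "hedgehog n (y, w) \<le> hedgehog n (y, z) + hedgehog n (z, w)" by simp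
qed

text \<open>Near \<open>y\<close> all points where \<open>\<psi> n\<close> is positive have the same
  label, so the distance from \<open>y\<close> is half the difference of the values of
  \<open>\<psi> n\<close>; the jump between spines is not seen.\<close>

lemma continuous_hedgehog: "continuous_fun Z (hedgehog n)"
proof (rule continuous_funI_pseudometric[OF pseudometric_hedgehog])
  fix y and e :: real assume y: "y \<in> topspace Z" and e: "e > 0"
  obtain N where N: "openin Z N" "y \<in> N" "\<forall>z\<in>N. \<bar>\<psi> n z - \<psi> n y\<bar> < e"
    using continuous_map_real_at[OF cont y e] by blast
  obtain N' j where N': "openin Z N'" "y \<in> N'" "\<forall>z\<in>N'. 0 < \<psi> n z \<longrightarrow> c n z = j"
    using locconst[OF y] by blast
  show "\<exists>N. openin Z N \<and> y \<in> N \<and> (\<forall>z\<in>N. hedgehog n (y, z) < e)"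
  proof (rule exI[of _ "N \<inter> N'"], intro conjI ballI)
    show "openin Z (N \<inter> N')" "y \<in> N \<inter> N'" using N N' by auto
    fix z assume z: "z \<in> N \<inter> N'"
    then have zZ: "z \<in> topspace Z" using openin_subset[OF N(1)] by auto
    have "0 \<le> \<psi> n y" "0 \<le> \<psi> n z" using bounds y zZ by blast+
    then have "c n y = c n z \<or> \<psi> n y = 0 \<or> \<psi> n z = 0" using N'(2,3) z by force
    moreover have "\<bar>\<psi> n z - \<psi> n y\<bar> < e" using N(3) z by blast
    ultimately show "hedgehog n (y, z) < e" by (simp add: hedgehog_def abs_minus_commute)
  qed
qed

lemma hedgehog_le: "y \<in> topspace Z \<Longrightarrow> z \<in> topspace Z \<Longrightarrow> hedgehog n (y, z) \<le> 1"
  using bounds[of y n] bounds[of z n] by (auto simp: hedgehog_def abs_if)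

text \<open>Equal labels at two points where \<open>\<psi> n\<close> is positive would put
  \<open>y\<close> and \<open>z\<close> into one member of the cover. So the points lie on different
  spines, or \<open>z\<close> is at the centre and \<open>y\<close> is not.\<close>

lemma hedgehog_pos:
  assumes "y \<in> topspace Z" "z \<in> topspace Z" "0 < \<psi> n y" "\<not> (\<exists>j\<in>J. y \<in> U j \<and> z \<in> U j)"
  shows "0 < hedgehog n (y, z)"
proof (cases "0 < \<psi> n z")
  case True
  have "c n y \<noteq> c n z"
  proof
    assume "c n y = c n z"
    then show False using label[OF assms(1,3)] label[OF assms(2) True] assms(4) by auto
  qed
  then show ?thesis using True assms(3) by (simp add: hedgehog_def)
next
  case False
  then have "\<psi> n z = 0" using bounds[OF assms(2), of n] by linarith
  then show ?thesis using assms(3) by (simp add: hedgehog_def)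
qed

end

context stratification
begin

text \<open>A sequence of covers witnessing a G-delta diagonal. If \<open>v\<close> lies in
  \<open>G S k\<close> and in \<open>C n y\<close> with \<open>k \<le> n\<close>, then
  \<open>y \<in> S\<close>, since otherwise \<open>G S k\<close> is contained in the set whose
  closure \<open>C n y\<close> omits. For disjoint neighbourhoods of \<open>w\<close> and
  \<open>z\<close>, at a level beyond the indices of both points, no \<open>y\<close> can serve
  both.\<close>

lemma separating_covers:
  assumes H: "Hausdorff_space Z"
  obtains C :: "nat \<Rightarrow> 'a \<Rightarrow> 'a set" where "\<And>n y. y \<in> topspace Z \<Longrightarrow> openin Z (C n y) \<and> y \<in> C n y"
    "\<And>w z. w \<in> topspace Z \<Longrightarrow> z \<in> topspace Z \<Longrightarrow> w \<noteq> z \<Longrightarrow>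
      \<exists>n. \<not> (\<exists>y\<in>topspace Z. w \<in> C n y \<and> z \<in> C n y)"
proof -
  have t1: "t1_space Z" using H by (rule Hausdorff_imp_t1_space)
  have del: "openin Z (topspace Z - {y})" for y using openin_delete[OF t1] .
  define C where "C n y = topspace Z - Z closure_of (G (topspace Z - {y}) n)" for n y
  show thesis
  proof (rule that[of C])
    fix n y assume y: "y \<in> topspace Z"
    show "openin Z (C n y) \<and> y \<in> C n y"
    proof
      show "openin Z (C n y)" unfolding C_def by (intro openin_diff) auto
      show "y \<in> C n y" unfolding C_def using y closG[OF del, of y n] by blast
    qed
  next
    fix w z assume wz: "w \<in> topspace Z" "z \<in> topspace Z" "w \<noteq> z"
    obtain U V where UV: "openin Z U" "openin Z V" "w \<in> U" "z \<in> V" "disjnt U V"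
      using H wz unfolding Hausdorff_space_def by blast
    obtain m where m: "w \<in> G U m" using unG[OF UV(1)] UV(3) by blast
    obtain m' where m': "z \<in> G V m'" using unG[OF UV(2)] UV(4) by blast
    have *: "y \<in> S" if S: "openin Z S" "v \<in> G S k" "k \<le> max m m'" "v \<in> C (max m m') y" for y S k v
    proof (rule ccontr)
      assume "y \<notin> S"
      then have "S \<subseteq> topspace Z - {y}" using openin_subset[OF S(1)] by blast
      then have "v \<in> G (topspace Z - {y}) (max m m')" using monoG[OF S(1) del _ S(3)] S(2) by blast
      then show False using S(4) subset_closure[OF del] unfolding C_def by blast
    qed
    have "\<not> (\<exists>y\<in>topspace Z. w \<in> C (max m m') y \<and> z \<in> C (max m m') y)"
    proof
      assume "\<exists>y\<in>topspace Z. w \<in> C (max m m') y \<and> z \<in> C (max m m') y"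
      then obtain y where "w \<in> C (max m m') y" "z \<in> C (max m m') y" by blast
      then have "y \<in> U" "y \<in> V" using *[OF UV(1) m] *[OF UV(2) m'] by auto
      then show False using UV(5) by (auto simp: disjnt_def)
    qed
    then show "\<exists>n. \<not> (\<exists>y\<in>topspace Z. w \<in> C n y \<and> z \<in> C n y)" by blast
  qed
qed

lemma separating_partitions:
  assumes H: "Hausdorff_space Z"
  obtains C :: "nat \<Rightarrow> 'a \<Rightarrow> 'a set" and \<psi> c
  where "\<And>m. labelled_partition Z (topspace Z) (C m) (\<psi> m) (c m)"
    "\<And>w z. w \<in> topspace Z \<Longrightarrow> z \<in> topspace Z \<Longrightarrow> w \<noteq> z \<Longrightarrow>
      \<exists>n. \<not> (\<exists>y\<in>topspace Z. w \<in> C n y \<and> z \<in> C n y)"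
proof (rule separating_covers[OF H])
  fix C :: "nat \<Rightarrow> 'a \<Rightarrow> 'a set"
  assume C: "\<And>n y. y \<in> topspace Z \<Longrightarrow> openin Z (C n y) \<and> y \<in> C n y"
    "\<And>w z. w \<in> topspace Z \<Longrightarrow> z \<in> topspace Z \<Longrightarrow> w \<noteq> z \<Longrightarrow>
      \<exists>n. \<not> (\<exists>y\<in>topspace Z. w \<in> C n y \<and> z \<in> C n y)"
  have "\<exists>\<psi> c. labelled_partition Z (topspace Z) (C m) \<psi> c" for m
  proof (rule labelled_partition_exists[of "topspace Z" "C m"])
    show "openin Z (C m y)" if "y \<in> topspace Z" for y using C(1)[OF that] by blast
    show "topspace Z \<subseteq> (\<Union>y\<in>topspace Z. C m y)"
    proof
      show "y \<in> (\<Union>y\<in>topspace Z. C m y)" if "y \<in> topspace Z" for y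
        using C(1)[OF that, of m] that by blast
    qed
  qed blast
  then have "\<forall>m. \<exists>\<psi> c. labelled_partition Z (topspace Z) (C m) \<psi> c" by blast
  from choice[OF this] obtain \<psi> where "\<forall>m. \<exists>c. labelled_partition Z (topspace Z) (C m) (\<psi> m) c" by blast
  from choice[OF this] obtain c where "\<forall>m. labelled_partition Z (topspace Z) (C m) (\<psi> m) (c m)" by blast
  then have P: "labelled_partition Z (topspace Z) (C m) (\<psi> m) (c m)" for m by blast
  show thesis
  proof (rule that)
    show "labelled_partition Z (topspace Z) (C m) (\<psi> m) (c m)" for m by (rule P)
  qed (rule C(2))
qed

text \<open>The hedgehog metrics of the separating partitions form a countable family. For distinct
  points some cover has no member containing both, and the hedgehog of a function that is positive
  at one of them tells them apart.\<close>

lemma weight_nonmetrizable: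
  assumes H: "Hausdorff_space Z" and nm: "\<not> metrizable_space Z"
  shows "\<exists>D. admissible_weight Z D"
proof (rule separating_partitions[OF H])
  fix C :: "nat \<Rightarrow> 'a \<Rightarrow> 'a set" and \<psi> c
  assume P: "\<And>m. labelled_partition Z (topspace Z) (C m) (\<psi> m) (c m)"
    and sep: "\<And>w z. w \<in> topspace Z \<Longrightarrow> z \<in> topspace Z \<Longrightarrow> w \<noteq> z \<Longrightarrow>
      \<exists>n. \<not> (\<exists>y\<in>topspace Z. w \<in> C n y \<and> z \<in> C n y)"
  define d where "d k = (case prod_decode k of (m, n) \<Rightarrow>
      labelled_partition.hedgehog (\<psi> m) (c m) n)" for k
  have 1: "pseudometric Z (d k)" "continuous_fun Z (d k)" for k
    unfolding d_def using labelled_partition.pseudometric_hedgehog[OF P]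
      labelled_partition.continuous_hedgehog[OF P] by (auto split: prod.split)
  have 2: "\<forall>k. \<forall>y\<in>topspace Z. \<forall>z\<in>topspace Z. d k (y, z) \<le> 1"
    unfolding d_def using labelled_partition.hedgehog_le[OF P] by (auto split: prod.split)
  have 3: "\<forall>y\<in>topspace Z. \<forall>z\<in>topspace Z. y \<noteq> z \<longrightarrow> (\<exists>k. 0 < d k (y, z))"
  proof (intro ballI impI)
    fix y z assume yz: "y \<in> topspace Z" "z \<in> topspace Z" "y \<noteq> z"
    obtain m where m: "\<not> (\<exists>x\<in>topspace Z. y \<in> C m x \<and> z \<in> C m x)" using sep[OF yz] by blast
    obtain n where n: "0 < \<psi> m n y" using labelled_partition.pos[OF P yz(1)] by blast
    have "d (prod_encode (m, n)) = labelled_partition.hedgehog (\<psi> m) (c m) n" by (simp add: d_def)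
    then show "\<exists>k. 0 < d k (y, z)" using labelled_partition.hedgehog_pos[OF P yz(1,2) n m] by metis
  qed
  note S = series_metric[of Z d, OF 1 2 3]
  show ?thesis
    unfolding admissible_weight_def
    by (rule exI[of _ "\<lambda>w. \<Sum>k. (1/2)^Suc k * d k w"]) (use S(1-3) nm in simp)
qed

end

context Metric_space
begin

lemma weight_metric: "admissible_weight mtopology (\<lambda>(y, z). min 1 (d y z))"
proof -
  let ?D = "\<lambda>(y, z). min 1 (d y z)"
  have p: "pseudometric mtopology ?D"
    unfolding pseudometric_def topspace_mtopology
  proof (intro conjI ballI)
    fix x y z assume "x \<in> M" "y \<in> M"
    then show "?D (x, x) = 0" "0 \<le> ?D (x, y)" "?D (x, y) = ?D (y, x)" by (auto simp: commute)
    assume "z \<in> M"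
    then have "d x z \<le> d x y + d y z" using \<open>x \<in> M\<close> \<open>y \<in> M\<close> by (intro triangle)
    moreover have "min 1 v \<le> min 1 s + min 1 t" if "v \<le> s + t" "0 \<le> s" "0 \<le> t" for v s t :: real
      using that by (auto simp: min_def)
    ultimately show "?D (x, z) \<le> ?D (x, y) + ?D (y, z)" by simp
  qed
  have "continuous_fun mtopology ?D"
  proof (rule continuous_funI_pseudometric[OF p])
    fix y and e :: real assume "y \<in> topspace mtopology" "e > 0"
    then show "\<exists>N. openin mtopology N \<and> y \<in> N \<and> (\<forall>z\<in>N. ?D (y, z) < e)"
      by (intro exI[of _ "mball y e"]) auto
  qed
  moreover have m: "metric_fun mtopology ?D"
    unfolding metric_fun_iff using p by (auto simp: min_def split: if_splits)
  moreover have "dominating_metric mtopology ?D"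
    unfolding dominating_metric_def
  proof (intro conjI allI impI m)
    fix z U assume U: "openin mtopology U \<and> z \<in> U"
    then obtain e where e: "e > 0" "mball z e \<subseteq> U" unfolding openin_mtopology by blast
    have z: "z \<in> M" using U openin_subset[of mtopology U] by auto
    show "\<exists>e>0. {z' \<in> topspace mtopology. ?D (z, z') < e} \<subseteq> U"
    proof (intro exI[of _ "min 1 e"] conjI subsetI)
      fix z' assume "z' \<in> {z' \<in> topspace mtopology. ?D (z, z') < min 1 e}"
      then have "z' \<in> mball z e" using z by (auto simp: min_def split: if_splits)
      then show "z' \<in> U" using e(2) by blast
    qed (use e in simp)
  qed
  ultimately show ?thesis by (simp add: admissible_weight_def)
qed

end

lemma (in stratification) weight_exists:
  assumes "Hausdorff_space Z"
  shows "\<exists>D. admissible_weight Z D"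
proof (cases "metrizable_space Z")
  case True
  then obtain M d where "Metric_space M d" and Z: "Z = Metric_space.mtopology M d"
    unfolding metrizable_space_def by blast
  then show ?thesis using Metric_space.weight_metric by blast
qed (rule weight_nonmetrizable[OF assms])

section \<open>Totally bounded weights\<close>

text \<open>One representative is chosen for each of the finitely many codes.\<close>

lemma finite_net_of_code:
  assumes "finite (code ` Z)"
    and "\<And>y z. y \<in> Z \<Longrightarrow> z \<in> Z \<Longrightarrow> code y = code z \<Longrightarrow> p (y, z) < (e::real)"
  shows "\<exists>A. finite A \<and> A \<subseteq> Z \<and> (\<forall>z\<in>Z. \<exists>a\<in>A. p (z, a) < e)"
proof (intro exI[of _ "inv_into Z code ` (code ` Z)"] conjI ballI)
  show "finite (inv_into Z code ` (code ` Z))" using assms(1) by simp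
  show "inv_into Z code ` (code ` Z) \<subseteq> Z" by (auto intro: inv_into_into)
  fix z assume z: "z \<in> Z"
  have "p (z, inv_into Z code (code z)) < e"
    using z by (intro assms(2)) (auto intro: inv_into_into simp: f_inv_into_f)
  then show "\<exists>a\<in>inv_into Z code ` (code ` Z). p (z, a) < e" using z by blast
qed

text \<open>The functions map \<open>Y\<close> injectively into the Hilbert cube, and the weight is
  the pulled-back metric; it is totally bounded because the cube is. In the metrizable case
  \<open>dom\<close> lets single coordinates detect neighbourhoods.\<close>

lemma weight_of_functions:
  fixes v :: "nat \<Rightarrow> 'a \<Rightarrow> real"
  assumes cont: "\<And>k. continuous_map Y euclideanreal (v k)"
    and bd: "\<And>k y. y \<in> topspace Y \<Longrightarrow> 0 \<le> v k y \<and> v k y \<le> 1"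
    and sep: "\<And>y z. y \<in> topspace Y \<Longrightarrow> z \<in> topspace Y \<Longrightarrow> y \<noteq> z \<Longrightarrow> \<exists>k. v k y \<noteq> v k z"
    and dom: "\<And>y V. metrizable_space Y \<Longrightarrow> openin Y V \<Longrightarrow> y \<in> V \<Longrightarrow>
      \<exists>k. \<exists>e>0. \<forall>z\<in>topspace Y. \<bar>v k y - v k z\<bar> < e \<longrightarrow> z \<in> V"
  shows "\<exists>D. admissible_weight Y D \<and> totally_bounded_pseudometric Y D"
proof -
  define d where "d k = (\<lambda>(y, z). \<bar>v k y - v k z\<bar>)" for k
  have 1: "pseudometric Y (d k)" for k by (auto simp: pseudometric_def d_def)
  have 2: "continuous_fun Y (d k)" for k
  proof (rule continuous_funI_pseudometric[OF 1])
    fix y and e :: real assume "y \<in> topspace Y" "e > 0"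
    from continuous_map_real_at[OF cont this]
    show "\<exists>N. openin Y N \<and> y \<in> N \<and> (\<forall>z\<in>N. d k (y, z) < e)"
      by (simp add: d_def abs_minus_commute)
  qed
  have 3: "\<forall>k. \<forall>y\<in>topspace Y. \<forall>z\<in>topspace Y. d k (y, z) \<le> 1"
  proof (intro allI ballI)
    fix k y z assume "y \<in> topspace Y" "z \<in> topspace Y"
    then show "d k (y, z) \<le> 1" using bd[of y k] bd[of z k] by (auto simp: d_def abs_if)
  qed
  have 4: "\<forall>y\<in>topspace Y. \<forall>z\<in>topspace Y. y \<noteq> z \<longrightarrow> (\<exists>k. 0 < d k (y, z))"
    using sep by (fastforce simp: d_def)
  define D where "D = (\<lambda>w. \<Sum>k. (1/2)^Suc k * d k w)"
  note S = series_metric[of Y d, OF 1 2 3 4, folded D_def]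
  have dominating: "dominating_metric Y D" if mz: "metrizable_space Y"
    unfolding dominating_metric_def
  proof (intro conjI allI impI)
    show "metric_fun Y D" by (rule S(1))
    fix y V assume V: "openin Y V \<and> y \<in> V"
    then have y: "y \<in> topspace Y" using openin_subset[of Y V] by auto
    obtain k e where ke: "e > 0" "\<forall>z\<in>topspace Y. \<bar>v k y - v k z\<bar> < e \<longrightarrow> z \<in> V"
      using dom[OF mz] V by blast
    show "\<exists>e>0. {z \<in> topspace Y. D (y, z) < e} \<subseteq> V"
    proof (intro exI[of _ "(1/2)^Suc k * e"] conjI subsetI)
      fix z assume "z \<in> {z \<in> topspace Y. D (y, z) < (1/2)^Suc k * e}"
      then have z: "z \<in> topspace Y" "D (y, z) < (1/2)^Suc k * e" by auto
      have "(1/2)^Suc k * d k (y, z) < (1/2)^Suc k * e"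
        using S(4)[OF y z(1), of k] z(2) unfolding D_def by linarith
      then have "d k (y, z) < e" by simp
      then show "z \<in> V" using ke(2) z(1) by (simp add: d_def)
    qed (use ke in simp)
  qed
  have "totally_bounded_pseudometric Y D"
    unfolding totally_bounded_pseudometric_def
  proof (intro conjI allI impI)
    show "pseudometric Y D" using S(1) unfolding metric_fun_iff by blast
    fix e :: real assume e: "e > 0"
    obtain n where n: "(1/2::real)^n < e/2" using real_arch_pow_inv[of "e/2" "1/2"] e by auto
    obtain m :: nat where m: "2 / e < real m" using reals_Archimedean2 by blast
    have m0: "real m > 0" using m e by (smt (verit) divide_pos_pos)
    \<comment> \<open>The first \<open>n\<close> coordinates, rounded down to multiples of
      \<open>1 / m\<close>. Equal codes bound each of these differences by
      \<open>1 / m \<le> e / 2\<close>, and the remaining coordinates contribute at most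
      \<open>(1/2)^n < e / 2\<close>.\<close>
    define code where "code y = map (\<lambda>k. nat \<lfloor>v k y * real m\<rfloor>) [0..<n]" for y
    show "\<exists>A. finite A \<and> A \<subseteq> topspace Y \<and> (\<forall>z\<in>topspace Y. \<exists>a\<in>A. D (z, a) < e)"
    proof (rule finite_net_of_code[of code])
      have "code y \<in> {xs. set xs \<subseteq> {..m} \<and> length xs = n}" if y: "y \<in> topspace Y" for y
      proof -
        have "nat \<lfloor>v k y * real m\<rfloor> \<le> m" for k
        proof -
          have "v k y * real m \<le> real m" using bd[OF y, of k] by (simp add: mult_left_le_one_le)
          then show ?thesis by linarith
        qed
        then show ?thesis by (auto simp: code_def)
      qed
      then have "code ` topspace Y \<subseteq> {xs. set xs \<subseteq> {..m} \<and> length xs = n}" by blast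
      then show "finite (code ` topspace Y)" by (rule finite_subset) (rule finite_lists_length_eq, simp)
      fix y z assume y: "y \<in> topspace Y" and z: "z \<in> topspace Y" and eq: "code y = code z"
      have close: "d k (y, z) \<le> e / 2" if k: "k < n" for k
      proof -
        have "nat \<lfloor>v k y * real m\<rfloor> = nat \<lfloor>v k z * real m\<rfloor>"
          using arg_cong[OF eq, of "\<lambda>xs. xs ! k"] k by (simp add: code_def)
        moreover have "0 \<le> v k y * real m" "0 \<le> v k z * real m" using bd[OF y, of k] bd[OF z, of k] by auto
        ultimately have "\<bar>v k y * real m - v k z * real m\<bar> \<le> 1" by linarith
        then have "\<bar>v k y - v k z\<bar> * real m \<le> 1" using m0
          by (simp add: left_diff_distrib[symmetric] abs_mult)
        then have "\<bar>v k y - v k z\<bar> \<le> 1 / real m" using m0 by (simp add: field_simps)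
        also have "\<dots> \<le> e / 2" using m m0 e by (simp add: field_simps)
        finally show ?thesis by (simp add: d_def)
      qed
      have "(\<Sum>k<n. (1/2)^Suc k * d k (y, z)) \<le> (\<Sum>k<n. (1/2)^Suc k * (e / 2))"
        using close by (intro sum_mono mult_left_mono) auto
      also have "\<dots> = (\<Sum>k<n. (1/2)^Suc k) * (e / 2)" by (rule sum_distrib_right[symmetric])
      also have "\<dots> \<le> 1 * (e / 2)"
      proof (rule mult_right_mono)
        show "(\<Sum>k<n. (1/2::real)^Suc k) \<le> 1"
          using sum_le_suminf[OF sums_summable[OF power_half_series], of "{..<n}"]
            sums_unique[OF power_half_series] by simp
      qed (use e in simp)
      finally show "D (y, z) < e" using S(5)[OF y z, of n] n unfolding D_def by linarith
    qed
  qed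
  moreover have "admissible_weight Y D"
    unfolding admissible_weight_def
  proof (intro conjI ballI impI S(1) S(2) dominating)
    fix y z assume "y \<in> topspace Y" "z \<in> topspace Y"
    then show "D (y, z) \<le> 1" unfolding D_def by (rule S(3))
  qed
  ultimately show ?thesis by blast
qed

text \<open>The coordinates are the distances, truncated at 1, to the points of a countable dense
  set.\<close>

lemma (in Metric_space) weight_separable_metric:
  assumes sep: "separable_space mtopology" and ne: "M \<noteq> {}"
  shows "\<exists>D. admissible_weight mtopology D \<and> totally_bounded_pseudometric mtopology D"
proof -
  obtain C where C: "countable C" "C \<subseteq> M" "mtopology closure_of C = M"
    using sep unfolding separable_space_def by auto
  have dense: "\<exists>s\<in>C. d s y < e" if "y \<in> M" "e > 0" for y e
  proof -
    have "y \<in> mtopology closure_of C" using C(3) that by simp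
    then have "\<exists>s\<in>C. s \<in> mball y e" using that by (simp add: metric_closure_of)
    then show ?thesis by (auto simp: commute)
  qed
  obtain y0 where "y0 \<in> M" using ne by blast
  then have Cne: "C \<noteq> {}" using dense[of y0 1] by auto
  define v where "v k y = min 1 (d (from_nat_into C k) y)" for k y
  have s: "from_nat_into C k \<in> M" for k using from_nat_into[OF Cne] C(2) by blast
  have dense': "\<exists>k. d (from_nat_into C k) y < e" if ye: "y \<in> M" "e > 0" for y e
  proof -
    obtain s where "s \<in> C" "d s y < e" using dense[OF ye] by blast
    then show ?thesis using from_nat_into_surj[OF C(1)] by metis
  qed
  show ?thesis
  proof (rule weight_of_functions[of _ v])
    show "0 \<le> v k y \<and> v k y \<le> 1" for k y by (simp add: v_def)
    show "continuous_map mtopology euclideanreal (v k)" for k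
      unfolding continuous_map_real_iff topspace_mtopology
    proof (intro ballI allI impI)
      fix y and e :: real assume y: "y \<in> M" and e: "e > 0"
      have "\<bar>v k z - v k y\<bar> < e" if z: "z \<in> mball y e" for z
      proof -
        have "z \<in> M" "d y z < e" using z by auto
        then show ?thesis
          using triangle[OF s y, of z k] triangle[OF s, of z y k] y commute[of y z]
          by (auto simp: v_def min_def)
      qed
      then show "\<exists>N. openin mtopology N \<and> y \<in> N \<and> (\<forall>z\<in>N. \<bar>v k z - v k y\<bar> < e)"
        using y e by (intro exI[of _ "mball y e"]) auto
    qed
    show "\<exists>k. v k y \<noteq> v k z" if "y \<in> topspace mtopology" "z \<in> topspace mtopology" "y \<noteq> z" for y z
    proof -
      have yz: "y \<in> M" "z \<in> M" "0 < d y z" using that by auto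
      then obtain k where k: "d (from_nat_into C k) y < min 1 (d y z / 2)"
        using dense'[OF yz(1), of "min 1 (d y z / 2)"] by auto
      have "d y z \<le> d (from_nat_into C k) y + d (from_nat_into C k) z"
        using triangle[OF yz(1) s yz(2), of k] commute[of y] by simp
      then have "v k y < v k z" using k by (auto simp: v_def min_def split: if_splits)
      then show ?thesis by (intro exI[of _ k]) simp
    qed
    fix y V assume V: "openin mtopology V" "y \<in> V"
    obtain e where e: "e > 0" "mball y e \<subseteq> V" using V unfolding openin_mtopology by blast
    have y: "y \<in> M" using V openin_subset[OF V(1)] by auto
    \<comment> \<open>The bound 1/3 keeps \<open>v k y\<close> and \<open>v k z\<close> below the
      truncation at 1, so they are true distances; then
      \<open>d y z < \<delta> + 2 * \<delta> \<le> e\<close>.\<close>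
    define \<delta> where "\<delta> = min (1/3) (e / 3)"
    have \<delta>: "\<delta> > 0" "\<delta> \<le> 1/3" "3 * \<delta> \<le> e" using e by (auto simp: \<delta>_def)
    obtain k where k: "d (from_nat_into C k) y < \<delta>" using dense'[OF y \<delta>(1)] by blast
    have "z \<in> V" if z: "z \<in> M" "\<bar>v k y - v k z\<bar> < \<delta>" for z
    proof -
      have "d (from_nat_into C k) z < 2 * \<delta>"
        using z(2) k \<delta> by (auto simp: v_def min_def split: if_splits)
      moreover have "d y z \<le> d (from_nat_into C k) y + d (from_nat_into C k) z"
        using triangle[OF y s z(1), of k] commute[of y] by simp
      ultimately have "d y z < e" using k \<delta> by linarith
      then show ?thesis using e(2) y z(1) by auto
    qed
    then show "\<exists>k. \<exists>e>0. \<forall>z\<in>topspace mtopology. \<bar>v k y - v k z\<bar> < e \<longrightarrow> z \<in> V"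
      using \<delta>(1) by (intro exI[of _ k] exI[of _ \<delta>]) simp
  qed
qed

lemma dense_meets:
  assumes "Z closure_of C = topspace Z" "openin Z N" "N \<noteq> {}"
  shows "\<exists>q\<in>C. q \<in> N"
proof -
  obtain y where y: "y \<in> N" using assms(3) by blast
  then have "y \<in> Z closure_of C" using assms(1) openin_subset[OF assms(2)] by auto
  then show ?thesis using y assms(2) unfolding in_closure_of by blast
qed

section \<open>Branches of a partition over a countable dense set\<close>

context labelled_partition
begin

text \<open>One spine of the hedgehog, named by a point \<open>q\<close> on it rather than by its
  label, so that a countable dense set can enumerate all nonempty spines.\<close>

definition branch :: "nat \<Rightarrow> 'a \<Rightarrow> 'a \<Rightarrow> real" where
  "branch n q y = (if c n y = c n q then \<psi> n y else 0)"

lemma continuous_branch: "continuous_map Z euclideanreal (branch n q)"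
proof (rule continuous_map_real_local)
  fix y assume y: "y \<in> topspace Z"
  obtain N j where N: "openin Z N" "y \<in> N" "\<forall>z\<in>N. 0 < \<psi> n z \<longrightarrow> c n z = j"
    using locconst[OF y] by blast
  have "branch n q z = (if j = c n q then \<psi> n z else 0)" if z: "z \<in> N" for z
  proof (cases "0 < \<psi> n z")
    case True
    then show ?thesis using N(3) z by (auto simp: branch_def)
  next
    case False
    have "z \<in> topspace Z" using z openin_subset[OF N(1)] by blast
    then have "\<psi> n z = 0" using False bounds[of z n] by auto
    then show ?thesis by (simp add: branch_def)
  qed
  moreover have "continuous_map Z euclideanreal (\<lambda>z. if j = c n q then \<psi> n z else 0)"
    using cont by simp
  ultimately show "\<exists>N g. openin Z N \<and> y \<in> N \<and> continuous_map Z euclideanreal g \<and>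
      (\<forall>z\<in>N. branch n q z = g z)"
    using N(1,2) by blast
qed

lemma branch_bounds: "y \<in> topspace Z \<Longrightarrow> 0 \<le> branch n q y \<and> branch n q y \<le> 1"
  using bounds[of y n] by (simp add: branch_def)

text \<open>The points where \<open>\<psi> n\<close> is positive with the label of \<open>y\<close>
  form a nonempty open set; any \<open>q\<close> of the dense set in it names the spine of
  \<open>y\<close>.\<close>

lemma branch_dense:
  assumes C: "Z closure_of C = topspace Z" and y: "y \<in> topspace Z" "0 < \<psi> n y"
  shows "\<exists>q\<in>C. 0 < branch n q y \<and> 0 < \<psi> n q \<and> q \<in> topspace Z"
proof -
  have p: "0 < branch n y y" using y by (simp add: branch_def)
  have "openin Z {z \<in> topspace Z. 0 < branch n y z}" by (rule openin_real_less[OF continuous_branch])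
  moreover have "{z \<in> topspace Z. 0 < branch n y z} \<noteq> {}" using p y by blast
  ultimately obtain q where q: "q \<in> C" "q \<in> topspace Z" "0 < branch n y q"
    using dense_meets[OF C] by blast
  then have "c n q = c n y" "0 < \<psi> n q" by (auto simp: branch_def split: if_splits)
  then show ?thesis using q y by (auto simp: branch_def)
qed

end

text \<open>A hedgehog with infinitely many spines need not be totally bounded. Its spines are
  therefore used as separate real functions, and by \<open>branch_dense\<close> those named by
  points of a countable dense set are enough.\<close>

lemma (in stratification) weight_separable_nonmetrizable:
  assumes H: "Hausdorff_space Z" and nm: "\<not> metrizable_space Z" and sep: "separable_space Z"
  shows "\<exists>D. admissible_weight Z D \<and> totally_bounded_pseudometric Z D"
proof (rule separating_partitions[OF H])
  fix C :: "nat \<Rightarrow> 'a \<Rightarrow> 'a set" and \<psi> c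
  assume P: "\<And>m. labelled_partition Z (topspace Z) (C m) (\<psi> m) (c m)"
    and sepC: "\<And>w z. w \<in> topspace Z \<Longrightarrow> z \<in> topspace Z \<Longrightarrow> w \<noteq> z \<Longrightarrow>
      \<exists>n. \<not> (\<exists>y\<in>topspace Z. w \<in> C n y \<and> z \<in> C n y)"
  obtain S where S: "countable S" "S \<subseteq> topspace Z" "Z closure_of S = topspace Z"
    using sep unfolding separable_space_def by blast
  define br where "br m = labelled_partition.branch (\<psi> m) (c m)" for m
  define v where "v k = (case prod_decode k of (m, k') \<Rightarrow> case prod_decode k' of (n, i) \<Rightarrow>
      br m n (from_nat_into S i))" for k
  show ?thesis
  proof (rule weight_of_functions[of Z v])
    show "continuous_map Z euclideanreal (v k)" for k
      unfolding v_def br_def using labelled_partition.continuous_branch[OF P]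
      by (auto split: prod.split)
    show "0 \<le> v k y \<and> v k y \<le> 1" if "y \<in> topspace Z" for k y
      unfolding v_def br_def using labelled_partition.branch_bounds[OF P that]
      by (auto split: prod.split)
    fix y z assume yz: "y \<in> topspace Z" "z \<in> topspace Z" "y \<noteq> z"
    obtain m where m: "\<not> (\<exists>x\<in>topspace Z. y \<in> C m x \<and> z \<in> C m x)" using sepC[OF yz] by blast
    obtain n where n: "0 < \<psi> m n y" using labelled_partition.pos[OF P yz(1)] by blast
    obtain q where q: "q \<in> S" "0 < br m n q y"
      using labelled_partition.branch_dense[OF P S(3) yz(1) n] unfolding br_def by blast
    obtain i where i: "from_nat_into S i = q" using from_nat_into_surj[OF S(1) q(1)] by blast
    have "br m n q z \<noteq> br m n q y"
    proof
      assume "br m n q z = br m n q y"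
      then have "0 < br m n q z" using q by simp
      then have "c m n z = c m n q" "0 < \<psi> m n z" "c m n y = c m n q"
        using q(2) unfolding br_def labelled_partition.branch_def[OF P] by (auto split: if_splits)
      then show False
        using labelled_partition.label[OF P yz(1) n] labelled_partition.label[OF P yz(2)] m by metis
    qed
    moreover have "v (prod_encode (m, prod_encode (n, i))) = br m n q" by (simp add: v_def i)
    ultimately show "\<exists>k. v k y \<noteq> v k z" by metis
  qed (use nm in blast)
qed

lemma (in stratification) weight_separable:
  assumes "Hausdorff_space Z" "separable_space Z" "topspace Z \<noteq> {}"
  shows "\<exists>D. admissible_weight Z D \<and> totally_bounded_pseudometric Z D"
proof (cases "metrizable_space Z")
  case True
  then obtain M d where M: "Metric_space M d" and Z: "Z = Metric_space.mtopology M d"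
    unfolding metrizable_space_def by blast
  have "M \<noteq> {}" using assms(3) Z Metric_space.topspace_mtopology[OF M] by simp
  then show ?thesis using Metric_space.weight_separable_metric[OF M] assms(2) Z by simp
qed (rule weight_separable_nonmetrizable[OF assms(1) _ assms(2)])

section \<open>Partitions of bounded order\<close>

text \<open>An exhaustion function \<open>h\<close>, bounded on each finite union of members of a countable cover,
  reduces the refinement of that cover to the refinement of finite covers on the rings
  \<open>k - 1 < h < k + 1\<close>, at most two of which contain a given point.\<close>

lemma (in labelled_partition) countable_refinement:
  assumes sep: "separable_space Z" and ne: "topspace Z \<noteq> {}"
  obtains O' l h where "\<And>i::nat. openin Z (O' i)"
    "\<And>i z. z \<in> O' i \<Longrightarrow> l i \<in> J \<and> z \<in> U (l i)"
    "continuous_map Z euclideanreal h" "\<And>z. z \<in> topspace Z \<Longrightarrow> 0 < h z"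
    "\<And>k::nat. \<exists>m::nat. \<forall>z\<in>topspace Z. h z < real k \<longrightarrow> (\<exists>i<m. z \<in> O' i)"
proof -
  obtain S where S: "countable S" "S \<subseteq> topspace Z" "Z closure_of S = topspace Z"
    using sep unfolding separable_space_def by blast
  define \<phi> where "\<phi> i = (case prod_decode i of (n, k) \<Rightarrow> branch n (from_nat_into S k))" for i
  define l where "l i = (case prod_decode i of (n, k) \<Rightarrow> c n (from_nat_into S k))" for i
  have \<phi>c: "continuous_map Z euclideanreal (\<phi> i)" for i
    unfolding \<phi>_def using continuous_branch by (simp split: prod.split)
  have \<phi>b: "\<forall>i. \<forall>z\<in>topspace Z. 0 \<le> \<phi> i z \<and> \<phi> i z \<le> 1"
    unfolding \<phi>_def using branch_bounds by (simp split: prod.split)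
  define s where "s z = (\<Sum>i. (1/2)^Suc i * \<phi> i z)" for z
  note \<Sigma> = continuous_map_suminf[of Z \<phi>, OF \<phi>c \<phi>b, folded s_def]
  have spos: "0 < s z" if z: "z \<in> topspace Z" for z
  proof -
    obtain n where n: "0 < \<psi> n z" using pos[OF z] by blast
    obtain q where q: "q \<in> S" "0 < branch n q z" using branch_dense[OF S(3) z n] by blast
    obtain k where k: "from_nat_into S k = q" using from_nat_into_surj[OF S(1) q(1)] by blast
    have "\<phi> (prod_encode (n, k)) z = branch n q z" by (simp add: \<phi>_def k)
    then have "0 < (1/2)^Suc (prod_encode (n, k)) * \<phi> (prod_encode (n, k)) z" using q(2) by simp
    then show ?thesis using \<Sigma>(4)[OF z, of "prod_encode (n, k)"] by linarith
  qed
  show thesis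
  proof (rule that[of "\<lambda>i. {z \<in> topspace Z. 0 < \<phi> i z}" l "\<lambda>z. inverse (s z)"])
    show "openin Z {z \<in> topspace Z. 0 < \<phi> i z}" for i by (rule openin_real_less[OF \<phi>c])
    show "0 < inverse (s z)" if "z \<in> topspace Z" for z using spos[OF that] by simp
    show "continuous_map Z euclideanreal (\<lambda>z. inverse (s z))"
    proof (rule continuous_map_real_inverse)
      show "continuous_map Z euclideanreal s" unfolding s_def[abs_def] by (rule \<Sigma>(1)[unfolded s_def])
      show "s z \<noteq> 0" if "z \<in> topspace Z" for z using spos[OF that] by simp
    qed
  next
    fix i z assume zi: "z \<in> {z \<in> topspace Z. 0 < \<phi> i z}"
    obtain n k where nk: "prod_decode i = (n, k)" by fastforce
    have "0 < branch n (from_nat_into S k) z" using zi nk by (simp add: \<phi>_def)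
    then have "c n z = l i" "0 < \<psi> n z" using nk by (auto simp: branch_def l_def split: if_splits)
    then show "l i \<in> J \<and> z \<in> U (l i)" using label[of z n] zi by auto
  next
    fix k :: nat
    \<comment> \<open>If the first \<open>m\<close> functions vanish at \<open>z\<close>, only the
      tail of the series remains, so \<open>s z \<le> (1/2)^m\<close> and the exhaustion function
      \<open>inverse (s z)\<close> exceeds \<open>k + 1\<close>.\<close>
    obtain m where m: "(1/2::real)^m < 1 / (real k + 1)"
      using real_arch_pow_inv[of "1 / (real k + 1)" "1/2"] by auto
    have "\<exists>i<m. 0 < \<phi> i z" if z: "z \<in> topspace Z" and h: "inverse (s z) < real k" for z
    proof (rule ccontr)
      assume "\<not> (\<exists>i<m. 0 < \<phi> i z)"
      then have "\<phi> i z = 0" if "i < m" for i using \<phi>b z that by (metis order_antisym_conv not_le)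
      then have "s z \<le> (1/2)^m" using \<Sigma>(3)[OF z, of m] by simp
      then have "s z < 1 / (real k + 1)" using m by linarith
      then have "real k + 1 < inverse (s z)" using spos[OF z] by (simp add: field_simps)
      then show False using h by simp
    qed
    then show "\<exists>m. \<forall>z\<in>topspace Z. inverse (s z) < real k \<longrightarrow>
        (\<exists>i<m. z \<in> {z \<in> topspace Z. 0 < \<phi> i z})"
      by (intro exI[of _ m]) simp
  qed
qed

text \<open>A bound on the dimension refines only finite covers of the whole space. Below height
  \<open>k + 2\<close> a finite part of the countable cover suffices, and the open set
  \<open>far k\<close> completes it. The refinements are cut down to the rings afterwards, so the
  dimension is never applied to a subspace of \<open>Z\<close>.\<close>

theorem (in stratification) labelled_partition_bounded:
  fixes U :: "'j \<Rightarrow> 'a set"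
  assumes U: "\<And>j. j \<in> J \<Longrightarrow> openin Z (U j)" and cover: "topspace Z \<subseteq> (\<Union>j\<in>J. U j)"
    and sep: "separable_space Z" and dim: "finite_covering_dim Z"
  shows "\<exists>\<psi> c b. labelled_partition Z J U \<psi> c \<and>
    (\<forall>z\<in>topspace Z. finite {n. 0 < \<psi> n z} \<and> card {n. 0 < \<psi> n z} \<le> b)"
proof (rule labelled_partition_exists[of J U, OF U cover])
  fix \<psi>0 c0 assume P0: "labelled_partition Z J U \<psi>0 c0"
  show ?thesis
  proof (cases "topspace Z = {}")
    case True
    then show ?thesis using P0 by blast
  next
    case False
    show ?thesis
    proof (rule labelled_partition.countable_refinement[OF P0 sep False])
      fix O' :: "nat \<Rightarrow> 'a set" and l h
      assume O': "\<And>i. openin Z (O' i)" and l: "\<And>i z. z \<in> O' i \<Longrightarrow> l i \<in> J \<and> z \<in> U (l i)"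
        and hc: "continuous_map Z euclideanreal h" and hpos: "\<And>z. z \<in> topspace Z \<Longrightarrow> 0 < h z"
        and exh: "\<And>k::nat. \<exists>m::nat. \<forall>z\<in>topspace Z. h z < real k \<longrightarrow> (\<exists>i<m. z \<in> O' i)"
      obtain n where n: "covering_dim_le Z n" using dim unfolding finite_covering_dim_def by blast
      have "\<forall>k. \<exists>m. \<forall>z\<in>topspace Z. h z < real (k + 2) \<longrightarrow> (\<exists>i<m. z \<in> O' i)" using exh by blast
      from choice[OF this] obtain m where
        m: "\<forall>k. \<forall>z\<in>topspace Z. h z < real (k + 2) \<longrightarrow> (\<exists>i<m k. z \<in> O' i)" by blast
      define far where "far k = {z \<in> topspace Z. real k + 1 < h z}" for k :: nat
      define \<U> where "\<U> k = insert (far k) (O' ` {..<m k})" for k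
      have far: "openin Z (far k)" for k unfolding far_def by (rule openin_real_less[OF hc])
      have sub: "O' i \<subseteq> topspace Z" for i using openin_subset[OF O'] .
      have fc: "finite (\<U> k) \<and> (\<forall>V\<in>\<U> k. openin Z V) \<and> \<Union>(\<U> k) = topspace Z" for k
      proof (intro conjI subset_antisym)
        show "finite (\<U> k)" by (simp add: \<U>_def)
        show "\<forall>V\<in>\<U> k. openin Z V" using far O' by (auto simp: \<U>_def)
        show "\<Union>(\<U> k) \<subseteq> topspace Z" using sub by (auto simp: \<U>_def far_def)
        show "topspace Z \<subseteq> \<Union>(\<U> k)"
        proof
          fix z assume z: "z \<in> topspace Z"
          show "z \<in> \<Union>(\<U> k)"
          proof (cases "real k + 1 < h z")
            case True
            then show ?thesis using z by (auto simp: \<U>_def far_def)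
          next
            case False
            then have "h z < real (k + 2)" by simp
            then obtain i where "i < m k" "z \<in> O' i" using m z by blast
            then show ?thesis by (auto simp: \<U>_def)
          qed
        qed
      qed
      have "\<exists>\<V>. finite \<V> \<and> (\<forall>V\<in>\<V>. openin Z V) \<and> \<Union>\<V> = topspace Z \<and>
          (\<forall>V\<in>\<V>. \<exists>W\<in>\<U> k. V \<subseteq> W) \<and> (\<forall>z\<in>topspace Z. card {V \<in> \<V>. z \<in> V} \<le> n + 1)" for k
        by (rule n[unfolded covering_dim_le_def, THEN spec, THEN mp, OF fc])
      then have "\<forall>k. \<exists>\<V>. finite \<V> \<and> (\<forall>V\<in>\<V>. openin Z V) \<and> \<Union>\<V> = topspace Z \<and>
          (\<forall>V\<in>\<V>. \<exists>W\<in>\<U> k. V \<subseteq> W) \<and> (\<forall>z\<in>topspace Z. card {V \<in> \<V>. z \<in> V} \<le> n + 1)" by blast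
      from choice[OF this] obtain \<V> where V: "\<forall>k. finite (\<V> k) \<and> (\<forall>V\<in>\<V> k. openin Z V) \<and>
          \<Union>(\<V> k) = topspace Z \<and> (\<forall>V\<in>\<V> k. \<exists>W\<in>\<U> k. V \<subseteq> W) \<and>
          (\<forall>z\<in>topspace Z. card {V \<in> \<V> k. z \<in> V} \<le> n + 1)" by (elim exE) (rule that)
      have V_fin: "finite (\<V> k)" and V_open: "V \<in> \<V> k \<Longrightarrow> openin Z V"
        and V_cover: "\<Union>(\<V> k) = topspace Z" and V_ref: "V \<in> \<V> k \<Longrightarrow> \<exists>W\<in>\<U> k. V \<subseteq> W"
        and V_card: "z \<in> topspace Z \<Longrightarrow> card {V \<in> \<V> k. z \<in> V} \<le> n + 1" for k V z
        using V by auto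
      define ring where "ring k = {z \<in> topspace Z. real k - 1 < h z} \<inter> {z \<in> topspace Z. h z < real k + 1}"
        for k :: nat
      have ring: "openin Z (ring k)" for k
        unfolding ring_def by (intro openin_Int openin_real_less hc)
      \<comment> \<open>Only refining sets inside some \<open>O' i\<close> can be labelled. A point
        with \<open>k \<le> h z < k + 1\<close> is not in \<open>far k\<close>, so the refining sets
        of level \<open>k\<close> that contain it are all kept.\<close>
      define I where "I = {(k, V). V \<in> \<V> k \<and> (\<exists>i. V \<subseteq> O' i)}"
      have "I \<subseteq> Sigma UNIV \<V>" by (auto simp: I_def)
      moreover have "countable (Sigma UNIV \<V>)"
        using V_fin by (intro countable_SIGMA) (auto intro: countable_finite)
      ultimately have I: "countable I" by (rule countable_subset)
      define e where "e = to_nat_on I"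
      have e: "inj_on e I" unfolding e_def by (rule inj_on_to_nat_on[OF I])
      define good where "good w f \<longleftrightarrow> continuous_map Z euclideanreal f \<and>
          (\<forall>z\<in>topspace Z. 0 \<le> f z \<and> f z \<le> 1) \<and> (\<forall>z\<in>topspace Z. 0 < f z \<longleftrightarrow> z \<in> snd w \<inter> ring (fst w))"
        for w and f :: "'a \<Rightarrow> real"
      have "\<forall>w\<in>I. \<exists>f. good w f"
      proof
        fix w assume "w \<in> I"
        then have "snd w \<in> \<V> (fst w)" by (auto simp: I_def)
        then have "openin Z (snd w \<inter> ring (fst w))" using V_open ring by (intro openin_Int)
        then show "\<exists>f. good w f" by (rule cozero) (unfold good_def, blast)
      qed
      from bchoice[OF this] obtain f where f: "\<forall>w\<in>I. good w (f w)" by blast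
      have f_cont: "continuous_map Z euclideanreal (f w)"
        and f_bd: "z \<in> topspace Z \<Longrightarrow> 0 \<le> f w z \<and> f w z \<le> 1"
        and f_pos: "z \<in> topspace Z \<Longrightarrow> 0 < f w z \<longleftrightarrow> z \<in> snd w \<inter> ring (fst w)" if "w \<in> I" for w z
        using f that unfolding good_def by auto
      have "\<forall>w\<in>I. \<exists>i. snd w \<subseteq> O' i" by (auto simp: I_def)
      from bchoice[OF this] obtain L where L: "\<forall>w\<in>I. snd w \<subseteq> O' (L w)" by blast
      define ix where "ix j = inv_into I e j" for j
      have ix: "ix (e w) = w" if "w \<in> I" for w unfolding ix_def by (rule inv_into_f_f[OF e that])
      define \<psi> where "\<psi> j z = (if j \<in> e ` I then f (ix j) z else 0)" for j z
      define c where "c j z = l (L (ix j))" for j and z :: 'a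
      have \<psi>_e: "\<psi> (e w) z = f w z" if "w \<in> I" for w z using that ix by (simp add: \<psi>_def)
      have supp: "\<exists>w\<in>I. j = e w \<and> z \<in> snd w \<and> z \<in> ring (fst w)"
        if z: "z \<in> topspace Z" and p: "0 < \<psi> j z" for j z
      proof -
        have "j \<in> e ` I" using p by (auto simp: \<psi>_def split: if_splits)
        then obtain w where w: "w \<in> I" "j = e w" by blast
        then show ?thesis using f_pos[OF w(1) z] p \<psi>_e[OF w(1)] by auto
      qed
      have bd: "0 \<le> \<psi> j z \<and> \<psi> j z \<le> 1" if z: "z \<in> topspace Z" for j z
      proof (cases "j \<in> e ` I")
        case True
        then obtain w where w: "w \<in> I" "j = e w" by blast
        then show ?thesis using f_bd[OF w(1) z] \<psi>_e[OF w(1)] by simp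
      qed (simp add: \<psi>_def)
      have part: "labelled_partition Z J U \<psi> c"
      proof
        fix j
        show "continuous_map Z euclideanreal (\<psi> j)"
        proof (cases "j \<in> e ` I")
          case True
          then obtain w where w: "w \<in> I" "j = e w" by blast
          then have "\<psi> j z = f w z" for z using \<psi>_e[OF w(1), of z] by simp
          then have "\<psi> j = f w" by (rule ext)
          then show ?thesis using f_cont[OF w(1)] by simp
        next
          case False
          then have "\<psi> j = (\<lambda>z. 0)" by (auto simp: \<psi>_def)
          then show ?thesis by simp
        qed
      next
        show "0 \<le> \<psi> j z \<and> \<psi> j z \<le> 1" if "z \<in> topspace Z" for j z by (rule bd[OF that])
      next
        fix z assume z: "z \<in> topspace Z"
        obtain k0 :: nat where k0: "h z < real k0" using reals_Archimedean2 by blast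
        define N where "N = {y \<in> topspace Z. h y < real k0}"
        define A where "A = e ` (I \<inter> Sigma {..k0} \<V>)"
        have "finite A" unfolding A_def using V_fin by (intro finite_imageI finite_Int) auto
        then obtain b where b: "\<forall>j\<in>A. j < b" using finite_nat_set_iff_bounded by blast
        have "\<psi> j y = 0" if y: "y \<in> N" and j: "j \<ge> b" for y j
        proof (rule ccontr)
          have yZ: "y \<in> topspace Z" using y by (simp add: N_def)
          assume "\<psi> j y \<noteq> 0"
          then have "0 < \<psi> j y" using bd[OF yZ, of j] by simp
          then obtain w where w: "w \<in> I" "j = e w" "y \<in> ring (fst w)" using supp[OF yZ] by blast
          have "real (fst w) - 1 < real k0" using w(3) y by (simp add: ring_def N_def)
          then have "fst w \<le> k0" by linarith
          moreover have "snd w \<in> \<V> (fst w)" using w(1) by (auto simp: I_def)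
          ultimately have "w \<in> Sigma {..k0} \<V>" by (cases w) simp
          then have "j \<in> A" using w by (auto simp: A_def)
          then show False using b j by force
        qed
        moreover have "openin Z N" unfolding N_def by (rule openin_real_less[OF hc])
        moreover have "z \<in> N" using z k0 by (simp add: N_def)
        ultimately show "\<exists>N k. openin Z N \<and> z \<in> N \<and> (\<forall>y\<in>N. \<forall>n\<ge>k. \<psi> n y = 0)" by blast
      next
        fix z assume z: "z \<in> topspace Z"
        define k where "k = nat \<lfloor>h z\<rfloor>"
        have k: "real k \<le> h z" "h z < real k + 1" using hpos[OF z] unfolding k_def by linarith+
        obtain V where V: "V \<in> \<V> k" "z \<in> V" using V_cover[of k] z by blast
        obtain W where W: "W \<in> \<U> k" "V \<subseteq> W" using V_ref[OF V(1)] by blast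
        have "W \<noteq> far k" using V(2) W(2) k(2) by (auto simp: far_def)
        then obtain i where "W = O' i" using W(1) by (auto simp: \<U>_def)
        then have w: "(k, V) \<in> I" using V(1) W(2) by (auto simp: I_def)
        have "z \<in> ring k" using z k by (simp add: ring_def)
        then have "0 < \<psi> (e (k, V)) z" using f_pos[OF w z] \<psi>_e[OF w] V(2) by simp
        then show "\<exists>n. 0 < \<psi> n z" by blast
      next
        fix j z assume "z \<in> topspace Z"
        then show "\<exists>N i. openin Z N \<and> z \<in> N \<and> (\<forall>y\<in>N. 0 < \<psi> j y \<longrightarrow> c j y = i)"
          by (intro exI[of _ "topspace Z"] exI[of _ "l (L (ix j))"]) (simp add: c_def)
      next
        fix j z assume z: "z \<in> topspace Z" and p: "0 < \<psi> j z"
        obtain w where w: "w \<in> I" "j = e w" "z \<in> snd w" using supp[OF z p] by blast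
        then have "z \<in> O' (L w)" using L by blast
        moreover have "c j z = l (L w)" using w ix by (simp add: c_def)
        ultimately show "c j z \<in> J \<and> z \<in> U (c j z)" using l by simp
      qed
      \<comment> \<open>Only the rings \<open>k\<close> and \<open>Suc k\<close>, with
        \<open>k\<close> the integer part of \<open>h z\<close>, can contain \<open>z\<close>, and
        at each of these two levels at most \<open>n + 1\<close> refining sets do.\<close>
      have "finite {j. 0 < \<psi> j z} \<and> card {j. 0 < \<psi> j z} \<le> 2 * (n + 1)" if z: "z \<in> topspace Z" for z
      proof -
        define k where "k = nat \<lfloor>h z\<rfloor>"
        have k: "real k \<le> h z" "h z < real k + 1" using hpos[OF z] unfolding k_def by linarith+
        define B where "B = Sigma {k, Suc k} (\<lambda>k. {V \<in> \<V> k. z \<in> V})"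
        have "{j. 0 < \<psi> j z} \<subseteq> e ` B"
        proof
          fix j assume "j \<in> {j. 0 < \<psi> j z}"
          then obtain w where w: "w \<in> I" "j = e w" "z \<in> snd w" "z \<in> ring (fst w)"
            using supp[OF z] by blast
          have "real (fst w) - 1 < h z" "h z < real (fst w) + 1" using w(4) by (auto simp: ring_def)
          then have "fst w = k \<or> fst w = Suc k" using k by linarith
          moreover have "snd w \<in> \<V> (fst w)" using w(1) by (auto simp: I_def)
          ultimately have "w \<in> B" using w(3) by (cases w) (auto simp: B_def)
          then show "j \<in> e ` B" using w(2) by blast
        qed
        moreover have B: "finite B" unfolding B_def using V_fin by (intro finite_SigmaI) auto
        moreover have "card B \<le> 2 * (n + 1)"
        proof -
          have "card B = card {V \<in> \<V> k. z \<in> V} + card {V \<in> \<V> (Suc k). z \<in> V}"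
            unfolding B_def using V_fin by (subst card_SigmaI) auto
          then show ?thesis using V_card[OF z, of k] V_card[OF z, of "Suc k"] by simp
        qed
        ultimately show ?thesis
          using finite_subset[OF _ finite_imageI[OF B]] card_mono[OF finite_imageI[OF B]]
            card_image_le[OF B, of e] by (meson order_trans)
      qed
      then show ?thesis using part by blast
    qed
  qed
qed

section \<open>Completeness and total boundedness\<close>

context extension_data
begin

text \<open>The value of \<open>\<xi> e y\<close> can change only at \<open>r y\<close> and at the
  left endpoints of nonempty steps: if the index grew from \<open>t0\<close> to \<open>t\<close>,
  the left endpoint of the step at \<open>t\<close> would lie between them.\<close>

lemma step_constant:
  assumes y: "y \<in> topspace Y" and t: "0 \<le> t0" "t0 \<le> t" "t < 1"
    and no_r: "\<not> (t0 < r y \<and> r y \<le> t)"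
    and no_u: "\<And>n. y \<notin> X \<Longrightarrow> u n y < u (Suc n) y \<Longrightarrow> \<not> (t0 < u n y \<and> u n y \<le> t)"
  shows "\<xi> e y t = \<xi> e y t0" "t < r y \<longleftrightarrow> t0 < r y"
proof -
  show iff: "t < r y \<longleftrightarrow> t0 < r y" using no_r t by auto
  show "\<xi> e y t = \<xi> e y t0"
  proof (cases "y \<in> X")
    case False
    note yW = in_W[OF y False]
    have t0: "t0 < 1" using t by simp
    have t1: "0 \<le> t" using t by simp
    have "idx y t = idx y t0"
    proof (rule ccontr)
      assume ne: "idx y t \<noteq> idx y t0"
      have "\<not> idx y t < idx y t0"
      proof
        assume "idx y t < idx y t0"
        then have "u (Suc (idx y t)) y \<le> u (idx y t0) y" by (intro u_mono_le[OF yW]) simp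
        then show False using idx_props[OF yW t1 t(3)] idx_props[OF yW t(1) t0] t(2) by linarith
      qed
      then have "u (Suc (idx y t0)) y \<le> u (idx y t) y" using ne by (intro u_mono_le[OF yW]) simp
      then have "t0 < u (idx y t) y" using idx_props[OF yW t(1) t0] by linarith
      then show False
        using no_u[OF False idx_less[OF yW t1 t(3)]] idx_props[OF yW t1 t(3)] by blast
    qed
    then show ?thesis using iff by (simp add: \<xi>_def)
  qed simp
qed

text \<open>A point is coded by the classes of its step functions at the grid points \<open>j / k\<close>.  The step
  functions of two points with the same code are close outside the intervals of length \<open>1 / k\<close> that
  start at their breakpoints.\<close>

lemma preserves_totally_bounded:
  assumes D: "totally_bounded_pseudometric Y D"
    and m: "\<And>y. y \<in> topspace Y - X \<Longrightarrow>
      finite {n. u n y < u (Suc n) y} \<and> card {n. u n y < u (Suc n) y} \<le> m"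
  shows "preserves totally_bounded_pseudometric (subtopology Y X) Y T"
  unfolding preserves_def
proof (intro ballI impI)
  fix p assume tb: "totally_bounded_pseudometric (subtopology Y X) p"
  then have p: "pseudometric (subtopology Y X) p" by (simp add: totally_bounded_pseudometric_def)
  have net_X: "\<exists>A. finite A \<and> A \<subseteq> X \<and> (\<forall>z\<in>X. \<exists>s\<in>A. p (z, s) < e)" if "e > 0" for e
    using tb that unfolding totally_bounded_pseudometric_def topspace_X by blast
  have net_D: "\<exists>A. finite A \<and> A \<subseteq> topspace Y \<and> (\<forall>z\<in>topspace Y. \<exists>s\<in>A. D (z, s) < e)" if "e > 0" for e
    using D that unfolding totally_bounded_pseudometric_def by blast
  show "totally_bounded_pseudometric Y (T p)"
    unfolding totally_bounded_pseudometric_def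
  proof (intro conjI allI impI)
    show "pseudometric Y (T p)" by (rule pseudometric_T[OF p])
    fix e :: real assume e: "e > 0"
    have pab: "0 \<le> p (a, b)" using p_nonneg[OF p ab(1,2)] .
    define e1 where "e1 = e / 8"
    \<comment> \<open>Two points of \<open>X\<close> in one class are less than
      \<open>2 * e1 = e / 4\<close> apart, and the term with \<open>D\<close> contributes at most
      \<open>2 * e2 * p (a, b) \<le> e / 4\<close>, so \<open>e / 2\<close> remains for the
      exceptional set. The summand 1 covers \<open>p (a, b) = 0\<close>.\<close>
    define e2 where "e2 = e / (8 * (p (a, b) + 1))"
    have e1: "e1 > 0" using e by (simp add: e1_def)
    have e2: "e2 > 0" using e pab by (simp add: e2_def)
    have e2': "2 * e2 * p (a, b) \<le> e / 4"
    proof -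
      have "e2 * p (a, b) \<le> e2 * (p (a, b) + 1)" using e2 by (intro mult_left_mono) auto
      also have "\<dots> = e / 8"
      proof -
        have *: "v / (8 * q) * q = v / 8" if "q > 0" for v q :: real using that by simp
        have "p (a, b) + 1 > 0" using pab by simp
        then show ?thesis unfolding e2_def by (rule *)
      qed
      finally show ?thesis by simp
    qed
    obtain A where A: "finite A" "A \<subseteq> X" "\<forall>z\<in>X. \<exists>s\<in>A. p (z, s) < e1" using net_X[OF e1] by blast
    have "\<forall>z\<in>X. \<exists>s. s \<in> A \<and> p (z, s) < e1" using A(3) by blast
    from bchoice[OF this] obtain cl where cl: "\<forall>z\<in>X. cl z \<in> A \<and> p (z, cl z) < e1" by blast
    obtain A' where A': "finite A'" "A' \<subseteq> topspace Y" "\<forall>z\<in>topspace Y. \<exists>s\<in>A'. D (z, s) < e2"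
      using net_D[OF e2] by blast
    have "\<forall>z\<in>topspace Y. \<exists>s. s \<in> A' \<and> D (z, s) < e2" using A'(3) by blast
    from bchoice[OF this] obtain cl' where cl': "\<forall>z\<in>topspace Y. cl' z \<in> A' \<and> D (z, cl' z) < e2" by blast
    have same: "p (s, s') < 2 * e1" if s: "s \<in> X" "s' \<in> X" "cl s = cl s'" for s s'
    proof -
      have c: "cl s \<in> X" "p (s, cl s) < e1" "p (s', cl s) < e1" using cl s A(2) by auto
      have "p (s, s') \<le> p (s, cl s) + p (cl s, s')" by (rule p_tri[OF p s(1) c(1) s(2)])
      then show ?thesis using c p_sym[OF p s(2) c(1)] by linarith
    qed
    have same': "D (y, y') < 2 * e2" if y: "y \<in> topspace Y" "y' \<in> topspace Y" "cl' y = cl' y'" for y y'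
    proof -
      have c: "cl' y \<in> topspace Y" "D (y, cl' y) < e2" "D (y', cl' y) < e2" using cl' y A'(2) by auto
      have "D (y, y') \<le> D (y, cl' y) + D (cl' y, y')" "D (y', cl' y) = D (cl' y, y')"
        using D_pseudometric y c(1) unfolding pseudometric_def by blast+
      then show ?thesis using c by linarith
    qed
    \<comment> \<open>A bound for \<open>p\<close> on \<open>X\<close>: the maximum over the finite
      net, enlarged by the distances of two points to it.\<close>
    define B where "B = Max (p ` (A \<times> A)) + 2 * e1"
    have B: "p (s, s') \<le> B" if s: "s \<in> X" "s' \<in> X" for s s'
    proof -
      have c: "cl s \<in> A" "cl s' \<in> A" "p (s, cl s) < e1" "p (s', cl s') < e1" using cl s by auto
      then have cX: "cl s \<in> X" "cl s' \<in> X" using A(2) by auto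
      have "p (s, s') \<le> p (s, cl s) + (p (cl s, cl s') + p (cl s', s'))"
        using p_tri[OF p s(1) cX(1) s(2)] p_tri[OF p cX s(2)] by linarith
      moreover have "p (cl s, cl s') \<le> Max (p ` (A \<times> A))" using A(1) c by (intro Max_ge) auto
      ultimately show ?thesis using c p_sym[OF p s(2) cX(2)] unfolding B_def by linarith
    qed
    have B0: "0 \<le> B" using B[OF ab(1,2)] pab by linarith
    \<comment> \<open>Each exceptional set has measure at most \<open>(m + 2) / k\<close>, and
      \<open>Q p\<close> is at most \<open>B\<close> there; this choice makes
      \<open>2 * B * (m + 2) / k\<close> less than \<open>e / 2\<close>.\<close>
    obtain k0 :: nat where k0: "4 * (B + 1) * (real m + 2) / e < real k0" using reals_Archimedean2 by blast
    define k where "k = Suc k0"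
    have k: "4 * (B + 1) * (real m + 2) / e < real k" "real k > 0" using k0 by (auto simp: k_def)
    define g where "g j = real j / real k" for j :: nat
    define code where "code y = (cl' y, map (\<lambda>j. (g j < r y, cl (\<xi> a y (g j)), cl (\<xi> b y (g j)))) [0..<k])" for y
    have g: "0 \<le> g j" "g j < 1" if "j < k" for j using that k(2) by (auto simp: g_def)
    define P where "P y = (if y \<in> X then {} else insert (r y) ((\<lambda>n. u n y) ` {n. u n y < u (Suc n) y}))" for y
    define bad where "bad y = {0..<1} \<inter> (\<Union>v\<in>P y. {v..v + 1 / real k})" for y
    have P: "finite (P y)" "card (P y) \<le> m + 2" if y: "y \<in> topspace Y" for y
    proof -
      have "finite (P y) \<and> card (P y) \<le> m + 2"
      proof (cases "y \<in> X")
        case False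
        then have fin: "finite {n. u n y < u (Suc n) y}" and "card {n. u n y < u (Suc n) y} \<le> m"
          using m[of y] y by auto
        then have "card ((\<lambda>n. u n y) ` {n. u n y < u (Suc n) y}) \<le> m"
          using card_image_le[OF fin, of "\<lambda>n. u n y"] by linarith
        then show ?thesis
          using False fin card_insert_le_m1[of "m + 2" "(\<lambda>n. u n y) ` {n. u n y < u (Suc n) y}" "r y"]
          by (simp add: P_def)
      qed (simp add: P_def)
      then show "finite (P y)" "card (P y) \<le> m + 2" by auto
    qed
    have bad_sets: "bad y \<in> sets unit_lborel" if "y \<in> topspace Y" for y
      unfolding bad_def using P(1)[OF that] by (intro sets_unit_lborel sets.Int sets.finite_UN) auto
    have bad_measure: "measure unit_lborel (bad y) \<le> (real m + 2) / real k" if y: "y \<in> topspace Y" for y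
    proof -
      have fin: "(\<Union>v\<in>P y. {v..v + 1 / real k}) \<in> fmeasurable lborel"
        using P(1)[OF y] by (intro fmeasurable.finite_UN fmeasurableI) (auto simp: emeasure_lborel_Icc_eq)
      have "measure unit_lborel (bad y) = measure lborel (bad y)"
        by (rule measure_unit_lborel) (auto simp: bad_def)
      also have "\<dots> \<le> measure lborel (\<Union>v\<in>P y. {v..v + 1 / real k})"
      proof (rule measure_mono_fmeasurable[OF _ _ fin])
        show "bad y \<in> sets lborel" unfolding bad_def
          using P(1)[OF y] by (intro sets.Int sets.finite_UN) auto
      qed (auto simp: bad_def)
      also have "\<dots> \<le> (\<Sum>v\<in>P y. measure lborel {v..v + 1 / real k})"
        by (rule measure_UNION_le[OF P(1)[OF y]]) auto
      also have "\<dots> = real (card (P y)) / real k" by simp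
      also have "\<dots> \<le> (real m + 2) / real k"
        using P(2)[OF y] by (intro divide_right_mono) auto
      finally show ?thesis .
    qed
    have good: "\<xi> e' y t = \<xi> e' y (g j)" "t < r y \<longleftrightarrow> g j < r y"
      if y: "y \<in> topspace Y" and t: "t \<in> {0..<1}" "t \<notin> bad y" and j: "j = nat \<lfloor>t * real k\<rfloor>" for e' y t j
    proof -
      have "real j \<le> t * real k" "t * real k < real j + 1" using t j k(2) by (auto simp: of_nat_nat)
      then have gj: "g j \<le> t" "t < g j + 1 / real k" using k(2) by (auto simp: g_def field_simps)
      have no: "\<not> (g j < v \<and> v \<le> t)" if "v \<in> P y" for v
      proof
        assume "g j < v \<and> v \<le> t"
        then have "t \<in> {v..v + 1 / real k}" using gj by auto
        then show False using t that unfolding bad_def by blast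
      qed
      have no_r: "\<not> (g j < r y \<and> r y \<le> t)"
      proof (cases "y \<in> X")
        case True
        then have "r y = 0" using r_0[OF y] by blast
        moreover have "0 \<le> g j" by (simp add: g_def)
        ultimately show ?thesis by simp
      next
        case False
        then show ?thesis by (intro no) (simp add: P_def)
      qed
      have no_u: "\<not> (g j < u n y \<and> u n y \<le> t)" if "y \<notin> X" "u n y < u (Suc n) y" for n
        using that by (intro no) (auto simp: P_def)
      have "0 \<le> g j" "t < 1" using t by (auto simp: g_def)
      from step_constant[OF y this(1) gj(1) this(2) no_r no_u]
      show "\<xi> e' y t = \<xi> e' y (g j)" "t < r y \<longleftrightarrow> g j < r y" by blast+
    qed
    show "\<exists>A. finite A \<and> A \<subseteq> topspace Y \<and> (\<forall>z\<in>topspace Y. \<exists>a\<in>A. T p (z, a) < e)"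
    proof (rule finite_net_of_code[of code])
      have "code y \<in> A' \<times> {xs. set xs \<subseteq> UNIV \<times> A \<times> A \<and> length xs = k}" if y: "y \<in> topspace Y" for y
      proof -
        have "cl (\<xi> e y (g j)) \<in> A" if "e \<in> X" "j < k" for e j
          using cl \<xi>_in[OF y that(1) g[OF that(2)]] by blast
        then show ?thesis using cl' y ab by (auto simp: code_def)
      qed
      then have "code ` topspace Y \<subseteq> A' \<times> {xs. set xs \<subseteq> UNIV \<times> A \<times> A \<and> length xs = k}" by blast
      moreover have "finite (A' \<times> {xs :: (bool \<times> 'a \<times> 'a) list. set xs \<subseteq> UNIV \<times> A \<times> A \<and> length xs = k})"
        using A(1) A'(1) by (intro finite_cartesian_product finite_lists_length_eq) auto
      ultimately show "finite (code ` topspace Y)" by (rule finite_subset)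
      fix y y' assume y: "y \<in> topspace Y" "y' \<in> topspace Y" and eq: "code y = code y'"
      define h where "h t = e / 2 + B * indicator (bad y \<union> bad y') t" for t :: real
      have le: "Q p y y' t \<le> h t" if t: "t \<in> {0..<1}" for t
      proof (cases "t \<in> bad y \<union> bad y'")
        case True
        have "Q p y y' t \<le> B"
        proof (rule Q_le[OF y])
          fix s assume "s \<in> supp y \<times> supp y'"
          then show "p s \<le> B" using B supp_X[OF y(1)] supp_X[OF y(2)] by auto
        qed (use t in auto)
        then show ?thesis using True e by (simp add: h_def)
      next
        case False
        define j where "j = nat \<lfloor>t * real k\<rfloor>"
        have "t * real k < real k" using t k(2) by simp
        moreover have "0 \<le> t * real k" using t by simp
        ultimately have jk: "j < k" unfolding j_def by (simp add: nat_less_iff floor_less_iff)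
        have "(g j < r y, cl (\<xi> a y (g j)), cl (\<xi> b y (g j))) = (g j < r y', cl (\<xi> a y' (g j)), cl (\<xi> b y' (g j)))"
          using arg_cong[OF eq, of "\<lambda>w. snd w ! j"] jk by (simp add: code_def)
        then have "cl (\<xi> a y t) = cl (\<xi> a y' t)" "cl (\<xi> b y t) = cl (\<xi> b y' t)"
          using good[OF y(1) t _ j_def] good[OF y(2) t _ j_def] False by auto
        moreover have "\<xi> e' y t \<in> X" "\<xi> e' y' t \<in> X" if "e' \<in> X" for e' using \<xi>_in y that t by auto
        ultimately have "p (\<xi> a y t, \<xi> a y' t) < 2 * e1" "p (\<xi> b y t, \<xi> b y' t) < 2 * e1"
          using same ab by auto
        moreover have "cl' y = cl' y'" using eq by (simp add: code_def)
        then have "D (y, y') * p (a, b) \<le> 2 * e2 * p (a, b)"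
          using same'[OF y] pab by (intro mult_right_mono) auto
        then have "(if t < min (r y) (r y') then D (y, y') * K p else 0) \<le> e / 4"
          using e2' e K_p[OF p] by auto
        ultimately have "Q p y y' t \<le> e1 + e1 + e / 4" unfolding Q_def by linarith
        then show ?thesis using False by (simp add: h_def e1_def)
      qed
      have un: "bad y \<union> bad y' \<in> sets unit_lborel" using bad_sets y by (intro sets.Un)
      have i: "integrable unit_lborel (\<lambda>t. B * indicator (bad y \<union> bad y') t)"
        by (intro integrable_mult_right integrable_indicator_unit un)
      have ih: "integrable unit_lborel h" unfolding h_def[abs_def]
        by (intro Bochner_Integration.integrable_add i) simp
      have "T p (y, y') \<le> (LINT t|unit_lborel. h t)"
        unfolding T_eq[OF y]
        by (rule integral_mono[OF integrable_step[OF simple_Q[OF y]] ih]) (use le in simp)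
      also have "\<dots> = (LINT t|unit_lborel. e / 2) + (LINT t|unit_lborel. B * indicator (bad y \<union> bad y') t)"
        unfolding h_def by (intro Bochner_Integration.integral_add i) simp
      also have "\<dots> = e / 2 + B * measure unit_lborel (bad y \<union> bad y')"
        using un sets.sets_into_space[OF un] by (simp add: Int_absorb2)
      also have "\<dots> \<le> e / 2 + B * (2 * ((real m + 2) / real k))"
      proof -
        have "measure unit_lborel (bad y \<union> bad y') \<le> measure unit_lborel (bad y) + measure unit_lborel (bad y')"
          by (rule measure_Un_le) (use bad_sets y in auto)
        then have "measure unit_lborel (bad y \<union> bad y') \<le> 2 * ((real m + 2) / real k)"
          using bad_measure[OF y(1)] bad_measure[OF y(2)] by linarith
        then show ?thesis using B0 by (intro add_left_mono mult_left_mono)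
      qed
      also have "\<dots> < e"
      proof -
        have "4 * (B + 1) * (real m + 2) < e * real k" using k e by (simp add: field_simps)
        moreover have "4 * B * (real m + 2) \<le> 4 * (B + 1) * (real m + 2)" by (intro mult_right_mono) auto
        ultimately have "4 * B * (real m + 2) < e * real k" by linarith
        then have "4 * B * (real m + 2) / real k < e" using k(2) by (simp add: pos_divide_less_eq)
        moreover have "B * (2 * ((real m + 2) / real k)) = (4 * B * (real m + 2) / real k) / 2" by simp
        moreover have "e / 2 + w < e" if "v < e" "w = v / 2" for v w :: real using that by simp
        ultimately show ?thesis by blast
      qed
      finally show "T p (y, y') < e" .
    qed
  qed
qed

text \<open>Along a Cauchy sequence \<open>r\<close> converges.  If the limit is positive, the sequence is Cauchy for
  \<open>d\<close>, and otherwise it approaches the compact set \<open>X\<close>.\<close>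

lemma mcomplete_T:
  assumes M: "Metric_space M d" and Y: "Y = Metric_space.mtopology M d"
    and compl: "Metric_space.mcomplete M d" and comp: "compactin Y X"
    and D_eq: "D = (\<lambda>(y, z). min 1 (d y z))" and r_eq: "r = (\<lambda>y. min 1 (Metric_space.dist_to d X y))"
    and m: "metric_fun (subtopology Y X) p" and contp: "continuous_fun Y (T p)"
    and mT: "metric_fun Y (T p)"
  shows "Metric_space.mcomplete (topspace Y) (dist_fun Y (T p))"
proof -
  interpret M: Metric_space M d by (rule M)
  interpret E: Metric_space "topspace Y" "dist_fun Y (T p)" using mT by (simp add: metric_fun_def)
  have YM: "topspace Y = M" unfolding Y by simp
  have p: "pseudometric (subtopology Y X) p" using m unfolding metric_fun_iff by blast
  have pab: "0 < p (a, b)" by (rule metric_pos[OF m])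
  have X: "closedin M.mtopology X" "X \<noteq> {}" using closed_X ab Y by auto
  show ?thesis
    unfolding E.mcomplete_def
  proof (intro allI impI)
    fix \<sigma> assume C: "E.MCauchy \<sigma>"
    then have \<sigma>: "\<sigma> n \<in> topspace Y" for n unfolding E.MCauchy_def by auto
    have small: "\<exists>N. \<forall>i j. N \<le> i \<longrightarrow> N \<le> j \<longrightarrow> T p (\<sigma> i, \<sigma> j) < e" if e: "e > 0" for e
    proof -
      obtain N where "\<forall>i j. N \<le> i \<longrightarrow> N \<le> j \<longrightarrow> dist_fun Y (T p) (\<sigma> i) (\<sigma> j) < e"
        using C[unfolded E.MCauchy_def, THEN conjunct2, THEN spec, THEN mp, OF e] by blast
      then show ?thesis using \<sigma> by (intro exI[of _ N]) (simp add: dist_fun_def)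
    qed
    have low: "min (r (\<sigma> i)) (r (\<sigma> j)) * D (\<sigma> i, \<sigma> j) + \<bar>r (\<sigma> i) - r (\<sigma> j)\<bar> / 2 < e"
      if "T p (\<sigma> i, \<sigma> j) < p (a, b) * e" for i j e
    proof -
      have "p (a, b) * (min (r (\<sigma> i)) (r (\<sigma> j)) * D (\<sigma> i, \<sigma> j) + \<bar>r (\<sigma> i) - r (\<sigma> j)\<bar> / 2) < p (a, b) * e"
        using T_lower[OF p \<sigma> \<sigma>] that by (rule le_less_trans)
      then show ?thesis using pab by simp
    qed
    have nnD: "0 \<le> min (r (\<sigma> i)) (r (\<sigma> j)) * D (\<sigma> i, \<sigma> j)" for i j
      using r_bounds[OF \<sigma>[of i]] r_bounds[OF \<sigma>[of j]] D_nonneg[OF \<sigma> \<sigma>] by simp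
    have "Cauchy (\<lambda>n. r (\<sigma> n))"
      unfolding Cauchy_def
    proof (intro allI impI)
      fix e :: real assume "e > 0"
      then have "p (a, b) * (e / 2) > 0" using pab by simp
      from small[OF this] obtain N where N: "\<forall>i j. N \<le> i \<longrightarrow> N \<le> j \<longrightarrow> T p (\<sigma> i, \<sigma> j) < p (a, b) * (e / 2)" by blast
      have "\<bar>r (\<sigma> i) - r (\<sigma> j)\<bar> < e" if "i \<ge> N" "j \<ge> N" for i j
        using low[of i j "e / 2"] N that nnD[of i j] by (smt (verit) field_sum_of_halves)
      then show "\<exists>N. \<forall>i\<ge>N. \<forall>j\<ge>N. dist (r (\<sigma> i)) (r (\<sigma> j)) < e"
        by (auto simp: dist_real_def)
    qed
    then obtain \<rho> where \<rho>: "(\<lambda>n. r (\<sigma> n)) \<longlonglongrightarrow> \<rho>"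
      using Cauchy_convergent_iff convergent_def by blast
    have "\<rho> \<ge> 0" by (rule LIMSEQ_le_const[OF \<rho>]) (use r_bounds \<sigma> in blast)
    have "\<exists>k y. strict_mono k \<and> y \<in> M \<and> limitin M.mtopology (\<sigma> \<circ> k) y sequentially"
    proof (cases "\<rho> > 0")
      case True
      have "eventually (\<lambda>n. \<rho> / 2 < r (\<sigma> n)) sequentially"
        using order_tendstoD(1)[OF \<rho>, of "\<rho> / 2"] True by simp
      then obtain N0 where N0: "\<forall>n\<ge>N0. \<rho> / 2 < r (\<sigma> n)" by (auto simp: eventually_sequentially)
      have "M.MCauchy \<sigma>"
        unfolding M.MCauchy_def
      proof (intro conjI allI impI)
        show "range \<sigma> \<subseteq> M" using \<sigma> YM by auto
        fix e :: real assume e: "e > 0"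
        \<comment> \<open>Eventually \<open>r\<close> exceeds \<open>\<rho> / 2\<close> along the
          sequence, so \<open>D < min 1 e\<close>; being below 1, the truncated distance
          \<open>D\<close> is \<open>d\<close> itself.\<close>
        define e' where "e' = \<rho> / 2 * min 1 e"
        have "p (a, b) * e' > 0" using True e pab by (simp add: e'_def)
        from small[OF this] obtain N where N: "\<forall>i j. N \<le> i \<longrightarrow> N \<le> j \<longrightarrow> T p (\<sigma> i, \<sigma> j) < p (a, b) * e'" by blast
        have "d (\<sigma> i) (\<sigma> j) < e" if ij: "max N N0 \<le> i" "max N N0 \<le> j" for i j
        proof -
          have "min (r (\<sigma> i)) (r (\<sigma> j)) * D (\<sigma> i, \<sigma> j) + \<bar>r (\<sigma> i) - r (\<sigma> j)\<bar> / 2 < e'"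
            using N ij by (intro low) simp
          moreover have "0 \<le> \<bar>r (\<sigma> i) - r (\<sigma> j)\<bar> / 2" by simp
          ultimately have "min (r (\<sigma> i)) (r (\<sigma> j)) * D (\<sigma> i, \<sigma> j) < e'" by linarith
          moreover have "\<rho> / 2 \<le> min (r (\<sigma> i)) (r (\<sigma> j))" using N0 ij by (simp add: less_imp_le)
          then have "\<rho> / 2 * D (\<sigma> i, \<sigma> j) \<le> min (r (\<sigma> i)) (r (\<sigma> j)) * D (\<sigma> i, \<sigma> j)"
            by (rule mult_right_mono[OF _ D_nonneg[OF \<sigma> \<sigma>]])
          ultimately have "\<rho> / 2 * D (\<sigma> i, \<sigma> j) < \<rho> / 2 * min 1 e" unfolding e'_def by linarith
          then have "D (\<sigma> i, \<sigma> j) < min 1 e" using True by (simp add: mult_less_cancel_left_pos)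
          then show ?thesis by (auto simp: D_eq min_def split: if_splits)
        qed
        then show "\<exists>N. \<forall>n n'. N \<le> n \<longrightarrow> N \<le> n' \<longrightarrow> d (\<sigma> n) (\<sigma> n') < e"
          by (intro exI[of _ "max N N0"]) blast
      qed
      then obtain y where y: "limitin M.mtopology \<sigma> y sequentially" using compl unfolding M.mcomplete_def by blast
      then have "y \<in> M" using M.limitin_mspace by blast
      then show ?thesis using y by (intro exI[of _ id] exI[of _ y]) (simp add: strict_mono_id)
    next
      case False
      then have \<rho>0: "(\<lambda>n. r (\<sigma> n)) \<longlonglongrightarrow> 0" using \<rho> \<open>\<rho> \<ge> 0\<close> by simp
      \<comment> \<open>Nearly closest points of \<open>X\<close>: the error
        \<open>1 / real (Suc n)\<close> tends to 0, as does the distance of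
        \<open>\<sigma> n\<close> to \<open>X\<close>, and a subsequence of these points converges
        by compactness.\<close>
      have "\<exists>s. s \<in> X \<and> d (\<sigma> n) s < M.dist_to X (\<sigma> n) + 1 / real (Suc n)" for n
        using M.dist_to_less[OF X, of "\<sigma> n" "M.dist_to X (\<sigma> n) + 1 / real (Suc n)"] by auto
      then have "\<forall>n. \<exists>s. s \<in> X \<and> d (\<sigma> n) s < M.dist_to X (\<sigma> n) + 1 / real (Suc n)" by blast
      from choice[OF this] obtain s where s: "\<forall>n. s n \<in> X \<and> d (\<sigma> n) (s n) < M.dist_to X (\<sigma> n) + 1 / real (Suc n)"
        by blast
      have "range s \<subseteq> X" using s by blast
      then obtain l k where l: "l \<in> X" "strict_mono k" "limitin M.mtopology (s \<circ> k) l sequentially"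
        using comp unfolding Y M.compactin_sequentially by blast
      have lM: "l \<in> M" using l(1) X_sub YM by blast
      have "limitin M.mtopology (\<sigma> \<circ> k) l sequentially"
        unfolding M.limit_metric_sequentially
      proof (intro conjI allI impI lM)
        fix e :: real assume e: "e > 0"
        have e3: "e / 3 > 0" using e by simp
        have "\<exists>N. \<forall>n\<ge>N. (s \<circ> k) n \<in> M \<and> d ((s \<circ> k) n) l < e / 3"
          using l(3)[unfolded M.limit_metric_sequentially, THEN conjunct2, THEN spec, THEN mp, OF e3] .
        then obtain N1 where N1: "\<forall>n\<ge>N1. d (s (k n)) l < e / 3" by auto
        have "eventually (\<lambda>n. r (\<sigma> n) < min 1 (e / 3)) sequentially"
          using order_tendstoD(2)[OF \<rho>0, of "min 1 (e / 3)"] e by simp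
        then obtain N2 where N2: "\<forall>n\<ge>N2. r (\<sigma> n) < min 1 (e / 3)" by (auto simp: eventually_sequentially)
        obtain N3 :: nat where N3: "3 / e < real N3" using reals_Archimedean2 by blast
        have "d (\<sigma> (k n)) l < e" if n: "n \<ge> max N1 (max N2 N3)" for n
        proof -
          have kn: "n \<le> k n" by (rule seq_suble[OF l(2)])
          have "r (\<sigma> (k n)) < min 1 (e / 3)" using N2 kn n by simp
          then have 1: "M.dist_to X (\<sigma> (k n)) < e / 3" unfolding r_eq by (auto simp: min_def split: if_splits)
          have "3 / e < real (Suc (k n))" using N3 kn n by simp
          then have 2: "1 / real (Suc (k n)) < e / 3" using e by (simp add: field_simps)
          have 3: "d (\<sigma> (k n)) (s (k n)) < M.dist_to X (\<sigma> (k n)) + 1 / real (Suc (k n))" using s by blast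
          have 4: "d (s (k n)) l < e / 3" using N1 n by simp
          have "s (k n) \<in> M" "\<sigma> (k n) \<in> M" using s X_sub YM \<sigma> by auto
          then have "d (\<sigma> (k n)) l \<le> d (\<sigma> (k n)) (s (k n)) + d (s (k n)) l" using lM by (intro M.triangle)
          then show ?thesis using 1 2 3 4 by linarith
        qed
        moreover have "\<sigma> n \<in> M" for n using \<sigma> YM by auto
        ultimately show "\<exists>N. \<forall>n\<ge>N. (\<sigma> \<circ> k) n \<in> M \<and> d ((\<sigma> \<circ> k) n) l < e"
          by (intro exI[of _ "max N1 (max N2 N3)"]) simp
      qed
      then show ?thesis using l(2) lM by blast
    qed
    then obtain k y where k: "strict_mono k" "y \<in> M" "limitin Y (\<sigma> \<circ> k) y sequentially"
      unfolding Y by blast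
    have yY: "y \<in> topspace Y" using k(2) YM by simp
    \<comment> \<open>So far the subsequence converges in \<open>Y\<close>. Continuity of
      \<open>T p\<close> at \<open>(y, y)\<close>, where it vanishes, turns this into convergence
      for \<open>T p\<close>, and a Cauchy sequence converges along with its subsequence.\<close>
    have "limitin E.mtopology (\<sigma> \<circ> k) y sequentially"
      unfolding E.limit_metric_sequentially
    proof (intro conjI allI impI yY)
      fix e :: real assume e: "e > 0"
      have "(y, y) \<in> topspace (prod_topology Y Y)" using yY by simp
      from continuous_map_real_at[OF contp[unfolded continuous_fun_def] this e]
      obtain N where N: "openin (prod_topology Y Y) N" "(y, y) \<in> N" "\<forall>w\<in>N. \<bar>T p w - T p (y, y)\<bar> < e" by blast
      obtain A A' where A: "openin Y A" "openin Y A'" "y \<in> A" "y \<in> A'" "A \<times> A' \<subseteq> N"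
        using N(1)[unfolded openin_prod_topology_alt, rule_format, OF N(2)] by blast
      have T0: "T p (y, y) = 0" using pseudometric_T[OF p] yY unfolding pseudometric_def by blast
      have "eventually (\<lambda>n. (\<sigma> \<circ> k) n \<in> A) sequentially" using k(3) A(1,3) unfolding limitin_def by blast
      then obtain N1 where N1: "\<forall>n\<ge>N1. (\<sigma> \<circ> k) n \<in> A" by (auto simp: eventually_sequentially)
      have "(\<sigma> \<circ> k) n \<in> topspace Y \<and> dist_fun Y (T p) ((\<sigma> \<circ> k) n) y < e" if "n \<ge> N1" for n
      proof -
        have "((\<sigma> \<circ> k) n, y) \<in> N" using N1 that A(4,5) by blast
        then have "\<bar>T p ((\<sigma> \<circ> k) n, y) - 0\<bar> < e" using N(3) T0 by metis
        then show ?thesis using \<sigma> yY by (simp add: dist_fun_def)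
      qed
      then show "\<exists>N. \<forall>n\<ge>N. (\<sigma> \<circ> k) n \<in> topspace Y \<and> dist_fun Y (T p) ((\<sigma> \<circ> k) n) y < e" by blast
    qed
    then show "\<exists>y. limitin E.mtopology \<sigma> y sequentially"
      using E.MCauchy_convergent_subsequence[OF C k(1)] by blast
  qed
qed

end

lemma (in extension_data) preserves_complete:
  assumes good: "good_extension_operator (subtopology Y X) Y T"
    and M: "Metric_space M d" and Y: "Y = Metric_space.mtopology M d"
    and compl: "Metric_space.mcomplete M d" and comp: "compactin Y X"
    and D_eq: "D = (\<lambda>(y, z). min 1 (d y z))" and r_eq: "r = (\<lambda>y. min 1 (Metric_space.dist_to d X y))"
  shows "preserves complete_admissible_metric (subtopology Y X) Y T"
  unfolding preserves_def complete_admissible_metric_def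
proof (intro ballI impI)
  fix p assume p: "p \<in> rfun (sq (subtopology Y X))"
    and "admissible_metric (subtopology Y X) p \<and>
      Metric_space.mcomplete (topspace (subtopology Y X)) (dist_fun (subtopology Y X) p)"
  then have ad: "admissible_metric (subtopology Y X) p" by blast
  then have m: "metric_fun (subtopology Y X) p" by (simp add: admissible_metric_def dominating_metric_def)
  have "metrizable_space Y" unfolding Y by (rule Metric_space.metrizable_space_mtopology[OF M])
  then have "preserves admissible_metric (subtopology Y X) Y T"
    using good unfolding good_extension_operator_def by blast
  then have adT: "admissible_metric Y (T p)" using p ad unfolding preserves_def by blast
  then have "continuous_fun Y (T p)" "metric_fun Y (T p)"
    by (simp_all add: admissible_metric_def dominating_metric_def)
  from mcomplete_T[OF M Y compl comp D_eq r_eq m this] adT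
  show "admissible_metric Y (T p) \<and> Metric_space.mcomplete (topspace Y) (dist_fun Y (T p))" by blast
qed

text \<open>The two conditions on \<open>T\<close> depend on how it was built, so the extension data
  and the description of the nonempty steps are handed on together with the operator. The labels are
  the points of the complement.\<close>

lemma extension_data_exists:
  assumes X: "closedin Y X" and ab: "a \<in> X" "b \<in> X" "a \<noteq> b"
    and ap: "approach_system Y X r U x" and D: "admissible_weight Y D"
    and P: "labelled_partition (subtopology Y (topspace Y - X)) (topspace Y - X) U \<psi> c"
  obtains u where "extension_data Y X (topspace Y - X) U u c a b r D x"
    "\<And>z n. z \<in> topspace Y - X \<Longrightarrow> u n z < u (Suc n) z \<longleftrightarrow> 0 < \<psi> n z"
    "good_extension_operator (subtopology Y X) Y (extension_data.T Y X u c a b r D x)"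
proof -
  note ap_cover = ap[unfolded approach_system_def, THEN conjunct2, THEN conjunct2, THEN conjunct1,
      THEN bspec, THEN conjunct2, THEN conjunct2, THEN conjunct2]
  note ap_near = ap[unfolded approach_system_def, THEN conjunct2, THEN conjunct2, THEN conjunct2,
      THEN conjunct1, THEN bspec, THEN spec, THEN mp]
  note ap_metric = ap[unfolded approach_system_def, THEN conjunct2, THEN conjunct2, THEN conjunct2,
      THEN conjunct2, THEN mp, THEN bspec, THEN spec, THEN mp]
  have "\<exists>u. breakpoints (subtopology Y (topspace Y - X)) (topspace Y - X) U u c \<and>
      (\<forall>z\<in>topspace Y - X. \<forall>n. u n z < u (Suc n) z \<longleftrightarrow> 0 < \<psi> n z)"
    by (rule labelled_partition.breakpoints_exist[OF P]) auto
  then obtain u where u: "breakpoints (subtopology Y (topspace Y - X)) (topspace Y - X) U u c"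
    "\<forall>z\<in>topspace Y - X. \<forall>n. u n z < u (Suc n) z \<longleftrightarrow> 0 < \<psi> n z" by blast
  have ED: "extension_data Y X (topspace Y - X) U u c a b r D x"
    using u(1)
  proof (rule extension_data.intro)
    show "extension_data_axioms Y X (topspace Y - X) U a b r D x"
    proof
      show "closedin Y X" "a \<in> X" "b \<in> X" "a \<noteq> b" by fact+
      show "continuous_map Y euclideanreal r" using ap by (simp add: approach_system_def)
      show "0 \<le> r y \<and> r y \<le> 1" "r y = 0 \<longleftrightarrow> y \<in> X" if "y \<in> topspace Y" for y
        using ap that by (simp_all add: approach_system_def)
      show "continuous_fun Y D" "metric_fun Y D" using D by (simp_all add: admissible_weight_def)
      show "D (y, y') \<le> 1" if "y \<in> topspace Y" "y' \<in> topspace Y" for y y'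
        using D that by (simp add: admissible_weight_def)
      show "x j \<in> X" if "j \<in> topspace Y - X" for j
        by (rule ap_cover[OF that])
      show "\<exists>N. openin Y N \<and> s \<in> N \<and> (\<forall>j\<in>topspace Y - X. U j \<inter> N \<noteq> {} \<longrightarrow> x j \<in> V)"
        if "s \<in> X" "openin Y V" "s \<in> V" for s V
        using that by (intro ap_near conjI)
    qed
  qed
  interpret extension_data Y X "topspace Y - X" U u c a b r D x by (rule ED)
  have "good_extension_operator (subtopology Y X) Y T"
  proof (rule good_extension_operator_T)
    show "dominating_metric Y D" if "metrizable_space Y"
      using D that by (simp add: admissible_weight_def)
    show "\<exists>\<delta>>0. \<exists>V'. openin Y V' \<and> s \<in> V' \<and> (\<forall>y\<in>topspace Y - X. \<forall>j\<in>topspace Y - X.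
        r y < \<delta> \<and> y \<in> U j \<and> x j \<in> V' \<longrightarrow> y \<in> V)"
      if "metrizable_space Y" "s \<in> X" "openin Y V" "s \<in> V" for s V
      using that by (intro ap_metric conjI)
  qed
  then show thesis by (rule that[OF ED, rotated]) (use u(2) in simp)
qed

section \<open>The extension theorem\<close>

lemma approach_system_cover:
  assumes X: "closedin Y X" and ap: "approach_system Y X r U x"
  shows "\<And>w. w \<in> topspace Y - X \<Longrightarrow> openin (subtopology Y (topspace Y - X)) (U w)"
    and "topspace (subtopology Y (topspace Y - X)) \<subseteq> (\<Union>w\<in>topspace Y - X. U w)"
proof -
  have W: "openin Y (topspace Y - X)" using X by blast
  note U = ap[unfolded approach_system_def, THEN conjunct2, THEN conjunct2, THEN conjunct1, THEN bspec]
  show "openin (subtopology Y (topspace Y - X)) (U w)" if "w \<in> topspace Y - X" for w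
    unfolding openin_open_subtopology[OF W] using U[OF that] by simp
  show "topspace (subtopology Y (topspace Y - X)) \<subseteq> (\<Union>w\<in>topspace Y - X. U w)"
  proof
    fix w assume "w \<in> topspace (subtopology Y (topspace Y - X))"
    then have w: "w \<in> topspace Y - X" by simp
    then show "w \<in> (\<Union>w\<in>topspace Y - X. U w)" using U[OF w] by blast
  qed
qed

theorem theorem3p1:
  fixes Y :: "'a topology" and X :: "'a set"
  assumes "stratifiable_space Y"
    and "closedin Y X"
    and "\<exists>a\<in>X. \<exists>b\<in>X. a \<noteq> b"
  shows "(\<exists>T. good_extension_operator (subtopology Y X) Y T) \<and>
    (completely_metrizable_space Y \<and> compactin Y X \<longrightarrow>
       (\<exists>T. good_extension_operator (subtopology Y X) Y T \<and>
            preserves complete_admissible_metric (subtopology Y X) Y T)) \<and>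
    (separable_space Y \<and> finite_covering_dim (subtopology Y (topspace Y - X)) \<longrightarrow>
       (\<exists>T. good_extension_operator (subtopology Y X) Y T \<and>
            preserves totally_bounded_pseudometric (subtopology Y X) Y T))"
proof (intro conjI impI)
  let ?W = "topspace Y - X"
  let ?Z = "subtopology Y ?W"
  obtain G where "stratification Y G" using stratifiable_space_imp_stratification[OF assms(1)] by blast
  then interpret Y: stratification Y G .
  have W: "openin Y ?W" using assms(2) by blast
  interpret W: stratification ?Z G by (rule Y.stratification_subtopology[OF W])
  have H: "Hausdorff_space Y" using assms(1) by (simp add: stratifiable_space_def)
  have t1: "t1_space Y" by (rule Hausdorff_imp_t1_space[OF H])
  obtain a b where ab: "a \<in> X" "b \<in> X" "a \<noteq> b" using assms(3) by blast
  then have X0: "X \<noteq> {}" by blast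
  obtain r U x where ap: "approach_system Y X r U x"
    using Y.approach_system_exists[OF t1 assms(2) X0] by blast
  show "\<exists>T. good_extension_operator (subtopology Y X) Y T"
  proof -
    obtain D where D: "admissible_weight Y D" using Y.weight_exists[OF H] by blast
    show ?thesis
    proof (rule W.labelled_partition_exists[OF approach_system_cover[OF assms(2) ap]])
      fix \<psi> c assume "labelled_partition ?Z ?W U \<psi> c"
      then show ?thesis by (rule extension_data_exists[OF assms(2) ab ap D]) blast
    qed
  qed
  show "\<exists>T. good_extension_operator (subtopology Y X) Y T \<and>
      preserves complete_admissible_metric (subtopology Y X) Y T"
    if comp: "completely_metrizable_space Y \<and> compactin Y X"
  proof -
    obtain M d where M: "Metric_space M d" and compl: "Metric_space.mcomplete M d"
      and Y: "Y = Metric_space.mtopology M d"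
      using comp unfolding completely_metrizable_space_def by blast
    interpret M: Metric_space M d by (rule M)
    have closed: "closedin M.mtopology X" using assms(2) Y by simp
    \<comment> \<open>Here \<open>r\<close> and \<open>D\<close> are built from the complete metric
      \<open>d\<close> itself, not from an arbitrary approach system: \<open>mcomplete_T\<close>
      reads off from them that a sequence is Cauchy for \<open>d\<close> or approaches
      \<open>X\<close>.\<close>
    obtain U x where ap: "approach_system Y X (\<lambda>y. min 1 (M.dist_to X y)) U x"
      using M.approach_system_metric[OF closed X0] unfolding Y by blast
    have D: "admissible_weight Y (\<lambda>(y, z). min 1 (d y z))" unfolding Y by (rule M.weight_metric)
    show ?thesis
    proof (rule W.labelled_partition_exists[OF approach_system_cover[OF assms(2) ap]])
      fix \<psi> c assume P: "labelled_partition ?Z ?W U \<psi> c"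
      show ?thesis
      proof (rule extension_data_exists[OF assms(2) ab ap D P])
        fix u assume E: "extension_data Y X ?W U u c a b (\<lambda>y. min 1 (M.dist_to X y))
            (\<lambda>(y, z). min 1 (d y z)) x"
          and good: "good_extension_operator (subtopology Y X) Y (extension_data.T Y X u c a b
            (\<lambda>y. min 1 (M.dist_to X y)) (\<lambda>(y, z). min 1 (d y z)) x)"
        show ?thesis
          using good extension_data.preserves_complete[OF E good M Y compl _ refl refl] comp by blast
      qed
    qed
  qed
  show "\<exists>T. good_extension_operator (subtopology Y X) Y T \<and>
      preserves totally_bounded_pseudometric (subtopology Y X) Y T"
    if sep: "separable_space Y \<and> finite_covering_dim (subtopology Y ?W)"
  proof -
    have "topspace Y \<noteq> {}" using ab closedin_subset[OF assms(2)] by blast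
    \<comment> \<open>The term with \<open>D\<close> is part of \<open>T p\<close>, hence a totally
      bounded \<open>D\<close> is chosen, which separability makes possible.\<close>
    then obtain D where D: "admissible_weight Y D" "totally_bounded_pseudometric Y D"
      using Y.weight_separable[OF H] sep by blast
    have sepW: "separable_space ?Z" using separable_space_open_subset[OF _ W] sep by blast
    obtain \<psi> c m where P: "labelled_partition ?Z ?W U \<psi> c"
      and m: "\<forall>z\<in>topspace ?Z. finite {n. 0 < \<psi> n z} \<and> card {n. 0 < \<psi> n z} \<le> m"
      using W.labelled_partition_bounded[OF approach_system_cover[OF assms(2) ap] sepW] sep by blast
    show ?thesis
    proof (rule extension_data_exists[OF assms(2) ab ap D(1) P])
      fix u assume E: "extension_data Y X ?W U u c a b r D x"
        and u: "\<And>z n. z \<in> ?W \<Longrightarrow> u n z < u (Suc n) z \<longleftrightarrow> 0 < \<psi> n z"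
        and good: "good_extension_operator (subtopology Y X) Y (extension_data.T Y X u c a b r D x)"
      have "finite {n. u n y < u (Suc n) y} \<and> card {n. u n y < u (Suc n) y} \<le> m" if y: "y \<in> ?W" for y
        using m y unfolding u[OF y] by simp
      from extension_data.preserves_totally_bounded[OF E D(2) this] good show ?thesis by blast
    qed
  qed
qed

end
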